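(* Let $T$ be a transitive (two-sided) subshift of finite type on a space $\Sigma$, and $\mu$ a Gibbs measure for a Hölder-continuous potential. Consider a continuous linear cocycle $M$ on the trivial vector bundle $\Sigma\times\mathbb R^d$ above $T$. Assume that $M$ has exponential large deviations for all exponents, both in positive and negative times. Let $\epsilon>0$ and $\delta>0$. Then there exists $C>0$ such that, for all $n\in\mathbb N$, $$\mu\{x:\ \mathrm{Card}\{j\in[0,n-1]: A_\epsilon(T^jx)>C\}\geq\delta n\}\leq Ce^{-C^{-1}n}.$$
   Context: Subshift and Gibbs measure. $\Sigma=\{x\in\mathcal A^{\mathbb Z}: Q(x_n,x_{n+1})=1\ \forall n\}$ for a finite alphabet $\mathcal A$ and a $0$-$1$ matrix $Q$, $T$ is the left shift, assumed topologically transitive. The Gibbs measure of a Hölder-continuous $\phi$ is the unique $T$-invariant probability measure $\mu$ for which there are constants $P\in\mathbb R$, $C>0$ with $C^{-1}\leq \mu[a_0,\dots,a_{n-1}]/e^{S_n\phi(x)-nP}\leq C$ for every cylinder and every $x$ in it, where $S_n\phi=\sum_{j<n}\phi\circ T^j$. Cocycle. $M(x)$ is an invertible $d\times d$ matrix depending continuously on $x$; $M^n(x)=M(T^{n-1}x)\dotsm M(x)$ for $n\geq0$ and $M^{-n}(x)=M(T^{-n}x)^{-1}\dotsm M(T^{-1}x)^{-1}$. The Lyapunov exponents $\lambda_1\geq\dotsb\geq\lambda_d$ are defined by $\frac1n\log\|\Lambda^iM^n(x)\|\to\lambda_1+\dotsb+\lambda_i$ for $\mu$-a.e. $x$ as $n\to+\infty$,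 where $\Lambda^i$ is the $i$-th exterior power. Exponential large deviations for all exponents. In positive times: for every $1\leq i\leq d$ and $\eta>0$ there is $C>0$ such that for all $n\geq0$, $\mu\{x:|\log\|\Lambda^iM^n(x)\|-n(\lambda_1+\dotsb+\lambda_i)|\geq n\eta\}\leq Ce^{-C^{-1}n}$. In negative times: the same for the inverse cocycle over $T^{-1}$, i.e. for every $i$ and $\eta>0$ there is $C>0$ such that for all $n\geq 0$, $\mu\{x:|\log\|\Lambda^iM^{-n}(x)\|+n(\lambda_d+\dotsb+\lambda_{d-i+1})|\geq n\eta\}\leq Ce^{-C^{-1}n}$. Pesin function. Let $I=\{i:\lambda_i<\lambda_{i-1}\}$ (with $\lambda_0=+\infty$), so that $(\lambda_i)_{i\in I}$ are the distinct exponents. For $\mu$-a.e. $x$ and $i\in I$, let $E_i(x)$ be the Oseledets subspace for $\lambda_i$: it consists of $0$ and the vectors $v\neq 0$ with $\frac1n\log\|M^n(x)v\|\to\lambda_i$ as $n\to\pm\infty$. Define, for $\mu$-a.e. $x$, $$A_\epsilon(x)=\sup_{i\in I}\ \sup_{v\in E_i(x)\setminus\{0\}}\ \sup_{m,n\in\mathbb Z}\frac{\|M^n(x)v\|}{\|M^m(x)v\|}e^{-(n-m)\lambda_i}e^{-(|n|+|m|)\epsilon/2}\in[0,\infty].$$ *)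

theory Defs
  imports "HOL-Probability.Probability"
begin

section \<open>Subshifts of finite type\<close>

text \<open>A 0-1 matrix over the alphabet is a binary relation \<open>Q\<close>; \<open>Q a b\<close> says that the entry is 1.\<close>

definition sft :: "('a \<Rightarrow> 'a \<Rightarrow> bool) \<Rightarrow> (int \<Rightarrow> 'a) set" where
  "sft Q = {x. \<forall>n. Q (x n) (x (n + 1))}"

definition sft_topology :: "('a \<Rightarrow> 'a \<Rightarrow> bool) \<Rightarrow> (int \<Rightarrow> 'a) topology" where
  "sft_topology Q =
     subtopology (product_topology (\<lambda>_. discrete_topology UNIV) UNIV) (sft Q)"

text \<open>\<open>shift_pow k\<close> is the \<open>k\<close>-th iterate of the left shift \<open>T = shift_pow 1\<close>.\<close>

definition shift_pow :: "int \<Rightarrow> (int \<Rightarrow> 'a) \<Rightarrow> (int \<Rightarrow> 'a)" where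
  "shift_pow k x = (\<lambda>n. x (n + k))"

definition sft_transitive :: "('a \<Rightarrow> 'a \<Rightarrow> bool) \<Rightarrow> bool" where
  "sft_transitive Q \<longleftrightarrow>
     (\<forall>U V. openin (sft_topology Q) U \<and> U \<noteq> {} \<and> openin (sft_topology Q) V \<and> V \<noteq> {} \<longrightarrow>
        (\<exists>n::nat. shift_pow (int n) ` U \<inter> V \<noteq> {}))"

definition shift_dist :: "(int \<Rightarrow> 'a) \<Rightarrow> (int \<Rightarrow> 'a) \<Rightarrow> real" where
  "shift_dist x y =
     (if x = y then 0 else (1 / 2) ^ (LEAST m::nat. \<exists>k. \<bar>k\<bar> = int m \<and> x k \<noteq> y k))"

definition hoelder_on_sft :: "('a \<Rightarrow> 'a \<Rightarrow> bool) \<Rightarrow> ((int \<Rightarrow> 'a) \<Rightarrow> real) \<Rightarrow> bool" where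
  "hoelder_on_sft Q \<phi> \<longleftrightarrow>
     (\<exists>\<alpha> K. 0 < \<alpha> \<and> \<alpha> \<le> 1 \<and>
        (\<forall>x\<in>sft Q. \<forall>y\<in>sft Q. \<bar>\<phi> x - \<phi> y\<bar> \<le> K * shift_dist x y powr \<alpha>))"

section \<open>Gibbs measures\<close>

definition cylinder :: "('a \<Rightarrow> 'a \<Rightarrow> bool) \<Rightarrow> 'a list \<Rightarrow> (int \<Rightarrow> 'a) set" where
  "cylinder Q as = {x \<in> sft Q. \<forall>j<length as. x (int j) = as ! j}"

definition birkhoff_sum :: "((int \<Rightarrow> 'a) \<Rightarrow> real) \<Rightarrow> nat \<Rightarrow> (int \<Rightarrow> 'a) \<Rightarrow> real" where
  "birkhoff_sum \<phi> n x = (\<Sum>j<n. \<phi> (shift_pow (int j) x))"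

text \<open>The \<open>\<sigma>\<close>-algebra is the Borel one. For a transitive subshift and a Hoelder potential the
  measure is unique; uniqueness is a theorem and is not part of the definition.\<close>

definition gibbs_measure ::
  "('a \<Rightarrow> 'a \<Rightarrow> bool) \<Rightarrow> ((int \<Rightarrow> 'a) \<Rightarrow> real) \<Rightarrow> (int \<Rightarrow> 'a) measure \<Rightarrow> bool" where
  "gibbs_measure Q \<phi> \<mu> \<longleftrightarrow>
     space \<mu> = sft Q \<and>
     sets \<mu> = sigma_sets (sft Q) {U. openin (sft_topology Q) U} \<and>
     prob_space \<mu> \<and>
     distr \<mu> \<mu> (shift_pow 1) = \<mu> \<and>
     (\<exists>P C. C > 0 \<and>
        (\<forall>as. \<forall>x\<in>cylinder Q as.
           let r = measure \<mu> (cylinder Q as) /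
                   exp (birkhoff_sum \<phi> (length as) x - real (length as) * P)
           in 1 / C \<le> r \<and> r \<le> C))"

section \<open>Linear cocycles\<close>

definition continuous_linear_cocycle ::
  "('a \<Rightarrow> 'a \<Rightarrow> bool) \<Rightarrow> ((int \<Rightarrow> 'a) \<Rightarrow> real^'d^'d) \<Rightarrow> bool" where
  "continuous_linear_cocycle Q M \<longleftrightarrow>
     continuous_map (sft_topology Q) euclidean M \<and> (\<forall>x\<in>sft Q. invertible (M x))"

primrec cocycle_fwd :: "((int \<Rightarrow> 'a) \<Rightarrow> real^'d^'d) \<Rightarrow> nat \<Rightarrow> (int \<Rightarrow> 'a) \<Rightarrow> real^'d^'d" where
  "cocycle_fwd M 0 x = mat 1"
| "cocycle_fwd M (Suc n) x = M (shift_pow (int n) x) ** cocycle_fwd M n x"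

primrec cocycle_bwd :: "((int \<Rightarrow> 'a) \<Rightarrow> real^'d^'d) \<Rightarrow> nat \<Rightarrow> (int \<Rightarrow> 'a) \<Rightarrow> real^'d^'d" where
  "cocycle_bwd M 0 x = mat 1"
| "cocycle_bwd M (Suc n) x = matrix_inv (M (shift_pow (- int (Suc n)) x)) ** cocycle_bwd M n x"

definition cocycle :: "((int \<Rightarrow> 'a) \<Rightarrow> real^'d^'d) \<Rightarrow> int \<Rightarrow> (int \<Rightarrow> 'a) \<Rightarrow> real^'d^'d" where
  "cocycle M n x = (if n \<ge> 0 then cocycle_fwd M (nat n) x else cocycle_bwd M (nat (- n)) x)"

section \<open>Exterior powers\<close>

text \<open>
  The \<open>i\<close>-th tensor power of \<open>real^'d\<close> consists of the coefficient arrays \<open>u\<close> indexed by the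
  multi-indices \<open>f \<in> {..<i} \<rightarrow>\<^sub>E UNIV\<close>. The \<open>i\<close>-th exterior power is its subspace of antisymmetric
  tensors, where \<open>v\<^sub>0 \<and> \<dots> \<and> v\<^sub>i\<^sub>-\<^sub>1\<close> is the alternating sum over the permutations of the \<open>v\<^sub>k\<close>.
  The exterior power of \<open>A\<close> is the restriction of its tensor power to this subspace. The
  Euclidean norm of tensors makes the \<open>e\<^sub>J\<close>, for \<open>J\<close> an \<open>i\<close>-element set of indices, orthogonal
  of common length \<open>sqrt (i!)\<close>, so the operator norm is the one for which they are orthonormal.
\<close>

definition multi_indices :: "nat \<Rightarrow> (nat \<Rightarrow> 'd) set" where
  "multi_indices i = ({..<i} \<rightarrow>\<^sub>E UNIV)"

definition antisymmetric_tensors :: "nat \<Rightarrow> ((nat \<Rightarrow> 'd) \<Rightarrow> real) set" where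
  "antisymmetric_tensors i =
     {u. \<forall>\<sigma>. \<sigma> permutes {..<i} \<longrightarrow>
           (\<forall>f\<in>multi_indices i. u (f \<circ> \<sigma>) = of_int (sign \<sigma>) * u f)}"

definition tensor_power ::
  "nat \<Rightarrow> real^'d^'d \<Rightarrow> ((nat \<Rightarrow> 'd) \<Rightarrow> real) \<Rightarrow> ((nat \<Rightarrow> 'd) \<Rightarrow> real)" where
  "tensor_power i A u = (\<lambda>f. \<Sum>g\<in>multi_indices i. (\<Prod>k<i. A $ f k $ g k) * u g)"

definition tensor_norm :: "nat \<Rightarrow> ((nat \<Rightarrow> 'd) \<Rightarrow> real) \<Rightarrow> real" where
  "tensor_norm i u = L2_set u (multi_indices i)"

definition ext_power_norm :: "nat \<Rightarrow> real^'d^'d \<Rightarrow> real" where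
  "ext_power_norm i A =
     Sup {tensor_norm i (tensor_power i A u) | u.
            u \<in> antisymmetric_tensors i \<and> tensor_norm i u \<le> 1}"

definition wedge :: "nat \<Rightarrow> (nat \<Rightarrow> real^'d) \<Rightarrow> ((nat \<Rightarrow> 'd) \<Rightarrow> real)" where
  "wedge i v = (\<lambda>f. \<Sum>\<sigma> | \<sigma> permutes {..<i}. of_int (sign \<sigma>) * (\<Prod>k<i. v (\<sigma> k) $ f k))"

lemma wedge_antisymmetric: "wedge i v \<in> antisymmetric_tensors i"
proof -
  have "wedge i v (f \<circ> \<tau>) = of_int (sign \<tau>) * wedge i v f" if \<tau>: "\<tau> permutes {..<i}" for \<tau> f
  proof -
    have perm: "permutation \<sigma>" if "\<sigma> permutes {..<i}" for \<sigma>
      using that finite_lessThan permutation_permutes by blast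
    have "wedge i v (f \<circ> \<tau>) =
        (\<Sum>\<sigma> | \<sigma> permutes {..<i}.
           of_int (sign (\<sigma> \<circ> \<tau>)) * (\<Prod>k<i. v (\<sigma> (\<tau> k)) $ f (\<tau> k)))"
      unfolding wedge_def by (subst sum_permutations_compose_right[OF \<tau>]) simp
    also have "\<dots> = (\<Sum>\<sigma> | \<sigma> permutes {..<i}.
           of_int (sign \<tau>) * (of_int (sign \<sigma>) * (\<Prod>k<i. v (\<sigma> k) $ f k)))"
    proof (intro sum.cong refl)
      fix \<sigma> assume "\<sigma> \<in> {\<sigma>. \<sigma> permutes {..<i}}"
      then have "sign (\<sigma> \<circ> \<tau>) = sign \<sigma> * sign \<tau>"
        using perm \<tau> by (simp add: sign_compose)
      moreover have "(\<Prod>k<i. v (\<sigma> (\<tau> k)) $ f (\<tau> k)) = (\<Prod>k<i. v (\<sigma> k) $ f k)"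
        using prod.permute[OF \<tau>, of "\<lambda>k. v (\<sigma> k) $ f k"] by (simp add: comp_def)
      ultimately show "of_int (sign (\<sigma> \<circ> \<tau>)) * (\<Prod>k<i. v (\<sigma> (\<tau> k)) $ f (\<tau> k)) =
          of_int (sign \<tau>) * (of_int (sign \<sigma>) * (\<Prod>k<i. v (\<sigma> k) $ f k))"
        by simp
    qed
    finally show ?thesis
      by (simp add: wedge_def sum_distrib_left)
  qed
  then show ?thesis
    by (simp add: antisymmetric_tensors_def)
qed

lemma tensor_power_wedge:
  "tensor_power i A (wedge i v) f = wedge i (\<lambda>k. A *v v k) f"
proof -
  have "tensor_power i A (wedge i v) f =
    (\<Sum>g\<in>multi_indices i. \<Sum>\<sigma> | \<sigma> permutes {..<i}. of_int (sign \<sigma>) * (\<Prod>k<i. A $ f k $ g k * v (\<sigma> k) $ g k))"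
    by (simp add: tensor_power_def wedge_def sum_distrib_left prod.distrib mult_ac)
  also have "\<dots> = (\<Sum>\<sigma> | \<sigma> permutes {..<i}. of_int (sign \<sigma>) *
      (\<Sum>g\<in>multi_indices i. \<Prod>k<i. A $ f k $ g k * v (\<sigma> k) $ g k))"
    by (subst sum.swap) (simp add: sum_distrib_left)
  also have "\<dots> = wedge i (\<lambda>k. A *v v k) f"
    by (simp add: wedge_def multi_indices_def prod_sum_PiE matrix_vector_mult_def)
  finally show ?thesis .
qed

section \<open>Lyapunov exponents and large deviations\<close>

text \<open>The exponents are \<open>\<lambda> 1, \<dots>, \<lambda> d\<close> with \<open>d = CARD('d)\<close>; other values of \<open>\<lambda>\<close> are irrelevant.\<close>

definition lyapunov_exponents ::
  "(int \<Rightarrow> 'a) measure \<Rightarrow> ((int \<Rightarrow> 'a) \<Rightarrow> real^'d^'d) \<Rightarrow> (nat \<Rightarrow> real) \<Rightarrow> bool" where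
  "lyapunov_exponents \<mu> M lam \<longleftrightarrow>
     (\<forall>i\<in>{1..<CARD('d)}. lam (i + 1) \<le> lam i) \<and>
     (\<forall>i\<in>{1..CARD('d)}. AE x in \<mu>.
        (\<lambda>n::nat. ln (ext_power_norm i (cocycle M (int n) x)) / real n)
          \<longlonglongrightarrow> (\<Sum>k=1..i. lam k))"

definition exp_large_deviations_pos ::
  "(int \<Rightarrow> 'a) measure \<Rightarrow> ((int \<Rightarrow> 'a) \<Rightarrow> real^'d^'d) \<Rightarrow> (nat \<Rightarrow> real) \<Rightarrow> bool" where
  "exp_large_deviations_pos \<mu> M lam \<longleftrightarrow>
     (\<forall>i\<in>{1..CARD('d)}. \<forall>\<eta>>0. \<exists>C>0. \<forall>n::nat.
        measure \<mu> {x \<in> space \<mu>.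
          \<bar>ln (ext_power_norm i (cocycle M (int n) x)) - real n * (\<Sum>k=1..i. lam k)\<bar> \<ge> real n * \<eta>}
        \<le> C * exp (- (1 / C) * real n))"

definition exp_large_deviations_neg ::
  "(int \<Rightarrow> 'a) measure \<Rightarrow> ((int \<Rightarrow> 'a) \<Rightarrow> real^'d^'d) \<Rightarrow> (nat \<Rightarrow> real) \<Rightarrow> bool" where
  "exp_large_deviations_neg \<mu> M lam \<longleftrightarrow>
     (\<forall>i\<in>{1..CARD('d)}. \<forall>\<eta>>0. \<exists>C>0. \<forall>n::nat.
        measure \<mu> {x \<in> space \<mu>.
          \<bar>ln (ext_power_norm i (cocycle M (- int n) x))
             + real n * (\<Sum>k=CARD('d) - i + 1..CARD('d). lam k)\<bar> \<ge> real n * \<eta>}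
        \<le> C * exp (- (1 / C) * real n))"

section \<open>Oseledets subspaces and the Pesin function\<close>

text \<open>The case \<open>i = 1\<close> is the convention \<open>\<lambda> 0 = \<infinity>\<close>.\<close>

definition distinct_exponent_indices :: "nat \<Rightarrow> (nat \<Rightarrow> real) \<Rightarrow> nat set" where
  "distinct_exponent_indices d lam = {i \<in> {1..d}. i = 1 \<or> lam i < lam (i - 1)}"

text \<open>Defined at every \<open>x\<close>, but a subspace only for almost every \<open>x\<close>.\<close>

definition oseledets_space ::
  "((int \<Rightarrow> 'a) \<Rightarrow> real^'d^'d) \<Rightarrow> real \<Rightarrow> (int \<Rightarrow> 'a) \<Rightarrow> (real^'d) set" where
  "oseledets_space M l x =
     {0} \<union> {v. v \<noteq> 0 \<and>
       ((\<lambda>n::int. ln (norm (cocycle M n x *v v)) / of_int n) \<longlongrightarrow> l) at_top \<and>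
       ((\<lambda>n::int. ln (norm (cocycle M n x *v v)) / of_int n) \<longlongrightarrow> l) at_bot}"

definition pesin_function ::
  "((int \<Rightarrow> 'a) \<Rightarrow> real^'d^'d) \<Rightarrow> (nat \<Rightarrow> real) \<Rightarrow> real \<Rightarrow> (int \<Rightarrow> 'a) \<Rightarrow> ennreal" where
  "pesin_function M lam \<epsilon> x =
     (SUP i \<in> distinct_exponent_indices CARD('d) lam.
      SUP v \<in> oseledets_space M (lam i) x - {0}.
      SUP (m, n) \<in> (UNIV :: (int \<times> int) set).
        ennreal (norm (cocycle M n x *v v) / norm (cocycle M m x *v v)
                 * exp (- (of_int (n - m) * lam i))
                 * exp (- (of_int (\<bar>n\<bar> + \<bar>m\<bar>) * \<epsilon> / 2))))"

end

theory Submission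
  imports Defs
begin

text \<open>
  Call a point \<open>x\<close> good if, for all large \<open>l\<close>, all \<open>\<bar>a\<bar> \<le> l\<close>, all \<open>m \<le> l\<close> and all \<open>i\<close>, the number
  \<open>log \<parallel>\<Lambda>\<^sup>i M\<^sup>m(T\<^sup>a x)\<parallel>\<close> differs from \<open>m (\<lambda>\<^sub>1 + \<dots> + \<lambda>\<^sub>i)\<close> by less than \<open>\<eta> l\<close>. There are two independent parts.

  Goodness bounds the Pesin function. For matrices \<open>A\<close>, \<open>B\<close> and \<open>\<omega> \<in> \<Lambda>\<^sup>k\<close>, put \<open>w = A v\<close>; the identity
  \<open>\<parallel>w\<parallel>\<^sup>2 A\<omega> = \<iota>\<^sub>w (w \<and> A\<omega>) + w \<and> \<iota>\<^sub>w A\<omega>\<close>, mapped by \<open>\<Lambda>\<^sup>k B\<close>, shows that if \<open>v\<close> is expanded by \<open>A\<close> at a rate larger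
  than \<open>\<lambda>\<^sub>k\<^sub>+\<^sub>1\<close>, then \<open>A v\<close> is expanded by \<open>B\<close> at rate at least \<open>\<lambda>\<^sub>k\<close>. A vector with exponent \<open>\<lambda>\<^sub>i\<close> at both
  \<open>+\<infinity>\<close> and \<open>-\<infinity>\<close> therefore cannot grow faster or slower than \<open>\<lambda>\<^sub>i\<close> in between. No singular value
  decomposition and no Oseledets splitting are needed.

  Bad times are rare. If many times below \<open>n\<close> are bad, a covering argument gives disjoint windows of
  total length proportional to \<open>n\<close> on which the subadditive cocycle deviates linearly. By
  subadditivity, either it is too small on an interval of length \<open>3n\<close>, which is excluded by the large
  deviations, or a Birkhoff sum of \<open>max(0, log \<parallel>\<Lambda>\<^sup>i M\<^sup>N\<parallel> - N (\<lambda>\<^sub>1 + \<dots> + \<lambda>\<^sub>i))\<close> is too large, which is excluded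
  for large \<open>N\<close> by the quasi-Bernoulli inequality \<open>\<mu>[ab] \<le> K \<mu>[a] \<mu>[b]\<close> of the Gibbs measure.

  The level sets of the Pesin function are measurable for the completion because, off a set of small
  measure, the good bounds are uniform, so that a level set is a countable union of projections, along
  the compact unit sphere, of closed sets.
\<close>

section \<open>Exterior powers\<close>

text \<open>The limits that define the Oseledets spaces come without a rate, yet the bound on the
  Pesin function must be uniform over good points. In the growth argument the limits only ensure
  that a maximum is attained; all constants come from goodness. Negative times are reached by
  forward products with base point \<open>T^a x\<close>, \<open>a < 0\<close>, which is why goodness
  ranges over base points on both sides of 0.

  In the counting, a bad time may be bad at any scale from a constant up to \<open>n\<close>, and a
  bound for one window says nothing about many windows at once. Disjoint downward deviations add up
  to a deviation of one long window. Upward ones do not, as subadditivity goes the wrong way; they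
  are transferred to windows of one fixed length \<open>N\<close>, whose exceedances are almost
  independent from block to block. The order of choices matters: \<open>K\<close>, \<open>B\<close>
  and the threshold fix the admissible probability of an exceedance, then \<open>N\<close> is chosen
  by large deviations, and only then the number of coordinates approximating the exceedance event,
  which therefore must not enter the admissible probability.\<close>

lemma finite_multi_indices [simp]: "finite (multi_indices i :: (nat \<Rightarrow> 'd::finite) set)"
  by (simp add: multi_indices_def finite_PiE)

lemma multi_indices_compose:
  assumes "f \<in> multi_indices i" "\<sigma> permutes {..<i}"
  shows "f \<circ> \<sigma> \<in> multi_indices i"
  using assms permutes_not_in[OF assms(2)] by (auto simp: multi_indices_def PiE_iff extensional_def)

lemma bij_betw_multi_indices_compose:
  assumes "\<sigma> permutes {..<i}"
  shows "bij_betw (\<lambda>f. f \<circ> \<sigma>) (multi_indices i) (multi_indices i)"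
proof (rule bij_betwI[where g = "\<lambda>f. f \<circ> inv \<sigma>"])
  show "(\<lambda>f. f \<circ> \<sigma>) \<in> multi_indices i \<rightarrow> multi_indices i"
    using multi_indices_compose assms by blast
  show "(\<lambda>f. f \<circ> inv \<sigma>) \<in> multi_indices i \<rightarrow> multi_indices i"
    using multi_indices_compose permutes_inv[OF assms] by blast
qed (auto simp: comp_assoc permutes_inv_o[OF assms])

lemma sum_multi_indices_compose:
  assumes "\<sigma> permutes {..<i}"
  shows "(\<Sum>f\<in>multi_indices i. F (f \<circ> \<sigma>)) = (\<Sum>f\<in>multi_indices i. F f)"
  using sum.reindex_bij_betw[OF bij_betw_multi_indices_compose[OF assms], of F] by simp

lemma multi_indices_update: "g \<in> multi_indices k \<Longrightarrow> g(k := a) \<in> multi_indices (Suc k)"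
  by (auto simp: multi_indices_def PiE_iff extensional_def)

lemma multi_indices_undefined: "f \<in> multi_indices i \<Longrightarrow> \<not> m < i \<Longrightarrow> f m = undefined"
  by (auto simp: multi_indices_def PiE_iff extensional_def)

lemma multi_indices_eqI:
  assumes "f \<in> multi_indices i" "g \<in> multi_indices i" "\<And>m. m < i \<Longrightarrow> f m = g m"
  shows "f = g"
proof
  fix m show "f m = g m"
    using assms multi_indices_undefined[of f i m] multi_indices_undefined[of g i m] by (cases "m < i") auto
qed

lemma restrict_in_multi_indices [simp]: "restrict f {..<i} \<in> multi_indices i"
  by (simp add: multi_indices_def)

lemma restrict_multi_indices_update:
  assumes "g \<in> multi_indices k"
  shows "restrict (g(k := a)) {..<k} = g"
  by (rule multi_indices_eqI[of _ k]) (use assms in auto)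

lemma sum_multi_indices_Suc:
  fixes F :: "(nat \<Rightarrow> 'd::finite) \<Rightarrow> real"
  shows "(\<Sum>f\<in>multi_indices (Suc k). F f) = (\<Sum>g\<in>multi_indices k. \<Sum>a\<in>UNIV. F (g(k := a)))"
proof -
  have "(\<Sum>g\<in>multi_indices k. \<Sum>a\<in>UNIV. F (g(k := a))) =
        (\<Sum>(g, a)\<in>multi_indices k \<times> UNIV. F (g(k := a)))"
    by (simp add: sum.cartesian_product)
  also have "\<dots> = (\<Sum>f\<in>multi_indices (Suc k). F f)"
  proof (rule sum.reindex_bij_witness[where i = "\<lambda>f. (restrict f {..<k}, f k)" and j = "\<lambda>(g, a). g(k := a)"])
    fix f :: "nat \<Rightarrow> 'd" assume f: "f \<in> multi_indices (Suc k)"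
    show "(restrict f {..<k}, f k) \<in> multi_indices k \<times> UNIV"
      by (simp add: multi_indices_def)
    have "(restrict f {..<k})(k := f k) = f"
    proof (rule multi_indices_eqI[OF _ f])
      show "(restrict f {..<k})(k := f k) \<in> multi_indices (Suc k)"
        by (rule multi_indices_update[OF restrict_in_multi_indices])
    qed (auto simp: less_Suc_eq)
    then show "(case (restrict f {..<k}, f k) of (g, a) \<Rightarrow> g(k := a)) = f" by simp
  next
    fix ga :: "(nat \<Rightarrow> 'd) \<times> 'd" assume ga: "ga \<in> multi_indices k \<times> UNIV"
    obtain g a where [simp]: "ga = (g, a)" by (cases ga)
    have g: "g \<in> multi_indices k" using ga by simp
    then show "(case ga of (g, a) \<Rightarrow> g(k := a)) \<in> multi_indices (Suc k)"
      by (simp add: multi_indices_update)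
    from g show "(restrict (case ga of (g, a) \<Rightarrow> g(k := a)) {..<k}, (case ga of (g, a) \<Rightarrow> g(k := a)) k) = ga"
      using restrict_multi_indices_update[OF g, of a] by simp
  qed auto
  finally show ?thesis by simp
qed

section \<open>Euclidean norm of tensors\<close>

lemma tensor_norm_nonneg [simp]: "0 \<le> tensor_norm i u"
  by (simp add: tensor_norm_def)

lemma tensor_norm_sqrt: "tensor_norm i u = sqrt (\<Sum>f\<in>multi_indices i. (u f)\<^sup>2)"
  by (simp add: tensor_norm_def L2_set_def)

lemma tensor_norm_cong:
  "(\<And>f. f \<in> multi_indices i \<Longrightarrow> u f = w f) \<Longrightarrow> tensor_norm i u = tensor_norm i w"
  by (simp add: tensor_norm_def cong: L2_set_cong)

lemma tensor_norm_add_le: "tensor_norm i (\<lambda>f. u f + w f) \<le> tensor_norm i u + tensor_norm i w"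
  unfolding tensor_norm_def by (rule L2_set_triangle_ineq)

lemma tensor_norm_scale: "tensor_norm i (\<lambda>f. c * u f) = \<bar>c\<bar> * tensor_norm i u"
  by (simp add: tensor_norm_sqrt power_mult_distrib real_sqrt_mult flip: sum_distrib_left)

lemma tensor_norm_sum_le:
  "finite J \<Longrightarrow> tensor_norm i (\<lambda>f. \<Sum>j\<in>J. u j f) \<le> (\<Sum>j\<in>J. tensor_norm i (u j))"
proof (induction J rule: finite_induct)
  case empty
  then show ?case by (simp add: tensor_norm_sqrt)
next
  case (insert x F)
  then show ?case
    using tensor_norm_add_le[of i "u x" "\<lambda>f. \<Sum>j\<in>F. u j f"] by simp
qed

lemma tensor_norm_compose:
  "\<sigma> permutes {..<i} \<Longrightarrow> tensor_norm i (\<lambda>f. u (f \<circ> \<sigma>)) = tensor_norm i u"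
  unfolding tensor_norm_sqrt using sum_multi_indices_compose[of \<sigma> i "\<lambda>f. (u f)\<^sup>2"] by simp

lemma abs_le_tensor_norm:
  fixes u :: "(nat \<Rightarrow> 'd::finite) \<Rightarrow> real"
  assumes "f \<in> multi_indices i"
  shows "\<bar>u f\<bar> \<le> tensor_norm i u"
proof -
  have "\<bar>u f\<bar> = sqrt ((u f)\<^sup>2)" by simp
  also have "\<dots> \<le> sqrt (\<Sum>f\<in>multi_indices i. (u f)\<^sup>2)"
    using assms by (intro real_sqrt_le_mono member_le_sum) auto
  finally show ?thesis by (simp add: tensor_norm_sqrt)
qed

section \<open>Tensor powers acting on antisymmetric tensors\<close>

lemma antisymmetricD:
  "u \<in> antisymmetric_tensors i \<Longrightarrow> \<sigma> permutes {..<i} \<Longrightarrow> f \<in> multi_indices i \<Longrightarrow>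
    u (f \<circ> \<sigma>) = of_int (sign \<sigma>) * u f"
  by (simp add: antisymmetric_tensors_def)

lemma antisymmetric_scale:
  "u \<in> antisymmetric_tensors i \<Longrightarrow> (\<lambda>f. c * u f) \<in> antisymmetric_tensors i"
  by (simp add: antisymmetric_tensors_def)

lemma tensor_power_antisymmetric:
  fixes A :: "real^'d^'d"
  assumes "u \<in> antisymmetric_tensors i"
  shows "tensor_power i A u \<in> antisymmetric_tensors i"
  unfolding antisymmetric_tensors_def
proof (clarify)
  fix \<sigma> and f :: "nat \<Rightarrow> 'd" assume \<sigma>: "\<sigma> permutes {..<i}" and f: "f \<in> multi_indices i"
  have "tensor_power i A u (f \<circ> \<sigma>) =
        (\<Sum>g\<in>multi_indices i. (\<Prod>k<i. A $ f (\<sigma> k) $ (g \<circ> \<sigma>) k) * u (g \<circ> \<sigma>))"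
    unfolding tensor_power_def
    using sum_multi_indices_compose[OF \<sigma>, of "\<lambda>g. (\<Prod>k<i. A $ f (\<sigma> k) $ g k) * u g"] by simp
  also have "\<dots> = (\<Sum>g\<in>multi_indices i. (\<Prod>k<i. A $ f k $ g k) * (of_int (sign \<sigma>) * u g))"
  proof (intro sum.cong refl)
    fix g :: "nat \<Rightarrow> 'd" assume g: "g \<in> multi_indices i"
    have "(\<Prod>k<i. A $ f (\<sigma> k) $ (g \<circ> \<sigma>) k) = (\<Prod>k<i. A $ f k $ g k)"
      using prod.permute[OF \<sigma>, of "\<lambda>k. A $ f k $ g k"] by (simp add: comp_def)
    then show "(\<Prod>k<i. A $ f (\<sigma> k) $ (g \<circ> \<sigma>) k) * u (g \<circ> \<sigma>) =
       (\<Prod>k<i. A $ f k $ g k) * (of_int (sign \<sigma>) * u g)"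
      using antisymmetricD[OF assms \<sigma> g] by simp
  qed
  finally show "tensor_power i A u (f \<circ> \<sigma>) = of_int (sign \<sigma>) * tensor_power i A u f"
    by (simp add: tensor_power_def sum_distrib_left mult_ac)
qed

lemma tensor_power_mult:
  "tensor_power i (A ** B) u f = tensor_power i A (tensor_power i B u) f"
proof -
  have "tensor_power i A (tensor_power i B u) f =
    (\<Sum>h\<in>multi_indices i. (\<Sum>g\<in>multi_indices i. (\<Prod>k<i. A $ f k $ g k * B $ g k $ h k)) * u h)"
    unfolding tensor_power_def
    by (simp add: sum_distrib_left sum_distrib_right prod.distrib mult_ac) (rule sum.swap)
  also have "\<dots> = tensor_power i (A ** B) u f"
    by (simp add: tensor_power_def multi_indices_def prod_sum_PiE matrix_matrix_mult_def)
  finally show ?thesis by simp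
qed

lemma tensor_power_mat_1:
  fixes u :: "(nat \<Rightarrow> 'd::finite) \<Rightarrow> real"
  assumes f: "f \<in> multi_indices i"
  shows "tensor_power i (mat 1) u f = u f"
proof -
  have "(\<Prod>k<i. (mat 1 :: real^'d^'d) $ f k $ g k) * u g = (if g = f then u f else 0)"
    if "g \<in> multi_indices i" for g
  proof (cases "g = f")
    case True
    then show ?thesis by (simp add: mat_def)
  next
    case False
    then obtain k where k: "f k \<noteq> g k" by (metis ext)
    \<comment> \<open>Both multi-indices are \<open>undefined\<close> from \<open>i\<close> on, so
      they can only differ below \<open>i\<close>.\<close>
    then have "k < i"
      using multi_indices_undefined[OF f, of k] multi_indices_undefined[OF that, of k] by (cases "k < i") auto
    with k
    have "(\<Prod>k<i. (mat 1 :: real^'d^'d) $ f k $ g k) = 0"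
      by (auto simp: mat_def intro!: prod_zero)
    with False show ?thesis by simp
  qed
  then show ?thesis using f by (simp add: tensor_power_def)
qed

lemma tensor_power_cong:
  "(\<And>g. g \<in> multi_indices i \<Longrightarrow> u g = w g) \<Longrightarrow> tensor_power i A u f = tensor_power i A w f"
  by (simp add: tensor_power_def)

text \<open>The entrywise \<open>l^1\<close> distance of two tensor powers. Compared with the
  identity it shows that the supremum in \<open>ext_power_norm\<close> is finite; as a quantity that
  vanishes when the matrices meet, it gives continuity of \<open>ext_power_norm\<close>.\<close>

definition tensor_power_bound :: "nat \<Rightarrow> real^'d^'d \<Rightarrow> real^'d^'d \<Rightarrow> real" where
  "tensor_power_bound i A B =
     (\<Sum>f\<in>multi_indices i. \<Sum>g\<in>multi_indices i. \<bar>(\<Prod>k<i. A $ f k $ g k) - (\<Prod>k<i. B $ f k $ g k)\<bar>)"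

lemma tensor_norm_diff_le:
  fixes A B :: "real^'d^'d"
  shows "tensor_norm i (tensor_power i A u)
    \<le> tensor_norm i (tensor_power i B u) + tensor_power_bound i A B * tensor_norm i u"
proof -
  have "tensor_norm i (tensor_power i A u) =
      tensor_norm i (\<lambda>f. tensor_power i B u f + (tensor_power i A u f - tensor_power i B u f))"
    by simp
  also have "\<dots> \<le> tensor_norm i (tensor_power i B u) +
      tensor_norm i (\<lambda>f. tensor_power i A u f - tensor_power i B u f)"
    by (rule tensor_norm_add_le)
  also have "tensor_norm i (\<lambda>f. tensor_power i A u f - tensor_power i B u f) \<le>
      (\<Sum>f\<in>multi_indices i. \<bar>tensor_power i A u f - tensor_power i B u f\<bar>)"
    unfolding tensor_norm_def by (rule L2_set_le_sum_abs)
  also have "\<dots> \<le> (\<Sum>f\<in>multi_indices i. \<Sum>g\<in>multi_indices i.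
      \<bar>(\<Prod>k<i. A $ f k $ g k) - (\<Prod>k<i. B $ f k $ g k)\<bar> * tensor_norm i u)"
  proof (intro sum_mono)
    fix f :: "nat \<Rightarrow> 'd"
    have "tensor_power i A u f - tensor_power i B u f =
      (\<Sum>g\<in>multi_indices i. ((\<Prod>k<i. A $ f k $ g k) - (\<Prod>k<i. B $ f k $ g k)) * u g)"
      by (simp add: tensor_power_def sum_subtractf left_diff_distrib)
    also have "\<bar>\<dots>\<bar> \<le> (\<Sum>g\<in>multi_indices i. \<bar>((\<Prod>k<i. A $ f k $ g k) - (\<Prod>k<i. B $ f k $ g k)) * u g\<bar>)"
      by (rule sum_abs)
    also have "\<dots> \<le> (\<Sum>g\<in>multi_indices i. \<bar>(\<Prod>k<i. A $ f k $ g k) - (\<Prod>k<i. B $ f k $ g k)\<bar> * tensor_norm i u)"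
      by (intro sum_mono) (auto simp: abs_mult intro!: mult_left_mono abs_le_tensor_norm)
    finally show "\<bar>tensor_power i A u f - tensor_power i B u f\<bar> \<le> \<dots>" .
  qed
  also have "\<dots> = tensor_power_bound i A B * tensor_norm i u"
    by (simp add: tensor_power_bound_def sum_distrib_right)
  finally show ?thesis by simp
qed

section \<open>Operator norm on exterior powers\<close>

lemma zero_antisymmetric [simp]: "(\<lambda>f. 0) \<in> antisymmetric_tensors i"
  by (simp add: antisymmetric_tensors_def)

lemma tensor_norm_zero [simp]: "tensor_norm i (\<lambda>f. 0) = 0"
  by (simp add: tensor_norm_sqrt)

text \<open>A real \<open>Sup\<close> carries information only for sets bounded above, so every
  estimate of \<open>ext_power_norm\<close> from below rests on this.\<close>

lemma bdd_above_ext_power: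
  fixes A :: "real^'d^'d"
  shows "bdd_above {tensor_norm i (tensor_power i A u) | u.
            u \<in> antisymmetric_tensors i \<and> tensor_norm i u \<le> 1}"
proof (rule bdd_aboveI)
  let ?B = "mat 1 :: real^'d^'d"
  have nn: "0 \<le> tensor_power_bound i A ?B"
    by (auto simp: tensor_power_bound_def intro!: sum_nonneg)
  fix r assume "r \<in> {tensor_norm i (tensor_power i A u) | u.
            u \<in> antisymmetric_tensors i \<and> tensor_norm i u \<le> 1}"
  then obtain u :: "(nat \<Rightarrow> 'd) \<Rightarrow> real" where u: "r = tensor_norm i (tensor_power i A u)" "tensor_norm i u \<le> 1"
    by auto
  have "tensor_norm i (tensor_power i ?B u) = tensor_norm i u"
    by (intro tensor_norm_cong) (simp add: tensor_power_mat_1)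
  with tensor_norm_diff_le[of i A u ?B] u show "r \<le> 1 + tensor_power_bound i A ?B"
    using mult_left_mono[OF u(2) nn] by simp
qed

lemma ext_power_norm_upper:
  assumes "u \<in> antisymmetric_tensors i" "tensor_norm i u \<le> 1"
  shows "tensor_norm i (tensor_power i A u) \<le> ext_power_norm i A"
  unfolding ext_power_norm_def using assms by (intro cSup_upper bdd_above_ext_power) auto

lemma ext_power_norm_leI:
  assumes "\<And>u. u \<in> antisymmetric_tensors i \<Longrightarrow> tensor_norm i u \<le> 1 \<Longrightarrow>
             tensor_norm i (tensor_power i A u) \<le> c"
  shows "ext_power_norm i A \<le> c"
  unfolding ext_power_norm_def
proof (rule cSup_least)
  show "{tensor_norm i (tensor_power i A u) | u. u \<in> antisymmetric_tensors i \<and> tensor_norm i u \<le> 1} \<noteq> {}"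
    by (auto intro!: exI[of _ "\<lambda>f. 0"])
qed (use assms in auto)

lemma tensor_power_scale: "tensor_power i A (\<lambda>f. c * u f) = (\<lambda>f. c * tensor_power i A u f)"
  by (simp add: tensor_power_def sum_distrib_left mult_ac fun_eq_iff)

lemma ext_power_norm_nonneg [simp]: "0 \<le> ext_power_norm i A"
  by (rule order_trans[OF tensor_norm_nonneg ext_power_norm_upper[of "\<lambda>f. 0"]]) simp_all

lemma ext_power_norm_bound:
  fixes A :: "real^'d^'d"
  assumes u: "u \<in> antisymmetric_tensors i"
  shows "tensor_norm i (tensor_power i A u) \<le> ext_power_norm i A * tensor_norm i u"
proof (cases "tensor_norm i u = 0")
  case True
  \<comment> \<open>The function \<open>u\<close> may be nonzero off the multi-indices, but
    \<open>tensor_power\<close> only reads its values on them.\<close>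
  then have "u f = 0" if "f \<in> multi_indices i" for f
    using abs_le_tensor_norm[OF that, of u] by simp
  then have "tensor_power i A u = (\<lambda>f. 0)"
    by (simp add: tensor_power_def fun_eq_iff)
  then show ?thesis by (simp add: True)
next
  case False
  then have pos: "tensor_norm i u > 0"
    using tensor_norm_nonneg[of i u] by linarith
  define c where "c = 1 / tensor_norm i u"
  have "tensor_norm i (\<lambda>f. c * u f) \<le> 1"
    unfolding tensor_norm_scale using pos by (simp add: c_def)
  then have "tensor_norm i (tensor_power i A (\<lambda>f. c * u f)) \<le> ext_power_norm i A"
    by (intro ext_power_norm_upper antisymmetric_scale u)
  then show ?thesis
    using pos unfolding tensor_power_scale tensor_norm_scale by (simp add: c_def divide_simps mult.commute)
qed

lemma ext_power_norm_mult:
  fixes A B :: "real^'d^'d"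
  shows
  "ext_power_norm i (A ** B) \<le> ext_power_norm i A * ext_power_norm i B"
proof (rule ext_power_norm_leI)
  fix u :: "(nat \<Rightarrow> 'd) \<Rightarrow> real"
  assume u: "u \<in> antisymmetric_tensors i" "tensor_norm i u \<le> 1"
  have "tensor_norm i (tensor_power i (A ** B) u) = tensor_norm i (tensor_power i A (tensor_power i B u))"
    by (intro tensor_norm_cong) (rule tensor_power_mult)
  also have "\<dots> \<le> ext_power_norm i A * tensor_norm i (tensor_power i B u)"
    by (intro ext_power_norm_bound tensor_power_antisymmetric u)
  also have "\<dots> \<le> ext_power_norm i A * ext_power_norm i B"
    by (intro mult_left_mono ext_power_norm_upper u) simp
  finally show "tensor_norm i (tensor_power i (A ** B) u) \<le> ext_power_norm i A * ext_power_norm i B" .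
qed

lemma ext_power_norm_mat_1_le: "ext_power_norm i (mat 1 :: real^'d^'d) \<le> 1"
proof (rule ext_power_norm_leI)
  fix u :: "(nat \<Rightarrow> 'd) \<Rightarrow> real" assume "tensor_norm i u \<le> 1"
  moreover have "tensor_norm i (tensor_power i (mat 1) u) = tensor_norm i u"
    by (intro tensor_norm_cong) (simp add: tensor_power_mat_1)
  ultimately show "tensor_norm i (tensor_power i (mat 1) u) \<le> 1" by simp
qed

text \<open>Wedge \<open>i\<close> distinct basis vectors: at the multi-index listing them only the
  identity permutation contributes, so that coefficient is 1. This makes the exterior power of the
  identity have norm 1 rather than 0.\<close>

lemma exists_antisymmetric:
  assumes "i \<le> CARD('d)"
  obtains u :: "(nat \<Rightarrow> 'd::finite) \<Rightarrow> real" where "u \<in> antisymmetric_tensors i" "tensor_norm i u > 0"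
proof -
  obtain b :: "nat \<Rightarrow> 'd" where b: "bij_betw b {..<CARD('d)} UNIV"
    using ex_bij_betw_nat_finite[of "UNIV :: 'd set"] by (auto simp: atLeast0LessThan)
  then have inj: "inj_on b {..<i}"
    using assms by (auto simp: bij_betw_def intro: inj_on_subset)
  define v :: "nat \<Rightarrow> real^'d" where "v k = axis (b k) 1" for k
  define f where "f = restrict b {..<i}"
  have "(of_int (sign \<sigma>) * (\<Prod>k<i. v (\<sigma> k) $ f k) :: real) = (if \<sigma> = id then 1 else 0)"
    if \<sigma>: "\<sigma> permutes {..<i}" for \<sigma>
  proof (cases "\<sigma> = id")
    case False
    then obtain k where "\<sigma> k \<noteq> k" by (auto simp: fun_eq_iff)
    moreover from this have "k < i" using permutes_not_in[OF \<sigma>] by force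
    moreover have "\<sigma> k < i" using permutes_in_image[OF \<sigma>, of k] \<open>k < i\<close> by simp
    ultimately have "v (\<sigma> k) $ f k = 0"
      using inj_onD[OF inj, of k "\<sigma> k"] by (auto simp: v_def f_def axis_def)
    then have "(\<Prod>k<i. v (\<sigma> k) $ f k) = 0" using \<open>k < i\<close> by (auto intro!: prod_zero)
    with False show ?thesis by simp
  qed (simp add: v_def f_def sign_id)
  then have "wedge i v f = (\<Sum>\<sigma> | \<sigma> permutes {..<i}. if \<sigma> = id then 1 else 0)"
    unfolding wedge_def by (intro sum.cong) auto
  also have "\<dots> = 1"
    by (simp add: finite_permutations permutes_id)
  finally have "wedge i v f = 1" .
  moreover have "f \<in> multi_indices i" by (simp add: f_def multi_indices_def)
  ultimately have "tensor_norm i (wedge i v) > 0"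
    using abs_le_tensor_norm[of f i "wedge i v"] by simp
  then show thesis using that wedge_antisymmetric by blast
qed

lemma ext_power_norm_mat_1:
  assumes "i \<le> CARD('d)"
  shows "ext_power_norm i (mat 1 :: real^'d^'d) = 1"
proof -
  obtain u :: "(nat \<Rightarrow> 'd) \<Rightarrow> real" where u: "u \<in> antisymmetric_tensors i" "tensor_norm i u > 0"
    using exists_antisymmetric assms by blast
  have "tensor_norm i (tensor_power i (mat 1) u) = tensor_norm i u"
    by (intro tensor_norm_cong) (simp add: tensor_power_mat_1)
  with ext_power_norm_bound[OF u(1), of "mat 1"] u(2) have "1 \<le> ext_power_norm i (mat 1 :: real^'d^'d)"
    by simp
  then show ?thesis using ext_power_norm_mat_1_le[where 'd='d, of i] by simp
qed

text \<open>Submultiplicativity for \<open>A\<close> and its inverse. The logarithms of the cocycle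
  norms depend on this positivity.\<close>

lemma ext_power_norm_pos:
  fixes A :: "real^'d^'d"
  assumes "i \<le> CARD('d)" "invertible A"
  shows "ext_power_norm i A > 0"
proof -
  obtain A' where "A ** A' = mat 1" using assms(2) by (auto simp: invertible_def)
  then have "1 \<le> ext_power_norm i A * ext_power_norm i A'"
    using ext_power_norm_mult[of i A A'] ext_power_norm_mat_1[OF assms(1)] by simp
  then have "ext_power_norm i A \<noteq> 0" by auto
  then show ?thesis using ext_power_norm_nonneg[of i A] by linarith
qed

lemma ext_power_norm_0: "ext_power_norm 0 (A :: real^'d^'d) = 1"
proof -
  have "tensor_power 0 A = tensor_power 0 (mat 1)"
    by (simp add: tensor_power_def fun_eq_iff)
  then have "ext_power_norm 0 A = ext_power_norm 0 (mat 1 :: real^'d^'d)"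
    by (simp add: ext_power_norm_def)
  then show ?thesis using ext_power_norm_mat_1[of 0, where 'd='d] by simp
qed

text \<open>Removes the term of degree \<open>Suc k\<close> from the growth inequality at
  \<open>k = d\<close>; what is left there bounds the decay of a vector by the smallest
  exponent.\<close>

lemma ext_power_norm_eq_0:
  fixes A :: "real^'d^'d"
  assumes "CARD('d) < i"
  shows "ext_power_norm i A = 0"
proof -
  have "ext_power_norm i A \<le> 0"
  proof (rule ext_power_norm_leI)
    fix u :: "(nat \<Rightarrow> 'd) \<Rightarrow> real" assume u: "u \<in> antisymmetric_tensors i"
    have "tensor_norm i (tensor_power i A u) = tensor_norm i (\<lambda>f :: nat \<Rightarrow> 'd. 0)"
    proof (rule tensor_norm_cong)
      fix f :: "nat \<Rightarrow> 'd" assume f: "f \<in> multi_indices i"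
      have "\<not> inj_on f {..<i}"
        using card_inj_on_le[of f "{..<i}" UNIV] assms by auto
      then obtain a b where ab: "a < i" "b < i" "a \<noteq> b" "f a = f b" by (auto simp: inj_on_def)
      \<comment> \<open>The swap of two equal entries fixes \<open>f\<close>, while antisymmetry
        reverses the sign of the coefficient.\<close>
      have "f \<circ> Transposition.transpose a b = f" using ab(4) by (auto simp: fun_eq_iff Transposition.transpose_def)
      then show "tensor_power i A u f = 0"
        using antisymmetricD[OF tensor_power_antisymmetric[OF u, of A] permutes_swap_id f, of a b] ab
        by (simp add: sign_swap_id)
    qed
    then show "tensor_norm i (tensor_power i A u) \<le> 0" by simp
  qed
  then show ?thesis using ext_power_norm_nonneg[of i A] by linarith
qed

lemma tensor_power_bound_commute: "tensor_power_bound i A B = tensor_power_bound i B A"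
  by (simp add: tensor_power_bound_def abs_minus_commute)

lemma ext_power_norm_diff_le:
  fixes A B :: "real^'d^'d"
  shows "ext_power_norm i A \<le> ext_power_norm i B + tensor_power_bound i A B"
proof (rule ext_power_norm_leI)
  fix u :: "(nat \<Rightarrow> 'd) \<Rightarrow> real"
  assume u: "u \<in> antisymmetric_tensors i" "tensor_norm i u \<le> 1"
  have "0 \<le> tensor_power_bound i A B"
    by (auto simp: tensor_power_bound_def intro!: sum_nonneg)
  then show "tensor_norm i (tensor_power i A u) \<le> ext_power_norm i B + tensor_power_bound i A B"
    using tensor_norm_diff_le[of i A u B] ext_power_norm_upper[OF u, of B]
      mult_left_mono[OF u(2), of "tensor_power_bound i A B"] by simp
qed

lemma continuous_on_ext_power_norm: "continuous_on UNIV (ext_power_norm i :: real^'d^'d \<Rightarrow> real)"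
  unfolding continuous_on_def
proof
  fix A :: "real^'d^'d"
  have "((\<lambda>B. tensor_power_bound i B A) \<longlongrightarrow> tensor_power_bound i A A) (at A)"
    unfolding tensor_power_bound_def by (intro tendsto_intros)
  then have lim: "((\<lambda>B. tensor_power_bound i B A) \<longlongrightarrow> 0) (at A)"
    by (simp add: tensor_power_bound_def)
  have "((\<lambda>B. ext_power_norm i B - ext_power_norm i A) \<longlongrightarrow> 0) (at A)"
  proof (rule Lim_null_comparison[OF always_eventually lim], rule)
    fix B show "norm (ext_power_norm i B - ext_power_norm i A) \<le> tensor_power_bound i B A"
      using ext_power_norm_diff_le[of i A B] ext_power_norm_diff_le[of i B A]
        tensor_power_bound_commute[of i A B] by simp
  qed
  then show "(ext_power_norm i \<longlongrightarrow> ext_power_norm i A) (at A)"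
    by (rule LIM_zero_cancel)
qed

text \<open>
  \<open>wedge_vec k v u\<close> is \<open>u \<and> v\<close> up to a constant factor. The index \<open>k\<close> of the factor \<open>v\<close> is the last one, so that
  the permutations fixing it are those of \<open>{..<k}\<close>; the transpositions \<open>(k j)\<close> represent the cosets of
  this subgroup.
\<close>

definition wedge_vec :: "nat \<Rightarrow> real^'d \<Rightarrow> ((nat \<Rightarrow> 'd) \<Rightarrow> real) \<Rightarrow> (nat \<Rightarrow> 'd) \<Rightarrow> real" where
  "wedge_vec k v u = (\<lambda>f. \<Sum>j\<le>k. of_int (sign (Transposition.transpose k j)) *
     (u (restrict (f \<circ> Transposition.transpose k j) {..<k}) * v $ f j))"

text \<open>The interior product in the last slot, that is, the adjoint of appending
  \<open>v\<close> as last tensor factor.\<close>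

definition contract :: "nat \<Rightarrow> real^'d \<Rightarrow> ((nat \<Rightarrow> 'd) \<Rightarrow> real) \<Rightarrow> (nat \<Rightarrow> 'd) \<Rightarrow> real" where
  "contract k v u = (\<lambda>g. \<Sum>a\<in>UNIV. v $ a * u (g(k := a)))"

text \<open>Composition with \<open>\<tau>\<close> carries the coset of \<open>(k j)\<close> to that
  of \<open>(k \<tau>(j))\<close>. The discrepancy \<open>\<sigma>\<close> between the
  representatives fixes \<open>k\<close>, so the antisymmetry of \<open>u\<close> absorbs it and
  produces its sign.\<close>

lemma wedge_vec_antisymmetric:
  assumes u: "u \<in> antisymmetric_tensors k"
  shows "wedge_vec k v u \<in> antisymmetric_tensors (Suc k)"
  unfolding antisymmetric_tensors_def
proof clarify
  fix \<tau> and f :: "nat \<Rightarrow> 'a"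
  assume \<tau>: "\<tau> permutes {..<Suc k}" and f: "f \<in> multi_indices (Suc k)"
  define t where "t f = u (restrict f {..<k}) * v $ f k" for f
  have W: "wedge_vec k v u h = (\<Sum>j\<le>k. of_int (sign (Transposition.transpose k j)) * t (h \<circ> Transposition.transpose k j))" for h
    by (simp add: wedge_vec_def t_def)
  have t: "t (h \<circ> \<sigma>) = of_int (sign \<sigma>) * t h"
    if \<sigma>: "\<sigma> permutes {..<Suc k}" and fixk: "\<sigma> k = k" for \<sigma> h
  proof -
    have \<sigma>': "\<sigma> permutes {..<k}"
      by (rule permutes_superset[OF \<sigma>]) (use fixk in \<open>auto simp: less_Suc_eq\<close>)
    have "restrict (h \<circ> \<sigma>) {..<k} = restrict h {..<k} \<circ> \<sigma>"
      using permutes_in_image[OF \<sigma>'] by (auto simp: fun_eq_iff restrict_def)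
    then show ?thesis
      using antisymmetricD[OF u \<sigma>', of "restrict h {..<k}"] fixk by (simp add: t_def)
  qed
  have perm: "permutation p" if "p permutes {..<Suc k}" for p
    using that finite_lessThan permutation_permutes by blast
  have le: "\<tau> j \<le> k" if "j \<le> k" for j
    using permutes_in_image[OF \<tau>, of j] that by (simp add: less_Suc_eq_le)
  have "wedge_vec k v u (f \<circ> \<tau>) =
    (\<Sum>j\<le>k. of_int (sign \<tau>) * (of_int (sign (Transposition.transpose k (\<tau> j))) * t (f \<circ> Transposition.transpose k (\<tau> j))))"
    unfolding W
  proof (intro sum.cong refl)
    fix j assume "j \<in> {..k}"
    then have j: "j \<le> k" by simp
    define \<sigma> where "\<sigma> = Transposition.transpose k (\<tau> j) \<circ> (\<tau> \<circ> Transposition.transpose k j)"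
    have p: "Transposition.transpose k j permutes {..<Suc k}" "Transposition.transpose k (\<tau> j) permutes {..<Suc k}"
      using j le[OF j] by (auto intro!: permutes_swap_id)
    have \<sigma>: "\<sigma> permutes {..<Suc k}"
      unfolding \<sigma>_def by (intro permutes_compose p \<tau>)
    have "\<sigma> k = k" by (simp add: \<sigma>_def)
    have "Transposition.transpose k (\<tau> j) \<circ> \<sigma> = \<tau> \<circ> Transposition.transpose k j"
      by (simp add: \<sigma>_def fun_eq_iff)
    then have "t (f \<circ> \<tau> \<circ> Transposition.transpose k j) = of_int (sign \<sigma>) * t (f \<circ> Transposition.transpose k (\<tau> j))"
      using t[OF \<sigma> \<open>\<sigma> k = k\<close>, of "f \<circ> Transposition.transpose k (\<tau> j)"] by (simp add: comp_assoc)
    moreover have "sign \<sigma> = sign (Transposition.transpose k (\<tau> j)) * (sign \<tau> * sign (Transposition.transpose k j))"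
      unfolding \<sigma>_def using p \<tau> by (simp add: sign_compose perm permutes_compose)
    moreover have "sign (Transposition.transpose k j) * sign (Transposition.transpose k j) = 1"
      by (simp add: sign_idempotent)
    ultimately show "of_int (sign (Transposition.transpose k j)) * t (f \<circ> \<tau> \<circ> Transposition.transpose k j) =
       of_int (sign \<tau>) * (of_int (sign (Transposition.transpose k (\<tau> j))) * t (f \<circ> Transposition.transpose k (\<tau> j)))"
      by (simp add: sign_swap_id)
  qed
  also have "\<dots> = (\<Sum>j\<le>k. of_int (sign \<tau>) * (of_int (sign (Transposition.transpose k j)) * t (f \<circ> Transposition.transpose k j)))"
  proof -
    have "bij_betw \<tau> {..k} {..k}"
      using permutes_imp_bij[OF \<tau>] by (simp add: lessThan_Suc_atMost)
    from sum.reindex_bij_betw[OF this] show ?thesis by auto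
  qed
  also have "\<dots> = of_int (sign \<tau>) * wedge_vec k v u f"
    by (simp add: W sum_distrib_left)
  finally show "wedge_vec k v u (f \<circ> \<tau>) = of_int (sign \<tau>) * wedge_vec k v u f" .
qed

lemma tensor_norm_wedge_vec_le:
  fixes v :: "real^'d"
  shows "tensor_norm (Suc k) (wedge_vec k v u) \<le> (real k + 1) * (norm v * tensor_norm k u)"
proof -
  define t where "t f = u (restrict f {..<k}) * v $ f k" for f
  have "wedge_vec k v u = (\<lambda>h. \<Sum>j\<le>k. of_int (sign (Transposition.transpose k j)) * t (h \<circ> Transposition.transpose k j))"
    by (simp add: wedge_vec_def t_def)
  then have "tensor_norm (Suc k) (wedge_vec k v u) \<le>
     (\<Sum>j\<le>k. tensor_norm (Suc k) (\<lambda>h. of_int (sign (Transposition.transpose k j)) * t (h \<circ> Transposition.transpose k j)))"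
    using tensor_norm_sum_le[of "{..k}" "Suc k" "\<lambda>j h. of_int (sign (Transposition.transpose k j)) * t (h \<circ> Transposition.transpose k j)"] by simp
  also have "\<dots> = (\<Sum>j\<le>k. tensor_norm (Suc k) t)"
  proof (intro sum.cong refl)
    fix j assume "j \<in> {..k}"
    then have p: "Transposition.transpose k j permutes {..<Suc k}" by (auto intro!: permutes_swap_id)
    show "tensor_norm (Suc k) (\<lambda>h. of_int (sign (Transposition.transpose k j)) * t (h \<circ> Transposition.transpose k j)) = tensor_norm (Suc k) t"
      unfolding tensor_norm_scale tensor_norm_compose[OF p] by (simp add: sign_swap_id)
  qed
  \<comment> \<open>Each of the \<open>k + 1\<close> summands is a rearranged product tensor, and
    the norm of a product tensor is the product of the norms.\<close>
  also have "tensor_norm (Suc k) t = norm v * tensor_norm k u"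
  proof -
    have "(\<Sum>f\<in>multi_indices (Suc k). (t f)\<^sup>2) = (\<Sum>g\<in>multi_indices k. \<Sum>a\<in>UNIV. (u g)\<^sup>2 * (v $ a)\<^sup>2)"
      unfolding sum_multi_indices_Suc
    proof (intro sum.cong refl)
      fix g :: "nat \<Rightarrow> 'd" and a assume "g \<in> multi_indices k"
      then have "restrict (g(k := a)) {..<k} = g"
        by (rule restrict_multi_indices_update)
      then show "(t (g(k := a)))\<^sup>2 = (u g)\<^sup>2 * (v $ a)\<^sup>2"
        by (simp add: t_def power_mult_distrib)
    qed
    also have "\<dots> = (\<Sum>a\<in>UNIV. (v $ a)\<^sup>2) * (\<Sum>g\<in>multi_indices k. (u g)\<^sup>2)"
      by (subst mult.commute) (simp add: sum_product)
    finally show ?thesis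
      by (simp add: tensor_norm_sqrt norm_vec_def L2_set_def real_sqrt_mult)
  qed
  finally show ?thesis by (simp add: add.commute)
qed

lemma tensor_norm_contract_le:
  fixes v :: "real^'d"
  shows "tensor_norm k (contract k v u) \<le> norm v * tensor_norm (Suc k) u"
proof -
  have "(\<Sum>g\<in>multi_indices k. (contract k v u g)\<^sup>2) \<le>
        (\<Sum>g\<in>multi_indices k. (\<Sum>a\<in>UNIV. (v $ a)\<^sup>2) * (\<Sum>a\<in>UNIV. (u (g(k := a)))\<^sup>2))"
    unfolding contract_def by (intro sum_mono Cauchy_Schwarz_ineq_sum)
  also have "\<dots> = (\<Sum>a\<in>UNIV. (v $ a)\<^sup>2) * (\<Sum>f\<in>multi_indices (Suc k). (u f)\<^sup>2)"
    by (simp add: sum_multi_indices_Suc sum_distrib_left)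
  finally have "sqrt (\<Sum>g\<in>multi_indices k. (contract k v u g)\<^sup>2) \<le>
      sqrt ((\<Sum>a\<in>UNIV. (v $ a)\<^sup>2) * (\<Sum>f\<in>multi_indices (Suc k). (u f)\<^sup>2))"
    by (rule real_sqrt_le_mono)
  then show ?thesis
    by (simp add: tensor_norm_sqrt norm_vec_def L2_set_def real_sqrt_mult)
qed

lemma contract_antisymmetric:
  assumes u: "u \<in> antisymmetric_tensors (Suc k)"
  shows "contract k v u \<in> antisymmetric_tensors k"
  unfolding antisymmetric_tensors_def
proof clarify
  fix \<sigma> and g :: "nat \<Rightarrow> 'a" assume \<sigma>: "\<sigma> permutes {..<k}" and g: "g \<in> multi_indices k"
  have \<sigma>': "\<sigma> permutes {..<Suc k}" by (rule permutes_subset[OF \<sigma>]) auto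
  have "(g \<circ> \<sigma>)(k := a) = g(k := a) \<circ> \<sigma>" for a
  proof
    fix m show "((g \<circ> \<sigma>)(k := a)) m = (g(k := a) \<circ> \<sigma>) m"
      using permutes_in_image[OF \<sigma>, of m] permutes_not_in[OF \<sigma>, of m] by (cases "m < k") auto
  qed
  then have "u ((g \<circ> \<sigma>)(k := a)) = of_int (sign \<sigma>) * u (g(k := a))" for a
    using antisymmetricD[OF u \<sigma>' multi_indices_update[OF g]] by simp
  then show "contract k v u (g \<circ> \<sigma>) = of_int (sign \<sigma>) * contract k v u g"
    by (simp add: contract_def sum_distrib_left mult_ac)
qed

text \<open>Tensor powers act factor by factor on the product tensor \<open>t\<close> and commute
  with permutations of the factors, hence they commute with the alternating sum of its
  rearrangements.\<close>

lemma tensor_power_wedge_vec: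
  fixes v :: "real^'d"
  assumes f: "f \<in> multi_indices (Suc k)"
  shows "tensor_power (Suc k) A (wedge_vec k v u) f = wedge_vec k (A *v v) (tensor_power k A u) f"
proof -
  define t where "t v u = (\<lambda>f. u (restrict f {..<k}) * v $ f k)" for v :: "real^'d" and u
  have W: "wedge_vec k v u h = (\<Sum>j\<le>k. of_int (sign (Transposition.transpose k j)) * t v u (h \<circ> Transposition.transpose k j))" for h v u
    by (simp add: wedge_vec_def t_def)
  have T: "tensor_power (Suc k) A (t v u) h = t (A *v v) (tensor_power k A u) h" for h
  proof -
    have "tensor_power (Suc k) A (t v u) h =
        (\<Sum>g\<in>multi_indices k. \<Sum>a\<in>UNIV. ((\<Prod>m<k. A $ h m $ g m) * u g) * (A $ h k $ a * v $ a))"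
      unfolding tensor_power_def sum_multi_indices_Suc
    proof (intro sum.cong refl)
      fix g :: "nat \<Rightarrow> 'd" and a assume "g \<in> multi_indices k"
      then have "restrict (g(k := a)) {..<k} = g"
        by (rule restrict_multi_indices_update)
      then show "(\<Prod>m<Suc k. A $ h m $ (g(k := a)) m) * t v u (g(k := a)) =
          ((\<Prod>m<k. A $ h m $ g m) * u g) * (A $ h k $ a * v $ a)"
        by (simp add: t_def)
    qed
    also have "\<dots> = tensor_power k A u h * (A *v v) $ h k"
      by (simp add: tensor_power_def matrix_vector_mult_def sum_product)
    also have "tensor_power k A u h = tensor_power k A u (restrict h {..<k})"
      by (simp add: tensor_power_def)
    finally show ?thesis by (simp add: t_def)
  qed
  have perm: "tensor_power (Suc k) A (\<lambda>h. w (h \<circ> \<sigma>)) f = tensor_power (Suc k) A w (f \<circ> \<sigma>)"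
    if \<sigma>: "\<sigma> permutes {..<Suc k}" for \<sigma> and w :: "(nat \<Rightarrow> 'd) \<Rightarrow> real"
  proof -
    have "tensor_power (Suc k) A w (f \<circ> \<sigma>) =
        (\<Sum>g\<in>multi_indices (Suc k). (\<Prod>m<Suc k. A $ f (\<sigma> m) $ (g \<circ> \<sigma>) m) * w (g \<circ> \<sigma>))"
      unfolding tensor_power_def
      using sum_multi_indices_compose[OF \<sigma>, of "\<lambda>g. (\<Prod>m<Suc k. A $ f (\<sigma> m) $ g m) * w g"] by simp
    also have "\<dots> = tensor_power (Suc k) A (\<lambda>h. w (h \<circ> \<sigma>)) f"
      unfolding tensor_power_def
    proof (intro sum.cong refl arg_cong2[where f = "(*)"])
      fix g :: "nat \<Rightarrow> 'd"
      show "(\<Prod>m<Suc k. A $ f (\<sigma> m) $ (g \<circ> \<sigma>) m) = (\<Prod>m<Suc k. A $ f m $ g m)"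
        using prod.permute[OF \<sigma>, of "\<lambda>m. A $ f m $ g m"] by (simp add: comp_def)
    qed
    finally show ?thesis by simp
  qed
  have "tensor_power (Suc k) A (wedge_vec k v u) f =
      (\<Sum>j\<le>k. of_int (sign (Transposition.transpose k j)) * tensor_power (Suc k) A (\<lambda>h. t v u (h \<circ> Transposition.transpose k j)) f)"
    unfolding tensor_power_def W sum_distrib_left by (subst sum.swap) (simp add: mult_ac)
  also have "\<dots> = (\<Sum>j\<le>k. of_int (sign (Transposition.transpose k j)) * t (A *v v) (tensor_power k A u) (f \<circ> Transposition.transpose k j))"
  proof (intro sum.cong refl arg_cong2[where f = "(*)"])
    fix j assume "j \<in> {..k}"
    then have "Transposition.transpose k j permutes {..<Suc k}" by (auto intro!: permutes_swap_id)
    then show "tensor_power (Suc k) A (\<lambda>h. t v u (h \<circ> Transposition.transpose k j)) f =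
        t (A *v v) (tensor_power k A u) (f \<circ> Transposition.transpose k j)"
      by (simp add: perm T)
  qed
  finally show ?thesis by (simp add: W)
qed

text \<open>First half of \<open>contract v (v \<and> u) + v \<and> contract v u = |v|^2 u\<close>:
  the subtracted sum is the one that \<open>wedge_vec_contract\<close> computes one degree lower.
  Antisymmetry of \<open>u\<close> enters only in that second half.\<close>

lemma contract_wedge_vec:
  fixes v :: "real^'d"
  assumes g: "g \<in> multi_indices k"
  shows "contract k v (wedge_vec k v u) g =
    (norm v)\<^sup>2 * u g - (\<Sum>j<k. v $ g j * (\<Sum>a\<in>UNIV. v $ a * u (g(j := a))))"
proof -
  have "wedge_vec k v u (g(k := a)) = v $ a * u g - (\<Sum>j<k. v $ g j * u (g(j := a)))" for a
  proof -
    have "wedge_vec k v u (g(k := a)) = u (restrict (g(k := a)) {..<k}) * v $ a -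
       (\<Sum>j<k. u (restrict (g(k := a) \<circ> Transposition.transpose k j) {..<k}) * v $ g j)"
      unfolding wedge_vec_def lessThan_Suc_atMost[symmetric]
      by (simp add: sign_id sign_swap_id flip: sum_negf)
    moreover have "restrict (g(k := a)) {..<k} = g"
      using g by (rule restrict_multi_indices_update)
    \<comment> \<open>The swap moves \<open>a\<close> into place \<open>j\<close> and sends
      \<open>g j\<close> to the last place, where the restriction drops it; \<open>g j\<close>
      survives as the index of \<open>v\<close>.\<close>
    moreover have "restrict (g(k := a) \<circ> Transposition.transpose k j) {..<k} = g(j := a)" if "j < k" for j
    proof (rule multi_indices_eqI[of _ k])
      show "g(j := a) \<in> multi_indices k"
        using g that by (auto simp: multi_indices_def PiE_iff extensional_def)
    qed (auto simp: Transposition.transpose_def)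
    ultimately show ?thesis by (simp add: mult.commute)
  qed
  then have "contract k v (wedge_vec k v u) g =
     (\<Sum>a\<in>UNIV. v $ a * (v $ a * u g)) - (\<Sum>a\<in>UNIV. \<Sum>j<k. v $ a * (v $ g j * u (g(j := a))))"
    by (simp add: contract_def right_diff_distrib sum_subtractf sum_distrib_left)
  also have "(\<Sum>a\<in>UNIV. v $ a * (v $ a * u g)) = (norm v)\<^sup>2 * u g"
    unfolding power2_norm_eq_inner inner_vec_def by (simp add: sum_distrib_right mult.assoc)
  also have "(\<Sum>a\<in>UNIV. \<Sum>j<k. v $ a * (v $ g j * u (g(j := a)))) =
     (\<Sum>j<k. v $ g j * (\<Sum>a\<in>UNIV. v $ a * u (g(j := a))))"
    by (subst sum.swap) (simp add: sum_distrib_left mult_ac)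
  finally show ?thesis .
qed

text \<open>The sign of each transposition occurs twice, once in \<open>wedge_vec\<close> and once
  from the antisymmetry of \<open>u\<close>, and cancels.\<close>

lemma wedge_vec_contract:
  fixes v :: "real^'d"
  assumes u: "u \<in> antisymmetric_tensors (Suc k)" and g: "g \<in> multi_indices (Suc k)"
  shows "wedge_vec k v (contract k v u) g =
    (\<Sum>j<Suc k. v $ g j * (\<Sum>a\<in>UNIV. v $ a * u (g(j := a))))"
  unfolding wedge_vec_def lessThan_Suc_atMost
proof (intro sum.cong refl)
  fix j assume "j \<in> {..k}"
  then have j: "j \<le> k" by simp
  have p: "Transposition.transpose k j permutes {..<Suc k}" using j by (auto intro!: permutes_swap_id)
  have "u ((restrict (g \<circ> Transposition.transpose k j) {..<k})(k := a)) = of_int (sign (Transposition.transpose k j)) * u (g(j := a))" for a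
  proof -
    have gj: "g(j := a) \<in> multi_indices (Suc k)"
      using g j by (auto simp: multi_indices_def PiE_iff extensional_def)
    have "(restrict (g \<circ> Transposition.transpose k j) {..<k})(k := a) = g(j := a) \<circ> Transposition.transpose k j"
    proof (rule multi_indices_eqI)
      show "(restrict (g \<circ> Transposition.transpose k j) {..<k})(k := a) \<in> multi_indices (Suc k)"
        by (rule multi_indices_update[OF restrict_in_multi_indices])
      show "g(j := a) \<circ> Transposition.transpose k j \<in> multi_indices (Suc k)"
        by (rule multi_indices_compose[OF gj p])
    qed (auto simp: less_Suc_eq Transposition.transpose_def)
    then show ?thesis using antisymmetricD[OF u p gj] by simp
  qed
  then have "contract k v u (restrict (g \<circ> Transposition.transpose k j) {..<k}) =
      of_int (sign (Transposition.transpose k j)) * (\<Sum>a\<in>UNIV. v $ a * u (g(j := a)))"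
    by (simp add: contract_def sum_distrib_left mult_ac)
  then show "of_int (sign (Transposition.transpose k j)) * (contract k v u (restrict (g \<circ> Transposition.transpose k j) {..<k}) * v $ g j) =
      v $ g j * (\<Sum>a\<in>UNIV. v $ a * u (g(j := a)))"
    by (simp add: sign_swap_id)
qed

text \<open>
  With \<open>w = A v\<close> and \<open>z\<close> the image under \<open>A\<close> of a \<open>k\<close>-vector, expand \<open>\<parallel>w\<parallel>\<^sup>2 z = contract w (w \<and> z) + w \<and> contract w z\<close>
  and apply \<open>B\<close>: since \<open>w \<and> z\<close> is the image of a \<open>(k + 1)\<close>-vector, it is small if \<open>A\<close> expands \<open>v\<close> strongly.
\<close>

lemma ext_power_norm_growth:
  fixes A B :: "real^'d^'d" and v :: "real^'d"
  shows "ext_power_norm k (B ** A) * norm (A *v v)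
    \<le> (real k + 1) * ext_power_norm k B * ext_power_norm (Suc k) A * norm v
      + real k * norm (B *v (A *v v)) * ext_power_norm (k - 1) B * ext_power_norm k A"
    (is "_ \<le> ?R")
proof (cases "A *v v = 0")
  case True
  then show ?thesis by simp
next
  case False
  define w where "w = A *v v"
  have w: "norm w > 0" using False by (simp add: w_def)
  have R: "0 \<le> ?R" by simp
  have "ext_power_norm k (B ** A) \<le> ?R / norm w"
  proof (rule ext_power_norm_leI)
    fix u :: "(nat \<Rightarrow> 'd) \<Rightarrow> real"
    assume u: "u \<in> antisymmetric_tensors k" "tensor_norm k u \<le> 1"
    define z where "z = tensor_power k A u"
    have z: "z \<in> antisymmetric_tensors k"
      unfolding z_def by (rule tensor_power_antisymmetric[OF u(1)])
    have nz: "tensor_norm k z \<le> ext_power_norm k A"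
      unfolding z_def by (rule ext_power_norm_upper[OF u])
    have nwz: "tensor_norm (Suc k) (wedge_vec k w z) \<le> ext_power_norm (Suc k) A * ((real k + 1) * norm v)"
    proof -
      have "tensor_norm (Suc k) (wedge_vec k w z) = tensor_norm (Suc k) (tensor_power (Suc k) A (wedge_vec k v u))"
        unfolding w_def z_def by (intro tensor_norm_cong) (simp add: tensor_power_wedge_vec)
      also have "\<dots> \<le> ext_power_norm (Suc k) A * tensor_norm (Suc k) (wedge_vec k v u)"
        by (intro ext_power_norm_bound wedge_vec_antisymmetric u)
      also have "\<dots> \<le> ext_power_norm (Suc k) A * ((real k + 1) * (norm v * 1))"
        by (intro mult_left_mono order_trans[OF tensor_norm_wedge_vec_le] u) auto
      finally show ?thesis by simp
    qed
    define r where "r g = (\<Sum>j<k. w $ g j * (\<Sum>a\<in>UNIV. w $ a * z (g(j := a))))" for g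
    have nr: "tensor_norm k (tensor_power k B r)
       \<le> real k * norm (B *v w) * ext_power_norm (k - 1) B * ext_power_norm k A * norm w"
    \<comment> \<open>In degree 0 the sum \<open>r\<close> is empty. In degree \<open>Suc k'\<close>
      it is the wedge of \<open>w\<close> with the contraction of \<open>z\<close>, which has degree
      \<open>k'\<close>.\<close>
    proof (cases k)
      case 0
      then show ?thesis by (simp add: r_def tensor_power_def)
    next
      case (Suc k')
      have "tensor_norm k (tensor_power k B r) =
          tensor_norm k (wedge_vec k' (B *v w) (tensor_power k' B (contract k' w z)))"
      proof (rule tensor_norm_cong)
        fix f :: "nat \<Rightarrow> 'd" assume f: "f \<in> multi_indices k"
        have "tensor_power k B r f = tensor_power k B (wedge_vec k' w (contract k' w z)) f"
          by (rule tensor_power_cong)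
             (use z in \<open>simp add: Suc r_def wedge_vec_contract del: sum.lessThan_Suc\<close>)
        also have "\<dots> = wedge_vec k' (B *v w) (tensor_power k' B (contract k' w z)) f"
          using f Suc by (simp add: tensor_power_wedge_vec)
        finally show "tensor_power k B r f = \<dots>" .
      qed
      also have "\<dots> \<le> real k * (norm (B *v w) * tensor_norm k' (tensor_power k' B (contract k' w z)))"
        using tensor_norm_wedge_vec_le[of k' "B *v w"] Suc by (simp add: add.commute)
      also have "\<dots> \<le> real k * (norm (B *v w) * (ext_power_norm k' B * tensor_norm k' (contract k' w z)))"
        using z Suc by (intro mult_left_mono ext_power_norm_bound contract_antisymmetric) auto
      also have "\<dots> \<le> real k * (norm (B *v w) * (ext_power_norm k' B * (norm w * ext_power_norm k A)))"
        using nz Suc by (intro mult_left_mono order_trans[OF tensor_norm_contract_le]) auto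
      finally show ?thesis using Suc by (simp add: mult_ac)
    qed
    have "(norm w)\<^sup>2 * tensor_norm k (tensor_power k (B ** A) u) =
        tensor_norm k (\<lambda>f. (norm w)\<^sup>2 * tensor_power k B z f)"
    proof -
      have "tensor_norm k (tensor_power k (B ** A) u) = tensor_norm k (tensor_power k B z)"
        unfolding z_def by (intro tensor_norm_cong tensor_power_mult)
      then show ?thesis by (simp add: tensor_norm_scale)
    qed
    also have "\<dots> = tensor_norm k (\<lambda>f. tensor_power k B (contract k w (wedge_vec k w z)) f + tensor_power k B r f)"
    proof (rule tensor_norm_cong)
      fix f :: "nat \<Rightarrow> 'd"
      have "tensor_power k B (contract k w (wedge_vec k w z)) f = tensor_power k B (\<lambda>g. (norm w)\<^sup>2 * z g - r g) f"
        by (rule tensor_power_cong) (simp add: contract_wedge_vec r_def)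
      also have "\<dots> = (norm w)\<^sup>2 * tensor_power k B z f - tensor_power k B r f"
        by (simp add: tensor_power_def algebra_simps sum_subtractf sum_distrib_left)
      finally show "(norm w)\<^sup>2 * tensor_power k B z f =
        tensor_power k B (contract k w (wedge_vec k w z)) f + tensor_power k B r f" by simp
    qed
    also have "\<dots> \<le> tensor_norm k (tensor_power k B (contract k w (wedge_vec k w z))) + tensor_norm k (tensor_power k B r)"
      by (rule tensor_norm_add_le)
    also have "tensor_norm k (tensor_power k B (contract k w (wedge_vec k w z))) \<le>
        ext_power_norm k B * tensor_norm k (contract k w (wedge_vec k w z))"
      by (intro ext_power_norm_bound contract_antisymmetric wedge_vec_antisymmetric z)
    also have "\<dots> \<le> ext_power_norm k B * (norm w * (ext_power_norm (Suc k) A * ((real k + 1) * norm v)))"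
      by (intro mult_left_mono order_trans[OF tensor_norm_contract_le] nwz) auto
    finally have "(norm w)\<^sup>2 * tensor_norm k (tensor_power k (B ** A) u) \<le> norm w * ?R"
      using nr by (simp add: w_def algebra_simps)
    \<comment> \<open>Of the two factors \<open>norm w\<close> on the left one cancels; the other is
      the factor \<open>norm (A *v v)\<close> of the claim.\<close>
    then have "norm w * tensor_norm k (tensor_power k (B ** A) u) \<le> ?R"
      using w by (simp only: power2_eq_square mult.assoc mult_le_cancel_left_pos)
    then show "tensor_norm k (tensor_power k (B ** A) u) \<le> ?R / norm w"
      using w by (metis pos_le_divide_eq mult.commute)
  qed
  then show ?thesis using w by (simp add: w_def field_simps)
qed

section \<open>Growth along a sequence\<close>

text \<open>By \<open>step\<close>, a value at \<open>q\<close> much larger than the value at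
  \<open>p\<close> forces growth at rate \<open>g\<close> after \<open>q\<close>. Repeated, this
  contradicts the zero exponent at infinity. The limit \<open>lim\<close> is used only to attain a
  maximum, so the bound does not depend on the speed of convergence.\<close>

lemma growth_upper_of_dichotomy:
  fixes b :: "int \<Rightarrow> real" and p q :: int and c g \<eta> L :: real
  assumes pos: "\<And>n. b n > 0" and c: "c \<ge> 1" and g: "g > 0" and \<eta>: "0 \<le> \<eta>" "\<eta> \<le> g / 24" and L: "L \<ge> 0"
    and step: "\<And>p q r :: int. p \<le> q \<Longrightarrow> q \<le> r \<Longrightarrow>
       b q \<le> c * exp (3 * \<eta> * (L + \<bar>p\<bar> + \<bar>q\<bar> + \<bar>r\<bar>)) * (b p + exp (- (g * (r - q))) * b r)"
    and lim: "((\<lambda>n::int. ln (b n) / n) \<longlongrightarrow> 0) at_top"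
    and "p \<le> q"
  shows "b q \<le> (2 * c)\<^sup>2 * exp g * exp (12 * \<eta> * (L + \<bar>p\<bar> + \<bar>q\<bar>)) * b p"
proof -
  \<comment> \<open>Replace \<open>q\<close> by the point \<open>s \<ge> q\<close> where \<open>b\<close> is largest relative to the slope \<open>g / 2\<close>. Then the second summand
    in \<open>step\<close> is absorbed by the left-hand side as soon as \<open>r - s\<close> is of the order of the error.\<close>
  define h where "h n = ln (b n) - g * n / 2" for n :: int
  have "\<forall>\<^sub>F n::int in at_top. ln (b n) / n < g / 4"
    using order_tendstoD(2)[OF lim, of "g / 4"] g by simp
  then obtain N0 where N0: "\<And>n::int. n \<ge> N0 \<Longrightarrow> ln (b n) / n < g / 4"
    by (auto simp: eventually_at_top_linorder)
  \<comment> \<open>Beyond \<open>N0\<close> the function \<open>h n\<close> lies below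
    \<open>- g n / 4\<close>, and the last entry of the maximum pushes this below
    \<open>h q\<close>. So \<open>h\<close> on \<open>[q, \<infinity>)\<close> attains its maximum
    in \<open>[q, N]\<close>.\<close>
  define N where "N = Max {N0, q, 1, \<lceil>- 4 * h q / g\<rceil>}"
  have N: "N \<ge> N0" "N \<ge> q" "N \<ge> 1" "N \<ge> \<lceil>- 4 * h q / g\<rceil>" by (simp_all add: N_def)
  have far: "h n \<le> h q" if "n \<ge> N" for n
  proof -
    have n: "real_of_int n > 0" using that N by linarith
    have "ln (b n) \<le> g / 4 * n" using N0[of n] that N n by (simp add: field_simps)
    then have "h n \<le> - (g / 4 * n)" by (simp add: h_def)
    moreover have "- 4 * h q / g \<le> n" using that N by linarith
    ultimately show ?thesis using g by (simp add: field_simps)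
  qed
  obtain s where s: "s \<in> {q..N}" "\<And>n. n \<in> {q..N} \<Longrightarrow> h n \<le> h s"
  proof -
    have "Max (h ` {q..N}) \<in> h ` {q..N}" using N by (intro Max_in) auto
    then obtain s where "s \<in> {q..N}" "Max (h ` {q..N}) = h s" by auto
    moreover have "h n \<le> Max (h ` {q..N})" if "n \<in> {q..N}" for n
      using that by (intro Max_ge) auto
    ultimately show thesis using that by auto
  qed
  have max: "h n \<le> h s" if "n \<ge> q" for n
  proof (cases "n \<le> N")
    case True
    then show ?thesis using s that by auto
  next
    case False
    then have "h n \<le> h q" using far by simp
    also have "h q \<le> h s" using s(2)[of q] N by simp
    finally show ?thesis .
  qed
  have qs: "q \<le> s" using s by simp
  have bmax: "b n \<le> exp (g * (n - s) / 2) * b s" if "n \<ge> q" for n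
  proof -
    have "ln (b n) \<le> g * (n - s) / 2 + ln (b s)"
      using max[OF that] by (simp add: h_def field_simps)
    then have "exp (ln (b n)) \<le> exp (g * (n - s) / 2 + ln (b s))" by simp
    then show ?thesis using pos by (simp add: exp_add)
  qed
  define F where "F = 3 * \<eta> * (L + \<bar>p\<bar> + 2 * \<bar>s\<bar>)"
  have F: "F \<ge> 0" using \<eta> L by (simp add: F_def)
  \<comment> \<open>The gain \<open>exp (- g t / 2)\<close> has to beat \<open>2 c\<close> and the
    error \<open>exp E\<close>, and \<open>E\<close> itself may grow by \<open>g t / 8\<close> since
    it involves the end point \<open>s + t\<close>.\<close>
  define t where "t = \<lceil>4 / g * (F + ln (2 * c))\<rceil>"
  have "0 \<le> 4 / g * (F + ln (2 * c))" using F c g by simp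
  then have t: "4 / g * (F + ln (2 * c)) \<le> t" "t \<le> 4 / g * (F + ln (2 * c)) + 1" "t \<ge> 0"
    unfolding t_def by linarith+
  have t': "F + ln (2 * c) \<le> g / 4 * t" "g / 4 * t \<le> F + ln (2 * c) + g / 4"
    using t(1,2) g by (simp_all add: field_simps)
  define E where "E = 3 * \<eta> * (L + \<bar>p\<bar> + \<bar>s\<bar> + \<bar>s + t\<bar>)"
  have "E \<le> F + 3 * \<eta> * t"
  proof -
    have "3 * \<eta> * (L + \<bar>p\<bar> + \<bar>s\<bar> + \<bar>s + t\<bar>) \<le> 3 * \<eta> * (L + \<bar>p\<bar> + \<bar>s\<bar> + (\<bar>s\<bar> + t))"
      using \<eta> t(3) by (intro mult_left_mono) auto
    then show ?thesis by (simp add: E_def F_def algebra_simps)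
  qed
  moreover have "3 * \<eta> * t \<le> g / 8 * t"
    using \<eta> t(3) by (intro mult_right_mono) auto
  ultimately have E: "E \<le> F + g / 8 * t" by linarith
  have "b s \<le> c * exp E * (b p + exp (- (g * (real_of_int (s + t) - s))) * b (s + t))"
    unfolding E_def using step[of p s "s + t"] t(3) qs \<open>p \<le> q\<close> by simp
  also have "exp (- (g * (real_of_int (s + t) - s))) * b (s + t) \<le> exp (- (g * t)) * (exp (g * t / 2) * b s)"
    using bmax[of "s + t"] qs t(3) by (intro mult_mono) (auto simp: pos less_imp_le)
  also have "exp (- (g * t)) * (exp (g * t / 2) * b s) = exp (- (g / 2 * t)) * b s"
  proof -
    have "exp (- (g * t)) * exp (g * t / 2) = exp (- (g / 2 * t))"
      unfolding mult_exp_exp by simp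
    then show ?thesis by simp
  qed
  finally have "b s \<le> c * exp E * (b p + exp (- (g / 2 * t)) * b s)"
    using c by (simp add: mult_left_mono)
  \<comment> \<open>Half of \<open>b s\<close> can be moved to the left-hand side, at the price of a
    factor 2.\<close>
  moreover have "c * exp E * exp (- (g / 2 * t)) \<le> 1 / 2"
  proof -
    have "E - g / 2 * t \<le> - ln (2 * c)"
    proof -
      have "0 \<le> g * t" using g t(3) by simp
      then show ?thesis using E t'(1) by simp
    qed
    then have "exp (E - g / 2 * t) \<le> exp (- ln (2 * c))" by simp
    also have "\<dots> = 1 / (2 * c)" using c by (simp add: exp_minus field_simps)
    finally have "exp E * exp (- (g / 2 * t)) \<le> 1 / (2 * c)" unfolding mult_exp_exp by simp
    then show ?thesis using c by (simp add: field_simps)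
  qed
  then have "c * exp E * exp (- (g / 2 * t)) * b s \<le> 1 / 2 * b s"
    using pos[of s] by (intro mult_right_mono) auto
  ultimately have bs: "b s \<le> 2 * c * exp E * b p" by (simp add: algebra_simps)
  have "b q \<le> exp (g * (real_of_int q - s) / 2) * b s" using bmax[of q] by simp
  also have "\<dots> \<le> exp (g * (real_of_int q - s) / 2) * (2 * c * exp E * b p)"
    using bs by (intro mult_left_mono) auto
  also have "\<dots> = 2 * c * exp (E - g * (real_of_int s - q) / 2) * b p"
  proof -
    have "exp (g * (real_of_int q - s) / 2) * exp E = exp (E - g * (real_of_int s - q) / 2)"
      unfolding mult_exp_exp by (rule arg_cong[where f = exp]) (simp add: algebra_simps diff_divide_distrib)
    then show ?thesis by simp
  qed
  also have "exp (E - g * (real_of_int s - q) / 2) \<le> exp (12 * \<eta> * (L + \<bar>p\<bar> + \<bar>q\<bar>) + ln (2 * c) + g)"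
  proof -
    have s1: "real_of_int \<bar>s\<bar> \<le> \<bar>q\<bar> + (real_of_int s - q)" using qs by linarith
    have "E \<le> 2 * F + ln (2 * c) + g"
    proof -
      have "0 \<le> ln (2 * c)" using c by simp
      then show ?thesis using E t'(2) F g by linarith
    qed
    also have "2 * F \<le> 6 * \<eta> * (L + \<bar>p\<bar> + 2 * (\<bar>q\<bar> + (real_of_int s - q)))"
    proof -
      have "6 * \<eta> * (L + \<bar>p\<bar> + 2 * \<bar>s\<bar>) \<le> 6 * \<eta> * (L + \<bar>p\<bar> + 2 * (\<bar>q\<bar> + (real_of_int s - q)))"
        using \<eta> s1 by (intro mult_left_mono) auto
      then show ?thesis by (simp add: F_def)
    qed
    also have "\<dots> = 6 * \<eta> * (L + \<bar>p\<bar> + 2 * \<bar>q\<bar>) + 12 * \<eta> * (real_of_int s - q)"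
      by (simp add: algebra_simps)
    \<comment> \<open>Origin of the number 24: the error caused by the unknown distance from
      \<open>q\<close> to \<open>s\<close> must be paid by the slope \<open>g / 2\<close> over this
      distance.\<close>
    also have "12 * \<eta> * (real_of_int s - q) \<le> g / 2 * (real_of_int s - q)"
      using \<eta> qs by (intro mult_right_mono) auto
    also have "6 * \<eta> * (L + \<bar>p\<bar> + 2 * \<bar>q\<bar>) \<le> 6 * \<eta> * (2 * (L + \<bar>p\<bar> + \<bar>q\<bar>))"
      using \<eta> L by (intro mult_left_mono) auto
    finally show ?thesis by (simp add: field_simps)
  qed
  finally have "b q \<le> 2 * c * exp (12 * \<eta> * (L + \<bar>p\<bar> + \<bar>q\<bar>) + ln (2 * c) + g) * b p"
    using c pos[of p] by (simp add: mult_left_mono mult_right_mono less_imp_le)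
  then show ?thesis
    using c by (simp add: exp_add power2_eq_square mult_ac)
qed

text \<open>Here \<open>N k p q\<close> stands for the norm of the \<open>k\<close>-th exterior
  power of the product over \<open>[p, q]\<close>. Divide \<open>growth\<close> by
  \<open>N k p r\<close>: the rates cancel except for \<open>\<lambda>_(k+1)\<close> on
  \<open>[p, q]\<close> in the first term and \<open>- \<lambda>_k\<close> on \<open>[q, r]\<close>
  in the second. Three norms are replaced by exponentials in each term, hence the factor 3 in the
  error.\<close>

lemma growth_dichotomy:
  fixes a :: "int \<Rightarrow> real" and \<eta> L :: real and p q r :: int and N :: "nat \<Rightarrow> int \<Rightarrow> int \<Rightarrow> real" and lam :: "nat \<Rightarrow> real"
  assumes pos: "\<And>n. a n > 0"
    and growth: "\<And>k p q r. k \<le> d \<Longrightarrow> p \<le> q \<Longrightarrow> q \<le> r \<Longrightarrow>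
        N k p r * a q \<le> (real k + 1) * N k q r * N (Suc k) p q * a p + real k * a r * N (k - 1) q r * N k p q"
    and Npos: "\<And>k p q. k \<le> d \<Longrightarrow> p \<le> q \<Longrightarrow> N k p q > 0"
    and N0: "\<And>p q. p \<le> q \<Longrightarrow> N 0 p q = 1" and Nd: "\<And>p q. N (Suc d) p q = 0"
    and dev: "\<And>k (p :: int) (q :: int). k \<in> {1..d} \<Longrightarrow> p \<le> q \<Longrightarrow>
        \<bar>ln (N k p q) - (q - p) * (\<Sum>j=1..k. lam j)\<bar> \<le> \<eta> * (L + \<bar>p\<bar> + \<bar>q\<bar>)"
    and \<eta>: "0 \<le> \<eta>" and L: "L \<ge> 0" and k: "k \<le> d" and "p \<le> q" "q \<le> r"
  shows "a q \<le> (real d + 1) * exp (3 * \<eta> * (L + \<bar>p\<bar> + \<bar>q\<bar> + \<bar>r\<bar>)) *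
     ((if k = d then 0 else exp ((q - p) * lam (Suc k)) * a p)
      + (if k = 0 then 0 else exp (- ((r - q) * lam k)) * a r))"
proof -
  \<comment> \<open>One error term that covers all three windows with end points among
    \<open>p\<close>, \<open>q\<close>, \<open>r\<close>.\<close>
  define E where "E = \<eta> * (L + \<bar>p\<bar> + \<bar>q\<bar> + \<bar>r\<bar>)"
  define Lam where "Lam k = (\<Sum>j=1..k. lam j)" for k
  have Lam_Suc: "Lam (Suc k) = Lam k + lam (Suc k)" for k by (simp add: Lam_def)
  have E0: "E \<ge> 0" using \<eta> L by (simp add: E_def)
  have N: "exp ((v - u) * Lam k - E) \<le> N k u v \<and> N k u v \<le> exp ((v - u) * Lam k + E)"
    if "k \<le> d" "u \<le> v" and uv: "L + real_of_int \<bar>u\<bar> + real_of_int \<bar>v\<bar> \<le> L + \<bar>p\<bar> + \<bar>q\<bar> + \<bar>r\<bar>" for k u v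
  proof (cases "k = 0")
    case True
    then show ?thesis using E0 that N0 by (simp add: Lam_def)
  next
    case False
    have "\<eta> * (L + real_of_int \<bar>u\<bar> + real_of_int \<bar>v\<bar>) \<le> E" unfolding E_def using uv \<eta> by (intro mult_left_mono) auto
    with dev[of k u v] False that have "\<bar>ln (N k u v) - (v - u) * Lam k\<bar> \<le> E"
      by (auto simp: Lam_def)
    then have "(v - u) * Lam k - E \<le> ln (N k u v)" "ln (N k u v) \<le> (v - u) * Lam k + E"
      by linarith+
    then have "exp ((v - u) * Lam k - E) \<le> exp (ln (N k u v))" "exp (ln (N k u v)) \<le> exp ((v - u) * Lam k + E)"
      by simp_all
    then show ?thesis using Npos[of k u v] that by simp
  qed
  have s: "L + \<bar>p\<bar> + \<bar>r\<bar> \<le> L + \<bar>p\<bar> + \<bar>q\<bar> + \<bar>r\<bar>" "L + \<bar>p\<bar> + \<bar>q\<bar> \<le> L + \<bar>p\<bar> + \<bar>q\<bar> + \<bar>r\<bar>"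
    "L + \<bar>q\<bar> + \<bar>r\<bar> \<le> L + \<bar>p\<bar> + \<bar>q\<bar> + \<bar>r\<bar>" by auto
  have pr: "p \<le> r" using assms by simp
  have nn: "0 \<le> N k u v" if "k \<le> d" "u \<le> v" for k u v using Npos[OF that] by simp
  define x where "x = (real k + 1) * N k q r * N (Suc k) p q * a p"
  define y where "y = real k * a r * N (k - 1) q r * N k p q"
  define R where "R = exp ((r - p) * Lam k + 2 * E)"
  have x: "x \<le> (real d + 1) * R * (if k = d then 0 else exp ((q - p) * lam (Suc k)) * a p)"
  proof (cases "k = d")
    case True
    then show ?thesis by (simp add: x_def Nd)
  next
    case False
    then have "Suc k \<le> d" using k by simp
    then have "x \<le> (real d + 1) * exp ((r - q) * Lam k + E) * exp ((q - p) * Lam (Suc k) + E) * a p"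
      unfolding x_def using N[OF k \<open>q \<le> r\<close> s(3)] N[OF \<open>Suc k \<le> d\<close> \<open>p \<le> q\<close> s(2)] k \<open>p \<le> q\<close> \<open>q \<le> r\<close> pos[of p]
      by (intro mult_mono mult_nonneg_nonneg nn) auto
    also have "\<dots> = (real d + 1) * R * (exp ((q - p) * lam (Suc k)) * a p)"
    proof -
      have "exp ((r - q) * Lam k + E) * exp ((q - p) * Lam (Suc k) + E) = R * exp ((q - p) * lam (Suc k))"
        unfolding R_def mult_exp_exp by (rule arg_cong[where f = exp]) (simp add: Lam_Suc algebra_simps)
      then show ?thesis by (simp add: mult.assoc)
    qed
    finally show ?thesis using False by simp
  qed
  have y: "y \<le> (real d + 1) * R * (if k = 0 then 0 else exp (- ((r - q) * lam k)) * a r)"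
  proof (cases "k = 0")
    case True
    then show ?thesis by (simp add: y_def)
  next
    case False
    then have k1: "k - 1 \<le> d" "k = Suc (k - 1)" using k by auto
    then have "y \<le> (real d + 1) * a r * exp ((r - q) * Lam (k - 1) + E) * exp ((q - p) * Lam k + E)"
      unfolding y_def using N[OF k1(1) \<open>q \<le> r\<close> s(3)] N[OF k \<open>p \<le> q\<close> s(2)] k k1 \<open>p \<le> q\<close> \<open>q \<le> r\<close> pos[of r]
      by (intro mult_mono mult_nonneg_nonneg nn) auto
    also have "Lam (k - 1) = Lam k - lam k" using Lam_Suc[of "k - 1"] k1(2) by simp
    also have "(real d + 1) * a r * exp ((r - q) * (Lam k - lam k) + E) * exp ((q - p) * Lam k + E) =
       (real d + 1) * R * (exp (- ((r - q) * lam k)) * a r)"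
    proof -
      have "exp ((r - q) * (Lam k - lam k) + E) * exp ((q - p) * Lam k + E) = R * exp (- ((r - q) * lam k))"
        unfolding R_def mult_exp_exp by (rule arg_cong[where f = exp]) (simp add: algebra_simps)
      then show ?thesis by (simp add: mult_ac)
    qed
    finally show ?thesis using False by simp
  qed
  define S where "S = (if k = d then 0 else exp ((q - p) * lam (Suc k)) * a p)
      + (if k = 0 then 0 else exp (- ((r - q) * lam k)) * a r)"
  have "exp ((r - p) * Lam k - E) * a q \<le> N k p r * a q"
    using N[OF k pr s(1)] pos[of q] by (intro mult_right_mono) auto
  also have "\<dots> \<le> x + y" unfolding x_def y_def using growth[OF k \<open>p \<le> q\<close> \<open>q \<le> r\<close>] by simp
  also have "\<dots> \<le> (real d + 1) * R * S" unfolding S_def distrib_left by (intro add_mono x y)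
  finally have "exp (- ((r - p) * Lam k - E)) * (exp ((r - p) * Lam k - E) * a q) \<le>
      exp (- ((r - p) * Lam k - E)) * ((real d + 1) * R * S)"
    by (intro mult_left_mono) auto
  moreover have "exp (- ((r - p) * Lam k - E)) * (exp ((r - p) * Lam k - E) * a q) = a q"
    by (simp add: mult.assoc[symmetric] mult_exp_exp)
  moreover have "exp (- ((r - p) * Lam k - E)) * R = exp (3 * E)"
    by (simp add: R_def mult_exp_exp)
  moreover have "exp (- ((r - p) * Lam k - E)) * ((real d + 1) * R * S) =
      (real d + 1) * (exp (- ((r - p) * Lam k - E)) * R) * S"
    by (simp only: mult_ac)
  ultimately have "a q \<le> (real d + 1) * exp (3 * E) * S" by metis
  then show ?thesis unfolding S_def E_def by (simp only: mult.assoc[of 3 \<eta>] of_int_diff of_int_abs)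
qed

text \<open>After subtraction of the slope \<open>lam i\<close>, the gap above the block of
  exponents equal to \<open>lam i\<close> bounds growth from \<open>p\<close> to \<open>q\<close>,
  and the gap below it bounds decay, which is growth in reversed time. If there is no gap on one
  side, one term of the dichotomy is absent and the bound is direct. Since \<open>p\<close> and
  \<open>q\<close> come in either order, both bounds combine into one.\<close>

lemma growth_two_sided:
  fixes a :: "int \<Rightarrow> real" and \<eta> L :: real and p q :: int and N :: "nat \<Rightarrow> int \<Rightarrow> int \<Rightarrow> real" and lam :: "nat \<Rightarrow> real"
  assumes pos: "\<And>n. a n > 0"
    and growth: "\<And>k p q r. k \<le> d \<Longrightarrow> p \<le> q \<Longrightarrow> q \<le> r \<Longrightarrow>
        N k p r * a q \<le> (real k + 1) * N k q r * N (Suc k) p q * a p + real k * a r * N (k - 1) q r * N k p q"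
    and Npos: "\<And>k p q. k \<le> d \<Longrightarrow> p \<le> q \<Longrightarrow> N k p q > 0"
    and N0: "\<And>p q. p \<le> q \<Longrightarrow> N 0 p q = 1" and Nd: "\<And>p q. N (Suc d) p q = 0"
    and dev: "\<And>k (p :: int) (q :: int). k \<in> {1..d} \<Longrightarrow> p \<le> q \<Longrightarrow>
        \<bar>ln (N k p q) - (q - p) * (\<Sum>j=1..k. lam j)\<bar> \<le> \<eta> * (L + \<bar>p\<bar> + \<bar>q\<bar>)"
    and \<eta>: "0 \<le> \<eta>" and L: "L \<ge> 0"
    and gap: "\<And>k. k \<in> {1..<d} \<Longrightarrow> lam (Suc k) < lam k \<Longrightarrow> \<eta> \<le> (lam k - lam (Suc k)) / 24 \<and> lam k - lam (Suc k) \<le> G"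
    and dec: "\<And>k. k \<in> {1..<d} \<Longrightarrow> lam (Suc k) \<le> lam k" and G: "G \<ge> (0::real)"
    and i: "i \<in> distinct_exponent_indices d lam"
    and lim_top: "((\<lambda>n::int. ln (a n) / n) \<longlongrightarrow> lam i) at_top"
    and lim_bot: "((\<lambda>n::int. ln (a n) / n) \<longlongrightarrow> lam i) at_bot"
  shows "a q * exp (- ((q - p) * lam i)) \<le> (2 * (real d + 1))\<^sup>2 * exp G * exp (12 * \<eta> * (L + \<bar>p\<bar> + \<bar>q\<bar>)) * a p"
proof -
  note core = growth_dichotomy[OF pos growth Npos N0 Nd dev \<eta> L]
  define l where "l = lam i"
  define c where "c = real d + 1"
  have c: "c \<ge> 1" by (simp add: c_def)
  define b where "b n = a n * exp (- (n * l))" for n :: int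
  have bpos: "b n > 0" for n using pos by (simp add: b_def)
  have ln_b: "ln (b n) / n = ln (a n) / n - l" if "n \<noteq> 0" for n :: int
    using that pos[of n] by (simp add: b_def ln_mult diff_divide_distrib)
  have lim_top': "((\<lambda>n::int. ln (b n) / n) \<longlongrightarrow> 0) at_top"
  proof -
    have "((\<lambda>n::int. ln (a n) / n - l) \<longlongrightarrow> 0) at_top"
      using tendsto_diff[OF lim_top tendsto_const[of l]] by (simp add: l_def)
    then show ?thesis
    proof (rule Lim_transform_eventually)
      show "\<forall>\<^sub>F n::int in at_top. ln (a n) / n - l = ln (b n) / n"
        using eventually_gt_at_top[of "0::int"] by (rule eventually_mono) (simp add: ln_b)
    qed
  qed
  have lim_bot': "((\<lambda>n::int. ln (b n) / n) \<longlongrightarrow> 0) at_bot"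
  proof -
    have "((\<lambda>n::int. ln (a n) / n - l) \<longlongrightarrow> 0) at_bot"
      using tendsto_diff[OF lim_bot tendsto_const[of l]] by (simp add: l_def)
    then show ?thesis
    proof (rule Lim_transform_eventually)
      show "\<forall>\<^sub>F n::int in at_bot. ln (a n) / n - l = ln (b n) / n"
        using eventually_le_at_bot[of "-1::int"] by (rule eventually_mono) (simp add: ln_b)
    qed
  qed
  have lim_rev: "((\<lambda>n::int. ln (b (- n)) / n) \<longlongrightarrow> 0) at_top"
  proof -
    have f: "filterlim (uminus :: int \<Rightarrow> int) at_bot at_top"
      unfolding filterlim_at_bot
    proof
      fix Z :: int
      show "\<forall>\<^sub>F x in at_top. - x \<le> Z"
        using eventually_ge_at_top[of "- Z"] by (rule eventually_mono) simp
    qed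
    have "((\<lambda>n::int. ln (b (- n)) / real_of_int (- n)) \<longlongrightarrow> 0) at_top"
      using filterlim_compose[OF lim_bot' f] by simp
    from tendsto_minus[OF this] show ?thesis by simp
  qed
  \<comment> \<open>Large enough for the constant \<open>c\<close> of the direct cases and for
    \<open>(2 c)^2 exp g\<close> with any gap \<open>g \<le> G\<close>.\<close>
  define D where "D = (2 * c)\<^sup>2 * exp G"
  have cD: "c \<le> D"
  proof -
    have "c * 1 \<le> (2 * c) * (2 * c)" using c by (intro mult_mono) auto
    then have "c * 1 \<le> D" unfolding D_def power2_eq_square using G c by (intro mult_mono) auto
    then show ?thesis by simp
  qed
  have e1: "exp ((q - p) * l) * exp (- (q * l)) = exp (- (p * l))" for p q :: int
    unfolding mult_exp_exp by (rule arg_cong[where f = exp]) (simp add: algebra_simps)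
  have e2: "exp (- ((q - p) * l)) * exp (- (p * l)) = exp (- (q * l))" for p q :: int
    unfolding mult_exp_exp by (rule arg_cong[where f = exp]) (simp add: algebra_simps)
  have i': "1 \<le> i" "i \<le> d" "i = 1 \<or> lam i < lam (i - 1)"
    using i by (auto simp: distinct_exponent_indices_def)
  have up: "b q \<le> D * exp (12 * \<eta> * (L + \<bar>p\<bar> + \<bar>q\<bar>)) * b p" if "p \<le> q" for p q
  proof (cases "i = 1")
    case True
    \<comment> \<open>In degree 0 the term at \<open>r\<close> is absent, so the third point may
      coincide with \<open>q\<close>.\<close>
    have "a q \<le> c * exp (3 * \<eta> * (L + \<bar>p\<bar> + \<bar>q\<bar> + \<bar>q\<bar>)) * (exp ((q - p) * l) * a p)"
      using core[of 0 p q q] that True i' by (simp add: c_def l_def)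
    then have "a q * exp (- (q * l)) \<le> c * exp (3 * \<eta> * (L + \<bar>p\<bar> + \<bar>q\<bar> + \<bar>q\<bar>)) * (exp ((q - p) * l) * a p) * exp (- (q * l))"
      by (intro mult_right_mono) auto
    also have "\<dots> = c * exp (3 * \<eta> * (L + \<bar>p\<bar> + \<bar>q\<bar> + \<bar>q\<bar>)) * b p"
      unfolding b_def e1[of q p, symmetric] by (simp only: mult_ac)
    also have "\<dots> \<le> D * exp (12 * \<eta> * (L + \<bar>p\<bar> + \<bar>q\<bar>)) * b p"
    proof -
      have "3 * \<eta> * (L + \<bar>p\<bar> + \<bar>q\<bar> + \<bar>q\<bar>) \<le> 3 * \<eta> * (4 * (L + \<bar>p\<bar> + \<bar>q\<bar>))"
        using \<eta> L by (intro mult_left_mono) auto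
      also have "3 * \<eta> * (4 * (L + \<bar>p\<bar> + \<bar>q\<bar>)) = 12 * \<eta> * (L + \<bar>p\<bar> + \<bar>q\<bar>)" by algebra
      finally have "3 * \<eta> * (L + \<bar>p\<bar> + \<bar>q\<bar> + \<bar>q\<bar>) \<le> 12 * \<eta> * (L + \<bar>p\<bar> + \<bar>q\<bar>)" .
      then show ?thesis
        using cD c bpos[of p] by (intro mult_right_mono mult_mono) (auto simp del: mult_le_cancel_left)
    qed
    finally show ?thesis by (simp add: b_def)
  next
    case False
    define g where "g = lam (i - 1) - l"
    have g: "g > 0" "\<eta> \<le> g / 24" "g \<le> G"
    proof -
      have "i - 1 \<in> {1..<d}" "Suc (i - 1) = i" using i' False by auto
      then show "g > 0" "\<eta> \<le> g / 24" "g \<le> G"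
        using gap[of "i - 1"] i' False by (auto simp: g_def l_def)
    qed
    have "b q \<le> (2 * c)\<^sup>2 * exp g * exp (12 * \<eta> * (L + \<bar>p\<bar> + \<bar>q\<bar>)) * b p"
    proof (rule growth_upper_of_dichotomy[OF bpos c g(1) \<eta> g(2) L _ lim_top' that])
      fix p q r :: int assume pqr: "p \<le> q" "q \<le> r"
      have "a q \<le> c * exp (3 * \<eta> * (L + \<bar>p\<bar> + \<bar>q\<bar> + \<bar>r\<bar>)) *
         (exp ((q - p) * l) * a p + exp (- ((r - q) * (l + g))) * a r)"
      proof -
        have "i - 1 \<le> d" "Suc (i - 1) = i" "i - 1 \<noteq> d" "i - 1 \<noteq> 0" using i' False by auto
        then show ?thesis using core[of "i - 1" p q r] pqr by (simp add: c_def l_def g_def)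
      qed
      then have "a q * exp (- (q * l)) \<le> c * exp (3 * \<eta> * (L + \<bar>p\<bar> + \<bar>q\<bar> + \<bar>r\<bar>)) *
         (exp ((q - p) * l) * a p + exp (- ((r - q) * (l + g))) * a r) * exp (- (q * l))"
        by (intro mult_right_mono) auto
      also have "\<dots> = c * exp (3 * \<eta> * (L + \<bar>p\<bar> + \<bar>q\<bar> + \<bar>r\<bar>)) * (b p + exp (- (g * (r - q))) * b r)"
      proof -
        have "exp ((q - p) * l) * a p * exp (- (q * l)) = b p"
          unfolding b_def e1[of q p, symmetric] by (simp only: mult_ac)
        moreover have "exp (- ((r - q) * (l + g))) * a r * exp (- (q * l)) = exp (- (g * (r - q))) * b r"
        proof -
          have "exp (- ((r - q) * (l + g))) * exp (- (q * l)) = exp (- (g * (r - q))) * exp (- (r * l))"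
            unfolding mult_exp_exp by (rule arg_cong[where f = exp]) (simp add: algebra_simps)
          then show ?thesis by (simp add: b_def mult_ac)
        qed
        ultimately show ?thesis by (simp only: mult.assoc distrib_right)
      qed
      finally show "b q \<le> c * exp (3 * \<eta> * (L + \<bar>p\<bar> + \<bar>q\<bar> + \<bar>r\<bar>)) * (b p + exp (- (g * (r - q))) * b r)"
        by (simp add: b_def)
    qed
    also have "\<dots> \<le> D * exp (12 * \<eta> * (L + \<bar>p\<bar> + \<bar>q\<bar>)) * b p"
      unfolding D_def using g(3) c bpos[of p] by (intro mult_right_mono mult_left_mono) auto
    finally show ?thesis .
  qed
  \<comment> \<open>The index \<open>i\<close> is the first of its block of equal exponents; the gap
    below the block sits at its last index.\<close>
  define m where "m = Max {k\<in>{i..d}. lam k = l}"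
  have "m \<in> {k\<in>{i..d}. lam k = l}"
    unfolding m_def by (rule Max_in) (use i' in \<open>auto simp: l_def\<close>)
  then have m: "i \<le> m" "m \<le> d" "lam m = l" by auto
  have m_max: "lam (Suc m) \<noteq> l" if "m < d"
  proof
    assume "lam (Suc m) = l"
    then have "Suc m \<in> {k\<in>{i..d}. lam k = l}" using that m by simp
    then have "Suc m \<le> m" unfolding m_def by (intro Max_ge) auto
    then show False by simp
  qed
  have down: "b p \<le> D * exp (12 * \<eta> * (L + \<bar>p\<bar> + \<bar>q\<bar>)) * b q" if "p \<le> q" for p q
  proof (cases "m = d")
    case True
    have "a p \<le> c * exp (3 * \<eta> * (L + \<bar>p\<bar> + \<bar>p\<bar> + \<bar>q\<bar>)) * (exp (- ((q - p) * l)) * a q)"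
      using core[of d p p q] that True i' m by (simp add: c_def)
    then have "a p * exp (- (p * l)) \<le> c * exp (3 * \<eta> * (L + \<bar>p\<bar> + \<bar>p\<bar> + \<bar>q\<bar>)) * (exp (- ((q - p) * l)) * a q) * exp (- (p * l))"
      by (intro mult_right_mono) auto
    also have "\<dots> = c * exp (3 * \<eta> * (L + \<bar>p\<bar> + \<bar>p\<bar> + \<bar>q\<bar>)) * b q"
      unfolding b_def e2[of q p, symmetric] by (simp only: mult_ac)
    also have "\<dots> \<le> D * exp (12 * \<eta> * (L + \<bar>p\<bar> + \<bar>q\<bar>)) * b q"
    proof -
      have "3 * \<eta> * (L + \<bar>p\<bar> + \<bar>p\<bar> + \<bar>q\<bar>) \<le> 3 * \<eta> * (4 * (L + \<bar>p\<bar> + \<bar>q\<bar>))"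
        using \<eta> L by (intro mult_left_mono) auto
      also have "3 * \<eta> * (4 * (L + \<bar>p\<bar> + \<bar>q\<bar>)) = 12 * \<eta> * (L + \<bar>p\<bar> + \<bar>q\<bar>)" by algebra
      finally have "3 * \<eta> * (L + \<bar>p\<bar> + \<bar>p\<bar> + \<bar>q\<bar>) \<le> 12 * \<eta> * (L + \<bar>p\<bar> + \<bar>q\<bar>)" .
      then show ?thesis
        using cD c bpos[of q] by (intro mult_right_mono mult_mono) (auto simp del: mult_le_cancel_left)
    qed
    finally show ?thesis by (simp add: b_def)
  next
    case False
    then have md: "m < d" using m by simp
    define g where "g = l - lam (Suc m)"
    have "lam (Suc m) < lam m" using dec[of m] m_max md m i' by fastforce
    then have g: "g > 0" "\<eta> \<le> g / 24" "g \<le> G"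
      using gap[of m] i' m md by (auto simp: g_def)
    \<comment> \<open>Time reversal exchanges the two summands of the dichotomy.\<close>
    define b' where "b' n = b (- n)" for n
    have lim_rev': "((\<lambda>n::int. ln (b' n) / n) \<longlongrightarrow> 0) at_top"
      using lim_rev by (simp add: b'_def)
    have b'pos: "b' n > 0" for n by (simp add: b'_def bpos)
    have "b' (- p) \<le> (2 * c)\<^sup>2 * exp g * exp (12 * \<eta> * (L + \<bar>- q\<bar> + \<bar>- p\<bar>)) * b' (- q)"
    proof (rule growth_upper_of_dichotomy[OF b'pos c g(1) \<eta> g(2) L _ lim_rev'])
      fix p' q' r' :: int assume pqr': "p' \<le> q'" "q' \<le> r'"
      define p q r where "p = - r'" "q = - q'" "r = - p'"
      have pqr: "p \<le> q" "q \<le> r" using pqr' by (simp_all add: p_q_r_def)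
      have "a q \<le> c * exp (3 * \<eta> * (L + \<bar>p\<bar> + \<bar>q\<bar> + \<bar>r\<bar>)) *
         (exp ((q - p) * (l - g)) * a p + exp (- ((r - q) * l)) * a r)"
        using core[of m p q r] pqr False i' m by (simp add: c_def g_def)
      then have "a q * exp (- (q * l)) \<le> c * exp (3 * \<eta> * (L + \<bar>p\<bar> + \<bar>q\<bar> + \<bar>r\<bar>)) *
         (exp ((q - p) * (l - g)) * a p + exp (- ((r - q) * l)) * a r) * exp (- (q * l))"
        by (intro mult_right_mono) auto
      also have "\<dots> = c * exp (3 * \<eta> * (L + \<bar>p\<bar> + \<bar>q\<bar> + \<bar>r\<bar>)) * (exp (- (g * (q - p))) * b p + b r)"
      proof -
        have "exp (- ((r - q) * l)) * a r * exp (- (q * l)) = b r"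
          unfolding b_def e2[of r q, symmetric] by (simp only: mult_ac)
        moreover have "exp ((q - p) * (l - g)) * a p * exp (- (q * l)) = exp (- (g * (q - p))) * b p"
        proof -
          have "exp ((q - p) * (l - g)) * exp (- (q * l)) = exp (- (g * (q - p))) * exp (- (p * l))"
            unfolding mult_exp_exp by (rule arg_cong[where f = exp]) (simp add: algebra_simps)
          then show ?thesis by (simp add: b_def mult_ac)
        qed
        ultimately show ?thesis by (simp only: mult.assoc distrib_right)
      qed
      finally show "b' q' \<le> c * exp (3 * \<eta> * (L + \<bar>p'\<bar> + \<bar>q'\<bar> + \<bar>r'\<bar>)) * (b' p' + exp (- (g * (r' - q'))) * b' r')"
        by (simp add: b_def b'_def p_q_r_def algebra_simps)
    qed (use that in simp)
    also have "\<dots> \<le> D * exp (12 * \<eta> * (L + \<bar>p\<bar> + \<bar>q\<bar>)) * b q"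
    proof -
      have "(2 * c)\<^sup>2 * exp g * exp (12 * \<eta> * (L + \<bar>- q\<bar> + \<bar>- p\<bar>)) * b' (- q) =
          (2 * c)\<^sup>2 * exp g * exp (12 * \<eta> * (L + \<bar>p\<bar> + \<bar>q\<bar>)) * b q"
        by (simp add: b'_def algebra_simps)
      also have "\<dots> \<le> D * exp (12 * \<eta> * (L + \<bar>p\<bar> + \<bar>q\<bar>)) * b q"
        unfolding D_def using g(3) c bpos[of q] by (intro mult_right_mono mult_left_mono) auto
      finally show ?thesis .
    qed
    finally show ?thesis by (simp add: b'_def)
  qed
  have "b q \<le> D * exp (12 * \<eta> * (L + \<bar>p\<bar> + \<bar>q\<bar>)) * b p"
    using up[of p q] down[of q p] by (cases "p \<le> q") (auto simp: algebra_simps)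
  then have "b q * exp (p * l) \<le> D * exp (12 * \<eta> * (L + \<bar>p\<bar> + \<bar>q\<bar>)) * b p * exp (p * l)"
    by (intro mult_right_mono) auto
  also have "\<dots> = D * exp (12 * \<eta> * (L + \<bar>p\<bar> + \<bar>q\<bar>)) * a p"
    by (simp add: b_def exp_minus)
  also have "b q * exp (p * l) = a q * exp (- ((q - p) * l))"
  proof -
    have "exp (- (q * l)) * exp (p * l) = exp (- ((q - p) * l))"
      unfolding mult_exp_exp by (rule arg_cong[where f = exp]) (simp add: algebra_simps)
    then show ?thesis by (simp add: b_def)
  qed
  finally show ?thesis by (simp add: D_def c_def l_def)
qed

section \<open>Exponentially small sequences\<close>

text \<open>The form of the final estimate, where one \<open>C\<close> is both the factor and the
  inverse of the rate; \<open>exp_smallI\<close> and \<open>exp_smallE\<close> trade it for two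
  independent constants.\<close>

definition exp_small :: "(nat \<Rightarrow> real) \<Rightarrow> bool" where
  "exp_small f \<longleftrightarrow> (\<exists>C>0. \<forall>n. f n \<le> C * exp (- (1 / C) * real n))"

lemma exp_smallI:
  assumes "c > 0" "\<And>n. f n \<le> K * exp (- c * real n)"
  shows "exp_small f"
  unfolding exp_small_def
proof (intro exI[of _ "max (max K 1) (1 / c)"] conjI allI)
  let ?C = "max (max K 1) (1 / c)"
  show C: "?C > 0" by simp
  fix n
  have "1 / ?C \<le> c" using assms(1) by (simp add: field_simps max_def)
  then have "1 / ?C * real n \<le> c * real n" by (intro mult_right_mono) auto
  then have "exp (- c * real n) \<le> exp (- (1 / ?C) * real n)"
    unfolding exp_le_cancel_iff by linarith
  then have "K * exp (- c * real n) \<le> ?C * exp (- (1 / ?C) * real n)"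
    by (intro mult_mono) auto
  with assms(2)[of n] show "f n \<le> ?C * exp (- (1 / ?C) * real n)" by linarith
qed

lemma exp_smallE:
  assumes "exp_small f"
  obtains K c where "K > 0" "c > 0" "\<And>n. f n \<le> K * exp (- c * real n)"
proof -
  obtain C where "C > 0" "\<And>n. f n \<le> C * exp (- (1 / C) * real n)"
    using assms by (auto simp: exp_small_def)
  then show thesis using that[of C "1 / C"] by simp
qed

lemma exp_small_mono:
  assumes "exp_small g" "\<And>n. f n \<le> g n"
  shows "exp_small f"
  using assms order_trans unfolding exp_small_def by meson

lemma exp_small_add:
  assumes "exp_small f" "exp_small g"
  shows "exp_small (\<lambda>n. f n + g n)"
proof -
  obtain K c where f: "K > 0" "c > 0" "\<And>n. f n \<le> K * exp (- c * real n)"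
    using assms(1) by (rule exp_smallE) blast
  obtain K' c' where g: "K' > 0" "c' > 0" "\<And>n. g n \<le> K' * exp (- c' * real n)"
    using assms(2) by (rule exp_smallE) blast
  show ?thesis
  proof (rule exp_smallI)
    show "min c c' > 0" using f g by simp
    fix n
    have "K * exp (- c * real n) \<le> K * exp (- min c c' * real n)"
      using f by (intro mult_left_mono) (auto intro!: mult_right_mono)
    moreover have "K' * exp (- c' * real n) \<le> K' * exp (- min c c' * real n)"
      using g by (intro mult_left_mono) (auto intro!: mult_right_mono)
    ultimately show "f n + g n \<le> (K + K') * exp (- min c c' * real n)"
      using f(3)[of n] g(3)[of n] by (simp add: distrib_right)
  qed
qed

lemma exp_small_sum:
  "finite I \<Longrightarrow> (\<And>i. i \<in> I \<Longrightarrow> exp_small (f i)) \<Longrightarrow> exp_small (\<lambda>n. \<Sum>i\<in>I. f i n)"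
proof (induction I rule: finite_induct)
  case empty
  show ?case by (rule exp_smallI[of 1 _ 0]) auto
next
  case (insert i I)
  then show ?case by (simp add: exp_small_add)
qed

text \<open>Finitely many \<open>n\<close> are absorbed by the factor, because \<open>f\<close> is
  bounded; for probabilities \<open>b = 1\<close>.\<close>

lemma exp_small_eventually:
  assumes "exp_small g" "\<And>n. n \<ge> n0 \<Longrightarrow> f n \<le> g n" "\<And>n. f n \<le> b"
  shows "exp_small f"
proof -
  obtain K c where g: "K > 0" "c > 0" "\<And>n. g n \<le> K * exp (- c * real n)"
    using assms(1) by (rule exp_smallE) blast
  show ?thesis
  proof (rule exp_smallI[OF g(2)])
    fix n
    show "f n \<le> (K + \<bar>b\<bar> * exp (c * real n0)) * exp (- c * real n)"
    proof (cases "n \<ge> n0")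
      case True
      have "K * exp (- c * real n) \<le> (K + \<bar>b\<bar> * exp (c * real n0)) * exp (- c * real n)"
        by (intro mult_right_mono) auto
      then show ?thesis using assms(2)[OF True] g(3)[of n] by linarith
    next
      case False
      have "f n \<le> \<bar>b\<bar> * 1" using assms(3)[of n] by simp
      also have "\<bar>b\<bar> * 1 \<le> \<bar>b\<bar> * (exp (c * real n0) * exp (- c * real n))"
        using False g(2) by (intro mult_left_mono) (auto simp: mult_exp_exp)
      also have "\<dots> \<le> (K + \<bar>b\<bar> * exp (c * real n0)) * exp (- c * real n)"
        using g(1) by (simp add: distrib_right)
      finally show ?thesis .
    qed
  qed
qed

lemma exp_small_poly:
  assumes "exp_small g" "\<And>n. f n \<le> (real n + 1) * g n"
  shows "exp_small f"
proof -
  obtain K c where g: "K > 0" "c > 0" "\<And>n. g n \<le> K * exp (- c * real n)"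
    using assms(1) by (rule exp_smallE) blast
  show ?thesis
  proof (rule exp_smallI[of "c / 2"])
    show "c / 2 > 0" using g by simp
    fix n
    have "f n \<le> (real n + 1) * (K * exp (- c * real n))"
      by (rule order_trans[OF assms(2)]) (intro mult_left_mono g, auto)
    \<comment> \<open>Half of the rate pays for the linear factor, through
      \<open>t \<le> exp t\<close> at \<open>t = c n / 2\<close>.\<close>
    also have "real n + 1 \<le> (2 / c + 1) * exp (c / 2 * real n)"
    proof -
      have "c / 2 * real n \<le> exp (c / 2 * real n)"
        using exp_ge_add_one_self[of "c / 2 * real n"] by linarith
      then have "2 / c * (c / 2 * real n) \<le> 2 / c * exp (c / 2 * real n)"
        using g(2) by (intro mult_left_mono) auto
      then have "real n \<le> 2 / c * exp (c / 2 * real n)" using g(2) by simp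
      moreover have "1 \<le> exp (c / 2 * real n)" using g(2) by simp
      ultimately show ?thesis unfolding distrib_right by linarith
    qed
    also have "(2 / c + 1) * exp (c / 2 * real n) * (K * exp (- c * real n)) =
        (2 / c + 1) * K * (exp (c / 2 * real n) * exp (- c * real n))" by simp
    also have "exp (c / 2 * real n) * exp (- c * real n) = exp (- (c / 2) * real n)"
      unfolding mult_exp_exp by (rule arg_cong[where f = exp]) (simp add: field_simps)
    finally show "f n \<le> (2 / c + 1) * K * exp (- (c / 2) * real n)"
      using g(1) by (simp add: mult_right_mono)
  qed
qed

lemma exp_small_rescale:
  assumes "exp_small g" "c > 0" "\<And>n. \<exists>m. real m \<ge> c * real n \<and> f n \<le> g m"
  shows "exp_small f"
proof -
  obtain K d where g: "K > 0" "d > 0" "\<And>n. g n \<le> K * exp (- d * real n)"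
    using assms(1) by (rule exp_smallE) blast
  show ?thesis
  proof (rule exp_smallI[of "d * c"])
    show "d * c > 0" using g assms by simp
    fix n
    obtain m where m: "real m \<ge> c * real n" "f n \<le> g m" using assms(3) by blast
    have "K * exp (- d * real m) \<le> K * exp (- (d * c) * real n)"
      using g m by (intro mult_left_mono) (auto simp: mult.assoc)
    with g(3)[of m] m show "f n \<le> K * exp (- (d * c) * real n)" by linarith
  qed
qed

text \<open>Vitali's argument: keep a longest interval, discard all that meet it, and repeat. The
  points \<open>j i\<close> count the discarded intervals, since they are distinct and stay close to
  the kept one.\<close>

lemma disjoint_interval_selection:
  fixes a b j :: "'i \<Rightarrow> int"
  assumes "finite S" "inj_on j S" "\<And>i. i \<in> S \<Longrightarrow> a i \<le> j i \<and> j i \<le> b i \<and> a i < b i"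
  shows "\<exists>R\<subseteq>S. (\<forall>i\<in>R. \<forall>k\<in>R. i \<noteq> k \<longrightarrow> b i < a k \<or> b k < a i) \<and>
           real (card S) \<le> 4 * (\<Sum>i\<in>R. real_of_int (b i - a i))"
  using assms
proof (induction "card S" arbitrary: S rule: less_induct)
  case less
  show ?case
  proof (cases "S = {}")
    case True
    then show ?thesis by auto
  next
    case False
    define m where "m = Max ((\<lambda>i. b i - a i) ` S)"
    have "m \<in> (\<lambda>i. b i - a i) ` S" unfolding m_def using False less.prems by (intro Max_in) auto
    then obtain s where s: "s \<in> S" "m = b s - a s" by auto
    have smax: "b i - a i \<le> m" if "i \<in> S" for i
      unfolding m_def using that less.prems by (intro Max_ge) auto
    define S' where "S' = {i\<in>S. b i < a s \<or> b s < a i}"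
    have S': "S' \<subseteq> S" "s \<notin> S'" using less.prems(3)[OF s(1)] by (auto simp: S'_def)
    then have "card S' < card S" using less.prems(1) s by (intro psubset_card_mono) auto
    moreover have "finite S'" "inj_on j S'" using S' less.prems finite_subset inj_on_subset by blast+
    ultimately obtain R where R: "R \<subseteq> S'" "\<forall>i\<in>R. \<forall>k\<in>R. i \<noteq> k \<longrightarrow> b i < a k \<or> b k < a i"
      "real (card S') \<le> 4 * (\<Sum>i\<in>R. real_of_int (b i - a i))"
      using less.hyps[of S'] less.prems(3) S' by (auto simp: subset_iff)
    \<comment> \<open>A discarded interval has length at most \<open>m\<close> and meets
      \<open>[a s, b s]\<close>, which has length \<open>m\<close>. This leaves
      \<open>3 m + 1 \<le> 4 m\<close> integers, as \<open>m \<ge> 1\<close>.\<close>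
    have "j ` (S - S') \<subseteq> {a s - m .. b s + m}"
    proof clarify
      fix i assume "i \<in> S" "i \<notin> S'"
      then show "j i \<in> {a s - m .. b s + m}"
        using smax[of i] less.prems(3)[of i] by (auto simp: S'_def)
    qed
    then have "card (j ` (S - S')) \<le> card {a s - m .. b s + m}" by (intro card_mono) auto
    moreover have "card (j ` (S - S')) = card (S - S')"
      using less.prems(2) by (intro card_image inj_on_subset[OF less.prems(2)]) auto
    ultimately have "card (S - S') \<le> nat (3 * m + 1)" using s by (simp add: algebra_simps)
    moreover have m1: "m \<ge> 1" using less.prems(3)[OF s(1)] s(2) by simp
    ultimately have c1: "real (card (S - S')) \<le> 4 * real_of_int m" by linarith
    have "card S = card (S - S') + card S'"
      using S' less.prems(1) by (metis card_Diff_subset card_mono finite_subset le_add_diff_inverse2)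
    moreover have "(\<Sum>i\<in>insert s R. real_of_int (b i - a i)) = m + (\<Sum>i\<in>R. real_of_int (b i - a i))"
      using R(1) S' s finite_subset[OF _ \<open>finite S'\<close>] by (subst sum.insert) auto
    ultimately have "real (card S) \<le> 4 * (\<Sum>i\<in>insert s R. real_of_int (b i - a i))"
      using R(3) c1 by simp
    moreover have "\<forall>i\<in>insert s R. \<forall>k\<in>insert s R. i \<noteq> k \<longrightarrow> b i < a k \<or> b k < a i"
      using R(1,2) by (auto simp: S'_def)
    moreover have "insert s R \<subseteq> S" using R(1) S' s by auto
    ultimately show ?thesis by blast
  qed
qed

section \<open>Good times for a subadditive cocycle\<close>

text \<open>At scale \<open>l\<close> all windows that start in \<open>[-l, l]\<close> and last at
  most \<open>l\<close> are tested with the same tolerance \<open>\<eta> l\<close>. In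
  \<open>goodD\<close> this becomes a bound for every window, with the threshold \<open>L\<close> as
  an additive constant.\<close>

definition good :: "(int \<Rightarrow> int \<Rightarrow> 'x \<Rightarrow> real) \<Rightarrow> real \<Rightarrow> nat \<Rightarrow> 'x \<Rightarrow> bool" where
  "good dev \<eta> L x \<longleftrightarrow> (\<forall>l\<ge>L. \<forall>a\<in>{- int l..int l}. \<forall>m\<le>l. \<bar>dev a (a + int m) x\<bar> < \<eta> * real l)"

lemma good_mono: "good dev \<eta> L x \<Longrightarrow> L \<le> L' \<Longrightarrow> good dev \<eta> L' x"
  unfolding good_def by (meson order_trans)

lemma goodD:
  fixes p q :: int
  assumes "good dev \<eta> L x" "p \<le> q"
  shows "\<bar>dev p q x\<bar> \<le> \<eta> * (real L + \<bar>p\<bar> + \<bar>q\<bar>)"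
proof -
  \<comment> \<open>This scale bounds both the distance of \<open>p\<close> from 0 and the duration
    \<open>q - p\<close>.\<close>
  define l where "l = L + nat \<bar>p\<bar> + nat \<bar>q\<bar>"
  have "\<bar>dev p (p + int (nat (q - p))) x\<bar> < \<eta> * real l"
    using assms(1) unfolding good_def by (elim allE[of _ l] impE ballE[of _ _ p] allE[of _ "nat (q - p)"])
      (use assms(2) in \<open>auto simp: l_def\<close>)
  then show ?thesis using assms(2) by (simp add: l_def)
qed

text \<open>\<open>dev a b\<close> models the deviation, over the times from \<open>a\<close> to
  \<open>b\<close>, of a log norm from its expected growth. Of the two probabilistic inputs,
  \<open>large_dev\<close> concerns a single window, while \<open>average_dev\<close> concerns the
  upward deviations of all windows of one fixed length simultaneously.\<close>

locale subadditive_cocycle = prob_space \<mu>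
  for \<mu> :: "'x measure" +
  fixes T :: "int \<Rightarrow> 'x \<Rightarrow> 'x" and dev :: "int \<Rightarrow> int \<Rightarrow> 'x \<Rightarrow> real" and B :: real
  assumes T_meas [measurable]: "\<And>k. T k \<in> measurable \<mu> \<mu>"
    and T_pres: "\<And>k A. A \<in> sets \<mu> \<Longrightarrow> measure \<mu> (T k -` A \<inter> space \<mu>) = measure \<mu> A"
    and dev_meas [measurable]: "\<And>a b. dev a b \<in> borel_measurable \<mu>"
    and dev_shift: "\<And>a b k x. x \<in> space \<mu> \<Longrightarrow> a \<le> b \<Longrightarrow> dev a b (T k x) = dev (a + k) (b + k) x"
    and dev_sub: "\<And>a b c x. x \<in> space \<mu> \<Longrightarrow> a \<le> b \<Longrightarrow> b \<le> c \<Longrightarrow> dev a c x \<le> dev a b x + dev b c x"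
    and dev_upper: "\<And>a b x. x \<in> space \<mu> \<Longrightarrow> a \<le> b \<Longrightarrow> dev a b x \<le> B * (b - a)"
    and B: "B > 0"
    and large_dev: "\<And>\<eta>. \<eta> > 0 \<Longrightarrow>
          exp_small (\<lambda>n. \<P>(x in \<mu>. \<bar>dev 0 (int n) x\<bar> \<ge> \<eta> * real n))"
    and average_dev: "\<And>\<kappa>. \<kappa> > 0 \<Longrightarrow> \<exists>N\<ge>1. exp_small (\<lambda>n. measure \<mu> {x\<in>space \<mu>.
          (\<Sum>j<n. max 0 (dev (int j) (int j + int N) x)) \<ge> \<kappa> * real N * real n})"
begin

lemma measure_shift:
  assumes [measurable]: "Measurable.pred \<mu> P"
  shows "\<P>(x in \<mu>. P (T k x)) = \<P>(x in \<mu>. P x)"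
proof -
  have "T k -` {x\<in>space \<mu>. P x} \<inter> space \<mu> = {x\<in>space \<mu>. P (T k x)}"
    using measurable_space[OF T_meas] by auto
  then show ?thesis using T_pres[of "{x\<in>space \<mu>. P x}" k] by simp
qed

text \<open>Cutting \<open>[a, b)\<close> into blocks of length \<open>N\<close> in each of the
  \<open>N\<close> possible phases uses every starting point once; this explains the factor
  \<open>N\<close> on the left. The incomplete pieces at the two ends cost \<open>B N\<close> each
  per phase.\<close>

lemma sub_average:
  fixes a b :: int and N :: nat
  assumes x: "x \<in> space \<mu>" and N: "N \<ge> 1" and "a \<le> b"
  shows "real N * dev a b x \<le> (\<Sum>j\<in>{a..<b}. max 0 (dev j (j + int N) x)) + 2 * B * (real N)\<^sup>2"
proof -
  define f where "f j = max 0 (dev j (j + int N) x)" for j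
  \<comment> \<open>By subadditivity \<open>H (b + 1) - H b = dev a (b + N) - dev a b \<le> dev b (b + N)\<close>, which telescopes.\<close>
  define H where "H b = (\<Sum>s<N. dev a (b + int s) x)" for b
  have H: "H b \<le> (\<Sum>j\<in>{a..<b}. f j) + B * (real N)\<^sup>2" if "a \<le> b" for b
    using that
  proof (induction b rule: int_ge_induct)
    case base
    have "H a \<le> (\<Sum>s<N. B * real N)"
      unfolding H_def
    proof (intro sum_mono)
      fix s assume "s \<in> {..<N}"
      then have "dev a (a + int s) x \<le> B * real s" "B * real s \<le> B * real N"
        using dev_upper[OF x, of a "a + int s"] B by auto
      then show "dev a (a + int s) x \<le> B * real N" by simp
    qed
    then show ?case by (simp add: power2_eq_square mult_ac)
  next
    case (step b)
    have "H (b + 1) = (\<Sum>s<N. dev a (b + int (Suc s)) x)"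
      by (simp add: H_def algebra_simps)
    moreover have "dev a b x + (\<Sum>s<N. dev a (b + int (Suc s)) x) = (\<Sum>s<Suc N. dev a (b + int s) x)"
      by (subst sum.lessThan_Suc_shift) simp
    ultimately have "H (b + 1) = H b + dev a (b + int N) x - dev a b x"
      by (simp add: H_def)
    also have "\<dots> \<le> H b + f b"
      using dev_sub[OF x, of a b "b + int N"] step.hyps by (simp add: f_def)
    also have "{a..<b + 1} = insert b {a..<b}" using step.hyps by auto
    then have "(\<Sum>j\<in>{a..<b + 1}. f j) = f b + (\<Sum>j\<in>{a..<b}. f j)" by simp
    with step.IH have "H b + f b \<le> (\<Sum>j\<in>{a..<b + 1}. f j) + B * (real N)\<^sup>2" by simp
    finally show ?case .
  qed
  have nn: "0 \<le> (\<Sum>j\<in>{a..<b}. f j)" by (auto simp: f_def intro!: sum_nonneg)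
  have "real N * dev a b x \<le> (\<Sum>j\<in>{a..<b}. f j) + 2 * B * (real N)\<^sup>2"
  proof (cases "a + int N \<le> b")
    case False
    have "dev a b x \<le> B * (b - a)" using dev_upper[OF x \<open>a \<le> b\<close>] .
    also have "\<dots> \<le> B * real N" using False B by (intro mult_left_mono) auto
    finally have "real N * dev a b x \<le> real N * (B * real N)" by (intro mult_left_mono) auto
    also have "\<dots> \<le> 2 * B * (real N)\<^sup>2" using B by (simp add: power2_eq_square)
    finally show ?thesis using nn by simp
  next
    case True
    \<comment> \<open>\<open>H b'\<close> averages over the end points \<open>b' + s\<close> with
      \<open>s < N\<close>; each misses \<open>b\<close> by at most \<open>N\<close>, at a cost of
      \<open>B N\<close>.\<close>
    define b' where "b' = b - int N"
    have "real N * dev a b x = (\<Sum>s<N. dev a b x)" by simp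
    also have "\<dots> \<le> (\<Sum>s<N. dev a (b' + int s) x + B * real N)"
    proof (intro sum_mono)
      fix s assume s: "s \<in> {..<N}"
      have "dev a b x \<le> dev a (b' + int s) x + dev (b' + int s) b x"
        using s True by (intro dev_sub x) (auto simp: b'_def)
      also have "dev (b' + int s) b x \<le> B * (b - (b' + int s))"
        using dev_upper[OF x, of "b' + int s" b] s by (auto simp: b'_def)
      also have "\<dots> \<le> B * real N" using B s by (intro mult_left_mono) (auto simp: b'_def)
      finally show "dev a b x \<le> dev a (b' + int s) x + B * real N" by simp
    qed
    also have "\<dots> = H b' + B * (real N)\<^sup>2" by (simp add: H_def sum.distrib power2_eq_square mult_ac)
    also have "\<dots> \<le> (\<Sum>j\<in>{a..<b'}. f j) + 2 * B * (real N)\<^sup>2"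
      using H[of b'] True by (simp add: b'_def)
    also have "(\<Sum>j\<in>{a..<b'}. f j) \<le> (\<Sum>j\<in>{a..<b}. f j)"
      by (rule sum_mono2) (auto simp: b'_def f_def)
    finally show ?thesis by simp
  qed
  then show ?thesis by (simp add: f_def)
qed

text \<open>The windows in \<open>D\<close> keep their true deviation, and only the gaps between
  them are estimated by averages. So negative deviations on disjoint windows add up to a negative
  deviation of \<open>[p, q]\<close>. The induction removes the rightmost window; nonnegativity of
  \<open>f\<close> allows the sums over the gaps to be enlarged to \<open>[p, q)\<close>.\<close>

lemma sub_gaps:
  fixes p q :: int and c :: real and f :: "int \<Rightarrow> real" and u w :: "'i \<Rightarrow> int"
  assumes x: "x \<in> space \<mu>" and f: "\<And>j. f j \<ge> 0"
    and avg: "\<And>a b. a \<le> b \<Longrightarrow> dev a b x \<le> (\<Sum>j\<in>{a..<b}. f j) + c"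
    and D: "finite D" "\<And>i. i \<in> D \<Longrightarrow> p \<le> u i \<and> u i \<le> w i \<and> w i \<le> q"
      "\<And>i k. i \<in> D \<Longrightarrow> k \<in> D \<Longrightarrow> i \<noteq> k \<Longrightarrow> w i < u k \<or> w k < u i"
    and "p \<le> q"
  shows "dev p q x \<le> (\<Sum>j\<in>{p..<q}. f j) + c + (\<Sum>i\<in>D. dev (u i) (w i) x + c)"
  using D \<open>p \<le> q\<close>
proof (induction "card D" arbitrary: D q)
  case 0
  then show ?case using avg[of p q] by simp
next
  case (Suc n)
  define m where "m = Max (u ` D)"
  have ne: "D \<noteq> {}" using Suc.hyps(2) by auto
  have "m \<in> u ` D" unfolding m_def using ne Suc.prems by (intro Max_in) auto
  then obtain s where s: "s \<in> D" "u s = m" by auto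
  have smax: "u i \<le> u s" if "i \<in> D" for i
    unfolding s m_def using that Suc.prems by (intro Max_ge) auto
  have left: "w i \<le> u s" if "i \<in> D - {s}" for i
  proof -
    have "w i < u s \<or> w s < u i" using Suc.prems(3)[of i s] that s by auto
    moreover have "u s \<le> w s" using Suc.prems(2)[OF s(1)] by simp
    ultimately show ?thesis using smax[of i] that by auto
  qed
  have us: "p \<le> u s" "u s \<le> w s" "w s \<le> q" using Suc.prems(2)[OF s(1)] by auto
  have card': "n = card (D - {s})" using Suc.hyps(2) Suc.prems(1) s by simp
  have IH: "dev p (u s) x \<le> (\<Sum>j\<in>{p..<u s}. f j) + c + (\<Sum>i\<in>D - {s}. dev (u i) (w i) x + c)"
  proof (rule Suc.hyps(1)[OF card'])
    fix i assume "i \<in> D - {s}"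
    then show "p \<le> u i \<and> u i \<le> w i \<and> w i \<le> u s" using left[of i] Suc.prems(2)[of i] by auto
  qed (use Suc.prems us in auto)
  have "dev p q x \<le> dev p (u s) x + dev (u s) q x" using us by (intro dev_sub x) auto
  also have "dev (u s) q x \<le> dev (u s) (w s) x + dev (w s) q x" using us by (intro dev_sub x) auto
  also have "dev (w s) q x \<le> (\<Sum>j\<in>{w s..<q}. f j) + c" using us by (intro avg) auto
  finally have "dev p q x \<le> ((\<Sum>j\<in>{p..<u s}. f j) + (\<Sum>j\<in>{w s..<q}. f j)) + c +
      ((\<Sum>i\<in>D - {s}. dev (u i) (w i) x + c) + (dev (u s) (w s) x + c))"
    using IH by simp
  also have "(\<Sum>i\<in>D - {s}. dev (u i) (w i) x + c) + (dev (u s) (w s) x + c) = (\<Sum>i\<in>D. dev (u i) (w i) x + c)"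
    using Suc.prems(1) s by (simp add: sum.remove[of D s])
  also have "(\<Sum>j\<in>{p..<u s}. f j) + (\<Sum>j\<in>{w s..<q}. f j) = (\<Sum>j\<in>{p..<u s} \<union> {w s..<q}. f j)"
    using us by (intro sum.union_disjoint[symmetric]) auto
  also have "\<dots> \<le> (\<Sum>j\<in>{p..<q}. f j)"
    by (rule sum_mono2) (use us f in auto)
  finally show ?case by simp
qed

lemma good_meas [measurable]: "Measurable.pred \<mu> (good dev \<eta> L)"
  unfolding good_def by measurable

text \<open>\<open>large_dev\<close> decays in the length \<open>m\<close> of the window, which is
  useless for short windows; goodness at scale \<open>l\<close> needs decay in
  \<open>l\<close>.\<close>

lemma large_dev_window:
  assumes "\<eta> > 0"
  shows "\<exists>K>0. \<exists>c>0. \<forall>l m. m \<le> l \<longrightarrow>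
     \<P>(x in \<mu>. \<bar>dev 0 (int m) x\<bar> \<ge> \<eta> * real l) \<le> K * exp (- c * real l)"
proof -
  have "exp_small (\<lambda>n. \<P>(x in \<mu>. \<bar>dev 0 (int n) x\<bar> \<ge> \<eta> / 2 * real n))"
    using assms by (intro large_dev) simp
  then obtain K c where 1: "K > 0" "c > 0" and ld:
    "\<And>n. \<P>(x in \<mu>. \<bar>dev 0 (int n) x\<bar> \<ge> \<eta> / 2 * real n) \<le> K * exp (- c * real n)"
    by (rule exp_smallE) blast
  \<comment> \<open>Windows shorter than \<open>\<theta> l\<close> cannot deviate upwards by \<open>\<eta> l\<close>; if one deviates downwards, then so does
    \<open>[0, l]\<close>, or else \<open>[m, l]\<close> deviates upwards.\<close>
  define \<theta> where "\<theta> = min (1 / 2) (\<eta> / (2 * B))"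
  have \<theta>: "0 < \<theta>" "\<theta> \<le> 1 / 2" "B * \<theta> < \<eta>"
    using assms B by (auto simp: \<theta>_def min_def field_simps)
  have ld': "\<P>(x in \<mu>. \<bar>dev 0 (int n) x\<bar> \<ge> t) \<le> K * exp (- (c * \<theta>) * real l)"
    if "real n \<ge> \<theta> * real l" "t \<ge> \<eta> / 2 * real n" for n l t
  proof -
    have "\<P>(x in \<mu>. \<bar>dev 0 (int n) x\<bar> \<ge> t) \<le>
       \<P>(x in \<mu>. \<bar>dev 0 (int n) x\<bar> \<ge> \<eta> / 2 * real n)"
      using that by (intro finite_measure_mono) auto
    also have "\<dots> \<le> K * exp (- c * real n)" by (rule ld)
    also have "\<dots> \<le> K * exp (- (c * \<theta>) * real l)"
      using 1 that(1) by (intro mult_left_mono) (auto simp: mult.assoc)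
    finally show ?thesis .
  qed
  have "\<P>(x in \<mu>. \<bar>dev 0 (int m) x\<bar> \<ge> \<eta> * real l) \<le> 2 * K * exp (- (c * \<theta>) * real l)"
    if ml: "m \<le> l" for l m :: nat
  proof (cases "real m \<ge> \<theta> * real l")
    case True
    have "\<eta> / 2 * real m \<le> \<eta> * real l" using assms ml by (intro mult_mono) auto
    then have "\<P>(x in \<mu>. \<bar>dev 0 (int m) x\<bar> \<ge> \<eta> * real l) \<le> K * exp (- (c * \<theta>) * real l)"
      using True by (intro ld') auto
    moreover have "0 \<le> K * exp (- (c * \<theta>) * real l)" using 1 by simp
    ultimately show ?thesis by simp
  next
    case False
    have l: "l > 0" using False ml by (cases "l = 0") auto
    define A1 where "A1 = {x\<in>space \<mu>. \<bar>dev 0 (int l) x\<bar> \<ge> \<eta> / 2 * real l}"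
    define A2 where "A2 = {x\<in>space \<mu>. \<bar>dev 0 (int (l - m)) (T (int m) x)\<bar> \<ge> \<eta> / 2 * real l}"
    have [measurable]: "A1 \<in> sets \<mu>" "A2 \<in> sets \<mu>" by (simp_all add: A1_def A2_def)
    have "{x\<in>space \<mu>. \<bar>dev 0 (int m) x\<bar> \<ge> \<eta> * real l} \<subseteq> A1 \<union> A2"
    proof safe
      fix x assume x: "x \<in> space \<mu>" "\<bar>dev 0 (int m) x\<bar> \<ge> \<eta> * real l" "x \<notin> A2"
      have "dev 0 (int m) x \<le> B * real m" using dev_upper[OF x(1), of 0 "int m"] by simp
      also have "\<dots> \<le> B * (\<theta> * real l)" using False B by (intro mult_left_mono) auto
      also have "\<dots> < \<eta> * real l" using \<theta>(3) l by (simp add: mult.assoc[symmetric])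
      finally have lo: "dev 0 (int m) x \<le> - (\<eta> * real l)" using x(2) by simp
      have "dev 0 (int (l - m)) (T (int m) x) = dev (int m) (int l) x"
        using dev_shift[OF x(1), of 0 "int (l - m)" "int m"] ml by (simp add: of_nat_diff)
      then have "dev (int m) (int l) x < \<eta> / 2 * real l" using x by (auto simp: A2_def)
      then have "dev 0 (int l) x \<le> - (\<eta> / 2 * real l)"
        using dev_sub[OF x(1), of 0 "int m" "int l"] lo ml by simp
      then show "x \<in> A1" using x(1) by (auto simp: A1_def)
    qed
    then have "\<P>(x in \<mu>. \<bar>dev 0 (int m) x\<bar> \<ge> \<eta> * real l) \<le> measure \<mu> (A1 \<union> A2)"
      by (intro finite_measure_mono) auto
    also have "\<dots> \<le> measure \<mu> A1 + measure \<mu> A2" by (intro measure_Un_le) auto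
    also have "measure \<mu> A1 \<le> K * exp (- (c * \<theta>) * real l)"
      unfolding A1_def using \<theta> mult_right_mono[of \<theta> 1 "real l"] by (intro ld') auto
    also have "measure \<mu> A2 \<le> K * exp (- (c * \<theta>) * real l)"
    proof -
      have "measure \<mu> A2 = \<P>(x in \<mu>. \<bar>dev 0 (int (l - m)) x\<bar> \<ge> \<eta> / 2 * real l)"
        unfolding A2_def by (rule measure_shift) measurable
      also have "\<dots> \<le> K * exp (- (c * \<theta>) * real l)"
      proof (rule ld')
        have "\<theta> * real l \<le> 1 / 2 * real l" using \<theta> by (intro mult_right_mono) auto
        then show "\<theta> * real l \<le> real (l - m)" using False ml by (simp add: of_nat_diff)
        show "\<eta> / 2 * real (l - m) \<le> \<eta> / 2 * real l" using assms by (intro mult_left_mono) auto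
      qed
      finally show ?thesis .
    qed
    finally show ?thesis by simp
  qed
  moreover have "2 * K > 0" "c * \<theta> > 0" using 1 \<theta> by auto
  ultimately show ?thesis by blast
qed

text \<open>By invariance, the \<open>(2 l + 1) (l + 1)\<close> windows tested at scale
  \<open>l\<close> reduce to windows starting at 0. Their number is polynomial, and the sum over
  \<open>l \<ge> L\<close> is a geometric tail.\<close>

lemma measure_not_good:
  assumes "\<eta> > 0"
  shows "exp_small (\<lambda>L. \<P>(x in \<mu>. \<not> good dev \<eta> L x))"
proof -
  obtain K c where K: "K > 0" "c > 0" and ld: "\<And>l m. m \<le> l \<Longrightarrow>
     \<P>(x in \<mu>. \<bar>dev 0 (int m) x\<bar> \<ge> \<eta> * real l) \<le> K * exp (- c * real l)"
    using large_dev_window[OF assms] by blast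
  define W where "W l = (\<Union>a\<in>{- int l..int l}. \<Union>m\<in>{..l}. {x\<in>space \<mu>. \<bar>dev a (a + int m) x\<bar> \<ge> \<eta> * real l})" for l
  have [measurable]: "W l \<in> sets \<mu>" for l unfolding W_def by measurable
  have W: "measure \<mu> (W l) \<le> (real l + 1) * ((real l + 1) * (2 * K * exp (- c * real l)))" for l
  proof -
    have "measure \<mu> (W l) \<le> (\<Sum>a\<in>{- int l..int l}. measure \<mu> (\<Union>m\<in>{..l}. {x\<in>space \<mu>. \<bar>dev a (a + int m) x\<bar> \<ge> \<eta> * real l}))"
      unfolding W_def by (intro finite_measure_subadditive_finite) auto
    also have "\<dots> \<le> (\<Sum>a\<in>{- int l..int l}. \<Sum>m\<in>{..l}. \<P>(x in \<mu>. \<bar>dev a (a + int m) x\<bar> \<ge> \<eta> * real l))"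
      by (intro sum_mono finite_measure_subadditive_finite) auto
    also have "\<dots> \<le> (\<Sum>a\<in>{- int l..int l}. \<Sum>m\<in>{..l}. K * exp (- c * real l))"
    proof (intro sum_mono)
      fix a m assume am: "a \<in> {- int l..int l}" "m \<in> {..l}"
      have "{x\<in>space \<mu>. \<bar>dev a (a + int m) x\<bar> \<ge> \<eta> * real l} = {x\<in>space \<mu>. \<bar>dev 0 (int m) (T a x)\<bar> \<ge> \<eta> * real l}"
        by (intro Collect_cong) (auto simp: dev_shift add.commute)
      then have "\<P>(x in \<mu>. \<bar>dev a (a + int m) x\<bar> \<ge> \<eta> * real l) = \<P>(x in \<mu>. \<bar>dev 0 (int m) x\<bar> \<ge> \<eta> * real l)"
        using measure_shift[of "\<lambda>x. \<bar>dev 0 (int m) x\<bar> \<ge> \<eta> * real l" a] by simp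
      also have "\<dots> \<le> K * exp (- c * real l)" using am by (intro ld) auto
      finally show "\<P>(x in \<mu>. \<bar>dev a (a + int m) x\<bar> \<ge> \<eta> * real l) \<le> K * exp (- c * real l)" .
    qed
    also have "\<dots> = (2 * real l + 1) * ((real l + 1) * (K * exp (- c * real l)))" by simp
    also have "\<dots> \<le> (2 * (real l + 1)) * ((real l + 1) * (K * exp (- c * real l)))"
      using K by (intro mult_right_mono) auto
    also have "\<dots> = (real l + 1) * ((real l + 1) * (2 * K * exp (- c * real l)))" by algebra
    finally show ?thesis .
  qed
  have "exp_small (\<lambda>l. 2 * K * exp (- c * real l))" using K by (intro exp_smallI[of c _ "2 * K"]) auto
  then have "exp_small (\<lambda>l. (real l + 1) * (2 * K * exp (- c * real l)))" by (rule exp_small_poly) auto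
  then have "exp_small (\<lambda>l. measure \<mu> (W l))" by (rule exp_small_poly) (use W in auto)
  then obtain K' c' where K': "K' > 0" "c' > 0" "\<And>l. measure \<mu> (W l) \<le> K' * exp (- c' * real l)"
    by (rule exp_smallE) blast
  have r: "0 \<le> exp (- c')" "exp (- c') < 1" using K' by auto
  have geo: "(\<lambda>i. K' * exp (- c' * real (L + i))) sums (K' * exp (- c' * real L) * (1 / (1 - exp (- c'))))" for L
  proof -
    have "K' * exp (- c' * real (L + i)) = K' * exp (- c' * real L) * exp (- c') ^ i" for i
      by (simp add: exp_of_nat_mult[symmetric] mult_exp_exp algebra_simps)
    then show ?thesis
      using sums_mult[OF geometric_sums[of "exp (- c')"], of "K' * exp (- c' * real L)"] r by (simp only:) simp
  qed
  show ?thesis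
  proof (rule exp_smallI[OF K'(2)])
    fix L
    have sm: "summable (\<lambda>i. measure \<mu> (W (L + i)))"
    proof (rule summable_comparison_test'[OF sums_summable[OF geo[of L]], of 0])
      fix i show "norm (measure \<mu> (W (L + i))) \<le> K' * exp (- c' * real (L + i))"
        using K'(3)[of "L + i"] by simp
    qed
    have "{x\<in>space \<mu>. \<not> good dev \<eta> L x} \<subseteq> (\<Union>i. W (L + i))"
    proof
      fix x assume "x \<in> {x\<in>space \<mu>. \<not> good dev \<eta> L x}"
      then obtain l a m where "x \<in> space \<mu>" "l \<ge> L" "a \<in> {- int l..int l}" "m \<le> l" "\<eta> * real l \<le> \<bar>dev a (a + int m) x\<bar>"
        by (auto simp: good_def not_less)
      then have "x \<in> W (L + (l - L))" by (auto simp: W_def)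
      then show "x \<in> (\<Union>i. W (L + i))" by blast
    qed
    then have "\<P>(x in \<mu>. \<not> good dev \<eta> L x) \<le> measure \<mu> (\<Union>i. W (L + i))"
      by (intro finite_measure_mono) auto
    also have "\<dots> \<le> (\<Sum>i. measure \<mu> (W (L + i)))"
      by (intro finite_measure_subadditive_countably sm) auto
    also have "\<dots> \<le> (\<Sum>i. K' * exp (- c' * real (L + i)))"
      by (intro suminf_le sm K' sums_summable[OF geo])
    also have "\<dots> = K' * exp (- c' * real L) * (1 / (1 - exp (- c')))" by (rule sums_unique[OF geo, symmetric])
    finally show "\<P>(x in \<mu>. \<not> good dev \<eta> L x) \<le> (K' * (1 / (1 - exp (- c')))) * exp (- c' * real L)"
      by (simp add: mult_ac)
  qed
qed

text \<open>The threshold \<open>L\<close> may depend on \<open>\<delta>\<close>, but not on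
  \<open>n\<close>. Upward windows are charged to the sum \<open>F\<close> of positive parts of
  windows of length \<open>N\<close>, downward ones to the deviation of the single window
  \<open>[-n, 2n]\<close>.\<close>

lemma count_not_good:
  assumes \<eta>: "\<eta> > 0" and \<delta>: "\<delta> > 0"
  shows "\<exists>L Z. (\<forall>n. Z n \<in> sets \<mu>) \<and> exp_small (\<lambda>n. measure \<mu> (Z n)) \<and>
     (\<forall>x\<in>space \<mu>. \<forall>n. real (card {j\<in>{..<n}. \<not> good dev \<eta> L (T (int j) x)}) \<ge> \<delta> * real n \<longrightarrow> x \<in> Z n)"
proof -
  \<comment> \<open>Upward windows account for at most \<open>F < 3 \<kappa> n\<close>, downward
    ones for less than \<open>F + c + 3 \<kappa> n\<close>, together less than
    \<open>9 \<kappa> n + c\<close>. The windows found require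
    \<open>\<eta> \<delta> n / 24\<close>; this \<open>\<kappa>\<close> makes
    \<open>9 \<kappa> n\<close> one half of it.\<close>
  define \<kappa> where "\<kappa> = \<eta> * \<delta> / 432"
  have \<kappa>: "\<kappa> > 0" using \<eta> \<delta> by (simp add: \<kappa>_def)
  obtain N where N: "N \<ge> 1" and avg: "exp_small (\<lambda>n. measure \<mu> {x\<in>space \<mu>.
          (\<Sum>j<n. max 0 (dev (int j) (int j + int N) x)) \<ge> \<kappa> * real N * real n})"
    using average_dev[OF \<kappa>] by blast
  define c where "c = 2 * B * real N"
  have c: "c > 0" using B N by (simp add: c_def)
  \<comment> \<open>Every window has scale at least \<open>L\<close>, so the boundary cost
    \<open>c\<close> uses up at most half of its deviation \<open>\<eta> l\<close>.\<close>
  define L where "L = nat \<lceil>2 * c / \<eta>\<rceil> + 1"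
  have L: "real L \<ge> 2 * c / \<eta>" "L \<ge> 1" by (simp_all add: L_def) linarith
  \<comment> \<open>For \<open>n \<ge> n0\<close> the single remaining \<open>c\<close> is smaller
    than the other half, \<open>\<eta> \<delta> n / 48\<close>. Smaller \<open>n\<close> are given
    up by letting \<open>Z n\<close> be the whole space.\<close>
  define n0 where "n0 = nat \<lceil>48 * c / (\<eta> * \<delta>)\<rceil> + 1"
  have n0: "real n0 > 48 * c / (\<eta> * \<delta>)" unfolding n0_def by linarith
  \<comment> \<open>Excludes windows of scale at least \<open>n / 2\<close>, so that all windows
    belonging to times \<open>j < n\<close> stay inside \<open>[-n, 2n]\<close>.\<close>
  define E1 where "E1 n = (\<Union>j\<in>{..<n}. {x\<in>space \<mu>. \<not> good dev \<eta> (nat \<lceil>real n / 2\<rceil>) (T (int j) x)})" for n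
  \<comment> \<open>The shift by \<open>- n\<close> turns \<open>[0, 3n]\<close> into
    \<open>[-n, 2n]\<close>, here and in \<open>E3\<close>.\<close>
  define E2 where "E2 n = {x\<in>space \<mu>. (\<Sum>j<3 * n. max 0 (dev (int j) (int j + int N) (T (- int n) x))) \<ge> \<kappa> * real N * real (3 * n)}" for n
  define E3 where "E3 n = {x\<in>space \<mu>. \<bar>dev 0 (int (3 * n)) (T (- int n) x)\<bar> \<ge> \<kappa> * real (3 * n)}" for n
  define Z where "Z n = (if n < n0 then space \<mu> else E1 n \<union> E2 n \<union> E3 n)" for n
  have [measurable]: "E1 n \<in> sets \<mu>" "E2 n \<in> sets \<mu>" "E3 n \<in> sets \<mu>" for n
    unfolding E1_def E2_def E3_def by measurable
  have "Z n \<in> sets \<mu>" for n by (auto simp: Z_def)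
  moreover have "exp_small (\<lambda>n. measure \<mu> (Z n))"
  proof -
    have "exp_small (\<lambda>n. \<P>(x in \<mu>. \<not> good dev \<eta> (nat \<lceil>real n / 2\<rceil>) x))"
    proof (rule exp_small_rescale[OF measure_not_good[OF \<eta>], of "1 / 2"])
      fix n show "\<exists>m. 1 / 2 * real n \<le> real m \<and> \<P>(x in \<mu>. \<not> good dev \<eta> (nat \<lceil>real n / 2\<rceil>) x) \<le> \<P>(x in \<mu>. \<not> good dev \<eta> m x)"
        by (intro exI[of _ "nat \<lceil>real n / 2\<rceil>"] conjI order_refl) linarith
    qed simp
    then have 1: "exp_small (\<lambda>n. measure \<mu> (E1 n))"
    proof (rule exp_small_poly)
      fix n
      have "measure \<mu> (E1 n) \<le> (\<Sum>j<n. \<P>(x in \<mu>. \<not> good dev \<eta> (nat \<lceil>real n / 2\<rceil>) (T (int j) x)))"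
        unfolding E1_def by (intro finite_measure_subadditive_finite) auto
      also have "\<dots> = (\<Sum>j<n. \<P>(x in \<mu>. \<not> good dev \<eta> (nat \<lceil>real n / 2\<rceil>) x))"
        by (intro sum.cong refl measure_shift) measurable
      also have "\<dots> \<le> (real n + 1) * \<P>(x in \<mu>. \<not> good dev \<eta> (nat \<lceil>real n / 2\<rceil>) x)"
        by (simp add: distrib_right)
      finally show "measure \<mu> (E1 n) \<le> \<dots>" .
    qed
    have 2: "exp_small (\<lambda>n. measure \<mu> (E2 n))"
    proof (rule exp_small_rescale[OF avg, of 1])
      fix n show "\<exists>m. 1 * real n \<le> real m \<and> measure \<mu> (E2 n) \<le> measure \<mu> {x\<in>space \<mu>.
          (\<Sum>j<m. max 0 (dev (int j) (int j + int N) x)) \<ge> \<kappa> * real N * real m}"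
        unfolding E2_def by (intro exI[of _ "3 * n"] conjI) (simp, rule order_eq_refl, rule measure_shift, measurable)
    qed simp
    have 3: "exp_small (\<lambda>n. measure \<mu> (E3 n))"
    proof (rule exp_small_rescale[OF large_dev[OF \<kappa>], of 1])
      fix n show "\<exists>m. 1 * real n \<le> real m \<and> measure \<mu> (E3 n) \<le> \<P>(x in \<mu>. \<bar>dev 0 (int m) x\<bar> \<ge> \<kappa> * real m)"
        unfolding E3_def by (intro exI[of _ "3 * n"] conjI) (simp, rule order_eq_refl, rule measure_shift, measurable)
    qed simp
    show ?thesis
    proof (rule exp_small_eventually[OF exp_small_add[OF exp_small_add[OF 1 2] 3]])
      fix n assume "n \<ge> n0"
      then have "measure \<mu> (Z n) = measure \<mu> (E1 n \<union> E2 n \<union> E3 n)" by (simp add: Z_def)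
      also have "\<dots> \<le> measure \<mu> (E1 n \<union> E2 n) + measure \<mu> (E3 n)"
        by (intro measure_Un_le) auto
      also have "measure \<mu> (E1 n \<union> E2 n) \<le> measure \<mu> (E1 n) + measure \<mu> (E2 n)"
        by (intro measure_Un_le) auto
      finally show "measure \<mu> (Z n) \<le> measure \<mu> (E1 n) + measure \<mu> (E2 n) + measure \<mu> (E3 n)" by simp
    qed (rule prob_le_1)
  qed
  moreover have "x \<in> Z n"
    if x: "x \<in> space \<mu>" and many: "real (card {j\<in>{..<n}. \<not> good dev \<eta> L (T (int j) x)}) \<ge> \<delta> * real n" for x n
  proof (rule ccontr)
    assume "x \<notin> Z n"
    then have nn: "n \<ge> n0" and E1: "x \<notin> E1 n" and E2: "x \<notin> E2 n" and E3: "x \<notin> E3 n"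
      using x by (auto simp: Z_def split: if_splits)
    define S where "S = {j\<in>{..<n}. \<not> good dev \<eta> L (T (int j) x)}"
    have "\<exists>l u w. L \<le> l \<and> 2 * l \<le> n \<and> int j - int l \<le> u \<and> u \<le> w \<and> w \<le> int j + 2 * int l \<and>
        \<eta> * real l \<le> \<bar>dev u w x\<bar>" if jS: "j \<in> S" for j
    proof -
      obtain l a m where l: "L \<le> l" "a \<in> {- int l..int l}" "m \<le> l"
        "\<eta> * real l \<le> \<bar>dev a (a + int m) (T (int j) x)\<bar>"
        using jS by (auto simp: S_def good_def not_less)
      have "good dev \<eta> (nat \<lceil>real n / 2\<rceil>) (T (int j) x)"
        using E1 that x by (auto simp: E1_def S_def)
      then have "\<not> nat \<lceil>real n / 2\<rceil> \<le> l"
        using l unfolding good_def by (meson not_less)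
      then have "2 * l \<le> n" by linarith
      moreover have "dev a (a + int m) (T (int j) x) = dev (a + int j) (a + int m + int j) x"
        using dev_shift[OF x, of a "a + int m" "int j"] by simp
      ultimately show ?thesis
        using l by (intro exI[of _ l] exI[of _ "a + int j"] exI[of _ "a + int m + int j"]) auto
    qed
    then obtain l u w where luw: "\<And>j. j \<in> S \<Longrightarrow> L \<le> l j \<and> 2 * l j \<le> n \<and> int j - int (l j) \<le> u j \<and> u j \<le> w j \<and>
        w j \<le> int j + 2 * int (l j) \<and> \<eta> * real (l j) \<le> \<bar>dev (u j) (w j) x\<bar>"
      by metis
    have "finite S" "inj_on int S" by (auto simp: S_def)
    \<comment> \<open>The selection is applied to the intervals \<open>[j - l, j + 2 l]\<close> that
      contain the windows. Their length \<open>3 l\<close> and the covering factor 4 give the 12 in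
      \<open>total\<close>.\<close>
    have "\<exists>R\<subseteq>S. (\<forall>i\<in>R. \<forall>k\<in>R. i \<noteq> k \<longrightarrow> int i + 2 * int (l i) < int k - int (l k) \<or> int k + 2 * int (l k) < int i - int (l i)) \<and>
           real (card S) \<le> 4 * (\<Sum>i\<in>R. real_of_int (int i + 2 * int (l i) - (int i - int (l i))))"
    proof (rule disjoint_interval_selection[OF \<open>finite S\<close> \<open>inj_on int S\<close>])
      fix i assume "i \<in> S"
      then have "l i \<ge> 1" using luw[of i] L by auto
      then show "int i - int (l i) \<le> int i \<and> int i \<le> int i + 2 * int (l i) \<and> int i - int (l i) < int i + 2 * int (l i)"
        by auto
    qed
    then obtain R where R: "R \<subseteq> S"
      "\<And>i k. i \<in> R \<Longrightarrow> k \<in> R \<Longrightarrow> i \<noteq> k \<Longrightarrow> int i + 2 * int (l i) < int k - int (l k) \<or> int k + 2 * int (l k) < int i - int (l i)"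
      "real (card S) \<le> 4 * (\<Sum>i\<in>R. real_of_int (int i + 2 * int (l i) - (int i - int (l i))))"
      by blast
    have finR: "finite R" using R(1) \<open>finite S\<close> finite_subset by blast
    have "(\<Sum>i\<in>R. real_of_int (int i + 2 * int (l i) - (int i - int (l i)))) = 3 * (\<Sum>i\<in>R. real (l i))"
      by (simp add: sum_distrib_left)
    with R(3) many have total: "\<delta> * real n \<le> 12 * (\<Sum>i\<in>R. real (l i))"
      by (simp add: S_def)
    have win: "- int n \<le> u i \<and> u i \<le> w i \<and> w i \<le> 2 * int n" if "i \<in> R" for i
    proof -
      have "i \<in> S" using that R(1) by auto
      then have "i < n" by (simp add: S_def)
      then show ?thesis using luw[OF \<open>i \<in> S\<close>] by auto
    qed
    have disj: "w i < u k \<or> w k < u i" if "i \<in> R" "k \<in> R" "i \<noteq> k" for i k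
    proof -
      have "i \<in> S" "k \<in> S" using R(1) that by auto
      then show ?thesis using R(2)[OF that] luw[of i] luw[of k] by linarith
    qed
    define f where "f j = max 0 (dev j (j + int N) x) / real N" for j :: int
    have f: "f j \<ge> 0" for j by (simp add: f_def)
    have av: "dev a b x \<le> (\<Sum>j\<in>{a..<b}. f j) + c" if "a \<le> b" for a b
    proof -
      have "dev a b x \<le> ((\<Sum>j\<in>{a..<b}. max 0 (dev j (j + int N) x)) + 2 * B * (real N)\<^sup>2) / real N"
        using sub_average[OF x N that] N by (simp add: field_simps)
      also have "\<dots> = (\<Sum>j\<in>{a..<b}. f j) + c"
        using N by (simp add: f_def c_def add_divide_distrib sum_divide_distrib power2_eq_square)
      finally show ?thesis .
    qed
    define F where "F = (\<Sum>j\<in>{- int n..<2 * int n}. f j)"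
    have F: "F < \<kappa> * real (3 * n)"
    proof -
      have "(\<Sum>j<3 * n. max 0 (dev (int j) (int j + int N) (T (- int n) x))) = (\<Sum>j\<in>{- int n..<2 * int n}. max 0 (dev j (j + int N) x))"
      proof (rule sum.reindex_bij_witness[where i = "\<lambda>j. nat (j + int n)" and j = "\<lambda>j. int j - int n"])
        fix j show "max 0 (dev (int j - int n) (int j - int n + int N) x) = max 0 (dev (int j) (int j + int N) (T (- int n) x))"
          using dev_shift[OF x, of "int j" "int j + int N" "- int n"] by (simp add: algebra_simps)
      qed auto
      also have "\<dots> = real N * F" using N by (simp add: F_def f_def flip: sum_divide_distrib)
      finally have "real N * F < \<kappa> * real N * real (3 * n)" using E2 x by (auto simp: E2_def not_le)
      then have "real N * F < real N * (\<kappa> * real (3 * n))" by (simp add: mult_ac)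
      then show ?thesis using N by (simp only: mult_less_cancel_left_pos of_nat_0_less_iff) 
    qed
    have D: "dev (- int n) (2 * int n) x > - (\<kappa> * real (3 * n))"
    proof -
      have "dev 0 (int (3 * n)) (T (- int n) x) = dev (- int n) (2 * int n) x"
        using dev_shift[OF x, of 0 "int (3 * n)" "- int n"] by simp
      then show ?thesis using E3 x by (auto simp: E3_def not_le)
    qed
    have long: "c \<le> \<eta> * real (l i) / 2" if "i \<in> R" for i
    proof -
      have "L \<le> l i" using luw[of i] R(1) that by blast
      then have "2 * c / \<eta> \<le> real (l i)" using L(1) by linarith
      then show ?thesis using \<eta> by (simp add: field_simps)
    qed
    define U where "U = {i\<in>R. dev (u i) (w i) x \<ge> 0}"
    define V where "V = {i\<in>R. dev (u i) (w i) x < 0}"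
    have UV: "R = U \<union> V" "U \<inter> V = {}" "finite U" "finite V" using finR by (auto simp: U_def V_def)
    \<comment> \<open>Each upward deviation forces a large sum of \<open>f\<close> over its own
      window, and disjointness lets all these sums fit under \<open>F\<close>.\<close>
    have up: "(\<Sum>i\<in>U. \<eta> / 2 * real (l i)) \<le> F"
    proof -
      have "(\<Sum>i\<in>U. \<eta> / 2 * real (l i)) \<le> (\<Sum>i\<in>U. \<Sum>j\<in>{u i..<w i}. f j)"
      proof (intro sum_mono)
        fix i assume i: "i \<in> U"
        then have iR: "i \<in> R" by (simp add: U_def)
        have "\<eta> * real (l i) \<le> dev (u i) (w i) x" using luw[of i] R(1) i by (auto simp: U_def)
        also have "\<dots> \<le> (\<Sum>j\<in>{u i..<w i}. f j) + c" using win[OF iR] by (intro av) auto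
        finally show "\<eta> / 2 * real (l i) \<le> (\<Sum>j\<in>{u i..<w i}. f j)" using long[OF iR] by simp
      qed
      also have "\<dots> = (\<Sum>j\<in>(\<Union>i\<in>U. {u i..<w i}). f j)"
      proof (rule sum.UNION_disjoint[symmetric])
        show "\<forall>i\<in>U. \<forall>k\<in>U. i \<noteq> k \<longrightarrow> {u i..<w i} \<inter> {u k..<w k} = {}"
        proof (intro ballI impI)
          fix i k assume "i \<in> U" "k \<in> U" "i \<noteq> k"
          then have "w i < u k \<or> w k < u i" by (intro disj) (auto simp: U_def)
          then show "{u i..<w i} \<inter> {u k..<w k} = {}" by auto
        qed
      qed (use UV in auto)
      also have "\<dots> \<le> F"
        unfolding F_def by (rule sum_mono2) (use win f in \<open>fastforce simp: U_def\<close>)+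
      finally show ?thesis .
    qed
    have "dev (- int n) (2 * int n) x \<le> F + c + (\<Sum>i\<in>V. dev (u i) (w i) x + c)"
      unfolding F_def
    proof (rule sub_gaps[OF x f av])
      fix i assume "i \<in> V" then show "- int n \<le> u i \<and> u i \<le> w i \<and> w i \<le> 2 * int n" by (intro win) (simp add: V_def)
    next
      fix i k assume "i \<in> V" "k \<in> V" "i \<noteq> k"
      then show "w i < u k \<or> w k < u i" by (intro disj) (auto simp: V_def)
    qed (use UV in auto)
    also have "(\<Sum>i\<in>V. dev (u i) (w i) x + c) \<le> (\<Sum>i\<in>V. - (\<eta> / 2 * real (l i)))"
    proof (intro sum_mono)
      fix i assume i: "i \<in> V"
      then have iR: "i \<in> R" by (simp add: V_def)
      have "\<eta> * real (l i) \<le> - dev (u i) (w i) x" using luw[of i] R(1) i by (auto simp: V_def)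
      then show "dev (u i) (w i) x + c \<le> - (\<eta> / 2 * real (l i))" using long[OF iR] by simp
    qed
    also have "(\<Sum>i\<in>V. - (\<eta> / 2 * real (l i))) = - (\<Sum>i\<in>V. \<eta> / 2 * real (l i))" by (simp add: sum_negf)
    finally have "(\<Sum>i\<in>V. \<eta> / 2 * real (l i)) \<le> F + c - dev (- int n) (2 * int n) x" by simp
    moreover have "(\<Sum>i\<in>R. \<eta> / 2 * real (l i)) = (\<Sum>i\<in>U. \<eta> / 2 * real (l i)) + (\<Sum>i\<in>V. \<eta> / 2 * real (l i))"
      unfolding UV(1) by (rule sum.union_disjoint) (use UV in auto)
    moreover have "(\<Sum>i\<in>R. \<eta> / 2 * real (l i)) = \<eta> / 2 * (\<Sum>i\<in>R. real (l i))" by (simp add: sum_distrib_left)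
    ultimately have "\<eta> / 2 * (\<Sum>i\<in>R. real (l i)) \<le> 9 * \<kappa> * real n + c" using up F D by simp
    moreover have "\<eta> / 2 * (\<delta> * real n / 12) \<le> \<eta> / 2 * (\<Sum>i\<in>R. real (l i))"
      using total \<eta> by (intro mult_left_mono) auto
    moreover have "\<eta> / 2 * (\<delta> * real n / 12) = \<eta> * \<delta> * real n / 24" by simp
    moreover have "9 * \<kappa> * real n = \<eta> * \<delta> * real n / 48" by (simp add: \<kappa>_def)
    ultimately have "\<eta> * \<delta> * real n / 48 \<le> c" by linarith
    moreover have "48 * c / (\<eta> * \<delta>) < real n" using n0 nn by linarith
    then have "c < \<eta> * \<delta> * real n / 48" using \<eta> \<delta> by (simp add: field_simps)
    ultimately show False by simp
  qed
  ultimately show ?thesis by (intro exI[of _ L] exI[of _ Z]) blast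
qed

end

section \<open>The shift space\<close>

lemma topspace_sft [simp]: "topspace (sft_topology Q) = sft Q"
  by (simp add: sft_topology_def)

lemma shift_pow_in_sft [simp]: "shift_pow k x \<in> sft Q \<longleftrightarrow> x \<in> sft Q"
proof
  assume *: "shift_pow k x \<in> sft Q"
  have "Q (x n) (x (n + 1))" for n
  proof -
    have "Q (shift_pow k x (n - k)) (shift_pow k x (n - k + 1))" using * by (simp add: sft_def)
    then show ?thesis by (simp add: shift_pow_def algebra_simps)
  qed
  then show "x \<in> sft Q" by (simp add: sft_def)
next
  assume *: "x \<in> sft Q"
  have "Q (x (n + k)) (x (n + k + 1))" for n using * by (simp add: sft_def)
  then show "shift_pow k x \<in> sft Q" by (simp add: sft_def shift_pow_def algebra_simps)
qed

lemma shift_pow_0 [simp]: "shift_pow 0 x = x"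
  by (simp add: shift_pow_def)

lemma shift_pow_add: "shift_pow k (shift_pow l x) = shift_pow (k + l) x"
  by (simp add: shift_pow_def algebra_simps)

lemma continuous_map_shift_pow: "continuous_map (sft_topology Q) (sft_topology Q) (shift_pow k)"
proof -
  let ?P = "product_topology (\<lambda>_::int. discrete_topology (UNIV :: 'a set)) UNIV"
  have "continuous_map ?P (discrete_topology UNIV) (\<lambda>x. x (n + k))" for n
    by (rule continuous_map_product_projection) simp
  then have "continuous_map ?P ?P (shift_pow k)"
    unfolding continuous_map_componentwise_UNIV shift_pow_def by blast
  then have "continuous_map (sft_topology Q) ?P (shift_pow k)"
    unfolding sft_topology_def by (rule continuous_map_from_subtopology)
  then show ?thesis
    unfolding sft_topology_def by (rule continuous_map_into_subtopology) (auto simp: sft_topology_def)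
qed

section \<open>Topology of the subshift through finite coordinate windows\<close>

definition agree_on :: "int set \<Rightarrow> (int \<Rightarrow> 'a) \<Rightarrow> (int \<Rightarrow> 'a) \<Rightarrow> bool" where
  "agree_on I x y \<longleftrightarrow> (\<forall>i\<in>I. x i = y i)"

lemma agree_onD: "agree_on I x y \<Longrightarrow> i \<in> I \<Longrightarrow> x i = y i"
  by (simp add: agree_on_def)

lemma agree_on_refl: "agree_on I x x"
  by (simp add: agree_on_def)

lemma openin_product_discrete:
  fixes U :: "(int \<Rightarrow> 'a) set"
  shows "openin (product_topology (\<lambda>_. discrete_topology UNIV) UNIV) U \<longleftrightarrow>
    (\<forall>x\<in>U. \<exists>W::nat. \<forall>y. agree_on {- int W..int W} x y \<longrightarrow> y \<in> U)"
proof
  assume U: "openin (product_topology (\<lambda>_. discrete_topology UNIV) UNIV) U"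
  show "\<forall>x\<in>U. \<exists>W::nat. \<forall>y. agree_on {- int W..int W} x y \<longrightarrow> y \<in> U"
  proof
    fix x assume "x \<in> U"
    then obtain V where V: "finite {i. V i \<noteq> UNIV}" "x \<in> Pi\<^sub>E UNIV V" "Pi\<^sub>E UNIV V \<subseteq> U"
      using U unfolding openin_product_topology_alt by auto
    obtain W where W: "\<And>i. i \<in> {i. V i \<noteq> UNIV} \<Longrightarrow> \<bar>i\<bar> \<le> W"
      using V(1) by (metis finite_imageI Max_ge imageI)
    have "y \<in> U" if "agree_on {- int (nat W)..int (nat W)} x y" for y
    proof -
      have "y i \<in> V i" for i
      proof (cases "V i = UNIV")
        case False
        then have "i \<in> {- int (nat W)..int (nat W)}" using W[of i] by auto
        then have "x i = y i" by (rule agree_onD[OF that])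
        then show ?thesis using V(2) by (metis PiE_mem UNIV_I)
      qed simp
      then show ?thesis using V(3) by auto
    qed
    then show "\<exists>W::nat. \<forall>y. agree_on {- int W..int W} x y \<longrightarrow> y \<in> U" by blast
  qed
next
  assume *: "\<forall>x\<in>U. \<exists>W::nat. \<forall>y. agree_on {- int W..int W} x y \<longrightarrow> y \<in> U"
  show "openin (product_topology (\<lambda>_. discrete_topology UNIV) UNIV) U"
    unfolding openin_product_topology_alt
  proof
    fix x assume "x \<in> U"
    then obtain W :: nat where W: "\<And>y. agree_on {- int W..int W} x y \<Longrightarrow> y \<in> U" using * by blast
    let ?V = "\<lambda>i. if i \<in> {- int W..int W} then {x i} else UNIV"
    have "finite {i. ?V i \<noteq> UNIV}"
      by (rule finite_subset[of _ "{- int W..int W}"]) auto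
    moreover have "x \<in> Pi\<^sub>E UNIV ?V" by auto
    moreover have "Pi\<^sub>E UNIV ?V \<subseteq> U"
    proof
      fix y assume y: "y \<in> Pi\<^sub>E UNIV ?V"
      have "x i = y i" if "i \<in> {- int W..int W}" for i
        using PiE_mem[OF y, of i] that by simp
      then show "y \<in> U" by (intro W) (simp add: agree_on_def)
    qed
    ultimately show "\<exists>V. finite {i \<in> UNIV. V i \<noteq> topspace (discrete_topology UNIV)} \<and>
       (\<forall>i\<in>UNIV. openin (discrete_topology UNIV) (V i)) \<and> x \<in> Pi\<^sub>E UNIV V \<and> Pi\<^sub>E UNIV V \<subseteq> U"
      by (intro exI[of _ ?V]) auto
  qed
qed

lemma openin_sft:
  "openin (sft_topology Q) U \<longleftrightarrow>
    U \<subseteq> sft Q \<and> (\<forall>x\<in>U. \<exists>W::nat. \<forall>y\<in>sft Q. agree_on {- int W..int W} x y \<longrightarrow> y \<in> U)"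
proof
  assume "openin (sft_topology Q) U"
  then obtain V where V: "openin (product_topology (\<lambda>_. discrete_topology UNIV) UNIV) V" "U = V \<inter> sft Q"
    unfolding sft_topology_def openin_subtopology by blast
  then show "U \<subseteq> sft Q \<and> (\<forall>x\<in>U. \<exists>W::nat. \<forall>y\<in>sft Q. agree_on {- int W..int W} x y \<longrightarrow> y \<in> U)"
    unfolding openin_product_discrete by blast
next
  assume *: "U \<subseteq> sft Q \<and> (\<forall>x\<in>U. \<exists>W::nat. \<forall>y\<in>sft Q. agree_on {- int W..int W} x y \<longrightarrow> y \<in> U)"
  \<comment> \<open>The union of the cylinders of the full shift that are centred in
    \<open>U\<close> and whose trace on the subshift lies in \<open>U\<close>.\<close>
  define V where "V = {y. \<exists>x\<in>U. \<exists>W::nat. agree_on {- int W..int W} x y \<and>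
     (\<forall>z\<in>sft Q. agree_on {- int W..int W} x z \<longrightarrow> z \<in> U)}"
  have "U = V \<inter> sft Q"
  proof (intro equalityI subsetI)
    fix x assume "x \<in> U"
    then show "x \<in> V \<inter> sft Q" using * agree_on_refl unfolding V_def by blast
  qed (auto simp: V_def)
  moreover have "openin (product_topology (\<lambda>_. discrete_topology UNIV) UNIV) V"
    unfolding openin_product_discrete
  proof
    fix y assume "y \<in> V"
    then obtain x and W :: nat where xW: "x \<in> U" "agree_on {- int W..int W} x y"
      "\<forall>z\<in>sft Q. agree_on {- int W..int W} x z \<longrightarrow> z \<in> U" by (auto simp: V_def)
    have "z \<in> V" if "agree_on {- int W..int W} y z" for z
    proof -
      have "agree_on {- int W..int W} x z" using xW(2) that by (auto simp: agree_on_def)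
      then show ?thesis using xW unfolding V_def by blast
    qed
    then show "\<exists>W::nat. \<forall>z. agree_on {- int W..int W} y z \<longrightarrow> z \<in> V" by blast
  qed
  ultimately show "openin (sft_topology Q) U"
    unfolding sft_topology_def openin_subtopology by blast
qed

lemma compact_space_sft: "compact_space (sft_topology (Q :: 'a::finite \<Rightarrow> 'a \<Rightarrow> bool))"
proof -
  let ?P = "product_topology (\<lambda>_::int. discrete_topology (UNIV :: 'a set)) UNIV"
  have "compact_space ?P"
    by (simp add: compact_space_product_topology compact_space_discrete_topology)
  moreover have "closedin ?P (sft Q)"
  proof -
    have "openin ?P (- sft Q)"
      unfolding openin_product_discrete
    proof
      fix x assume "x \<in> - sft Q"
      then obtain n where n: "\<not> Q (x n) (x (n + 1))" by (auto simp: sft_def)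
      have "y \<in> - sft Q" if "agree_on {- int (nat (\<bar>n\<bar> + 1))..int (nat (\<bar>n\<bar> + 1))} x y" for y
      proof -
        have "x n = y n" "x (n + 1) = y (n + 1)" by (rule agree_onD[OF that]; auto)+
        then show ?thesis using n by (auto simp: sft_def)
      qed
      then show "\<exists>W::nat. \<forall>y. agree_on {- int W..int W} x y \<longrightarrow> y \<in> - sft Q" by blast
    qed
    then show ?thesis by (simp add: closedin_def Compl_eq_Diff_UNIV)
  qed
  ultimately show ?thesis
    unfolding sft_topology_def by (intro compact_space_subtopology closedin_compact_space)
qed

text \<open>Cover the compact set \<open>{g \<ge> b}\<close> by finitely many cylinders inside
  \<open>{g > a}\<close>. The Gibbs property speaks only of cylinders, and this makes it applicable
  to events given by a continuous function.\<close>

lemma clopen_approximation: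
  fixes Q :: "'a::finite \<Rightarrow> 'a \<Rightarrow> bool" and g :: "(int \<Rightarrow> 'a) \<Rightarrow> real"
  assumes g: "continuous_map (sft_topology Q) euclideanreal g" and ab: "a < b"
  obtains W :: nat and P where
    "\<And>x y. agree_on {- int W..int W} x y \<Longrightarrow> P x = P y"
    "\<And>x. x \<in> sft Q \<Longrightarrow> g x \<ge> b \<Longrightarrow> P x" "\<And>x. x \<in> sft Q \<Longrightarrow> P x \<Longrightarrow> g x > a"
proof -
  let ?X = "sft_topology Q"
  have "closedin ?X {x \<in> topspace ?X. g x \<in> {b..}}"
    by (rule closedin_continuous_map_preimage[OF g]) simp
  then have F: "compactin ?X {x \<in> sft Q. g x \<ge> b}"
    using closedin_compact_space[OF compact_space_sft] by simp
  have "openin ?X {x \<in> topspace ?X. g x \<in> {a<..}}"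
    by (rule openin_continuous_map_preimage[OF g]) simp
  then have "\<forall>x\<in>{x \<in> sft Q. g x > a}. \<exists>W::nat. \<forall>y\<in>sft Q. agree_on {- int W..int W} x y \<longrightarrow> y \<in> {x \<in> sft Q. g x > a}"
    unfolding openin_sft by simp
  from bchoice[OF this] obtain W :: "(int \<Rightarrow> 'a) \<Rightarrow> nat" where W: "\<And>x y. x \<in> sft Q \<Longrightarrow> g x > a \<Longrightarrow> y \<in> sft Q \<Longrightarrow>
      agree_on {- int (W x)..int (W x)} x y \<Longrightarrow> g y > a" by blast
  define C where "C x = {y\<in>sft Q. agree_on {- int (W x)..int (W x)} x y}" for x
  have openC: "openin ?X (C x)" for x
    unfolding openin_sft
  proof (intro conjI ballI)
    fix y assume y: "y \<in> C x"
    have "z \<in> C x" if "z \<in> sft Q" "agree_on {- int (W x)..int (W x)} y z" for z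
      using y that unfolding C_def agree_on_def by simp
    then show "\<exists>V::nat. \<forall>z\<in>sft Q. agree_on {- int V..int V} y z \<longrightarrow> z \<in> C x" by blast
  qed (auto simp: C_def)
  have cov: "{x \<in> sft Q. g x \<ge> b} \<subseteq> \<Union> (C ` {x \<in> sft Q. g x \<ge> b})"
    using agree_on_refl unfolding C_def by blast
  have "\<exists>\<F>. finite \<F> \<and> \<F> \<subseteq> C ` {x \<in> sft Q. g x \<ge> b} \<and> {x \<in> sft Q. g x \<ge> b} \<subseteq> \<Union> \<F>"
    by (rule compactinD[OF F _ cov]) (use openC in blast)
  then obtain \<F> where \<F>: "finite \<F>" "\<F> \<subseteq> C ` {x \<in> sft Q. g x \<ge> b}" "{x \<in> sft Q. g x \<ge> b} \<subseteq> \<Union> \<F>"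
    by blast
  from finite_subset_image[OF \<F>(1,2)]
  obtain S where S: "finite S" "S \<subseteq> {x \<in> sft Q. g x \<ge> b}" "\<F> = C ` S" by blast
  define V where "V = (\<Sum>x\<in>S. W x)"
  have WV: "W x \<le> V" if "x \<in> S" for x
    unfolding V_def using S(1) that by (intro member_le_sum) auto
  define P where "P y \<longleftrightarrow> (\<exists>x\<in>S. agree_on {- int (W x)..int (W x)} x y)" for y
  show thesis
  proof (rule that[of V P])
    fix x y :: "int \<Rightarrow> 'a" assume xy: "agree_on {- int V..int V} x y"
    have "agree_on {- int (W s)..int (W s)} s x = agree_on {- int (W s)..int (W s)} s y" if "s \<in> S" for s
    proof -
      have "x i = y i" if "i \<in> {- int (W s)..int (W s)}" for i
        by (rule agree_onD[OF xy]) (use WV[OF \<open>s \<in> S\<close>] that in auto)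
      then show ?thesis by (simp add: agree_on_def)
    qed
    then show "P x = P y" by (simp add: P_def)
  next
    fix x assume "x \<in> sft Q" "g x \<ge> b"
    then have "x \<in> \<Union> (C ` S)" using \<F>(3) S(3) by auto
    then show "P x" by (auto simp: P_def C_def)
  next
    fix x assume "x \<in> sft Q" "P x"
    then obtain s where "s \<in> S" "agree_on {- int (W s)..int (W s)} s x" by (auto simp: P_def)
    moreover from this have "s \<in> sft Q" "g s > a" using S(2) ab by auto
    ultimately show "g x > a" using W \<open>x \<in> sft Q\<close> by blast
  qed
qed

section \<open>Gibbs measures\<close>

lemma gibbs_prob_space: "gibbs_measure Q \<phi> \<mu> \<Longrightarrow> prob_space \<mu>"
  by (simp add: gibbs_measure_def)

lemma gibbs_space: "gibbs_measure Q \<phi> \<mu> \<Longrightarrow> space \<mu> = sft Q"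
  by (simp add: gibbs_measure_def)

lemma gibbs_open_sets: "gibbs_measure Q \<phi> \<mu> \<Longrightarrow> openin (sft_topology Q) U \<Longrightarrow> U \<in> sets \<mu>"
  by (auto simp: gibbs_measure_def intro: sigma_sets.Basic)

lemma gibbs_closed_sets:
  assumes "gibbs_measure Q \<phi> \<mu>" "closedin (sft_topology Q) F"
  shows "F \<in> sets \<mu>"
proof -
  have "space \<mu> - (sft Q - F) \<in> sets \<mu>"
    using assms by (intro sets.compl_sets gibbs_open_sets) (auto simp: closedin_def)
  moreover have "space \<mu> - (sft Q - F) = F"
    using closedin_subset[OF assms(2)] gibbs_space[OF assms(1)] by auto
  ultimately show ?thesis by simp
qed

lemma gibbs_continuous_measurable:
  fixes g :: "_ \<Rightarrow> 'b::topological_space"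
  assumes \<mu>: "gibbs_measure Q \<phi> \<mu>" and "continuous_map (sft_topology Q) euclidean g"
  shows "g \<in> borel_measurable \<mu>"
proof (rule borel_measurableI)
  fix S :: "'b set" assume "open S"
  then have "openin (sft_topology Q) {x \<in> topspace (sft_topology Q). g x \<in> S}"
    by (intro openin_continuous_map_preimage[OF assms(2)]) simp
  moreover have "{x \<in> topspace (sft_topology Q). g x \<in> S} = g -` S \<inter> space \<mu>"
    using gibbs_space[OF \<mu>] by auto
  ultimately show "g -` S \<inter> space \<mu> \<in> sets \<mu>"
    using gibbs_open_sets[OF \<mu>] by simp
qed

lemma gibbs_shift_measurable:
  assumes \<mu>: "gibbs_measure Q \<phi> \<mu>"
  shows "shift_pow k \<in> measurable \<mu> \<mu>"
proof (rule measurable_sigma_sets[where \<Omega> = "sft Q" and A = "{U. openin (sft_topology Q) U}"])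
  show "sets \<mu> = sigma_sets (sft Q) {U. openin (sft_topology Q) U}"
    using \<mu> by (simp add: gibbs_measure_def)
  show "{U. openin (sft_topology Q) U} \<subseteq> Pow (sft Q)" using openin_subset by fastforce
  show "shift_pow k \<in> space \<mu> \<rightarrow> sft Q" by (auto simp: gibbs_space[OF \<mu>])
  fix U assume "U \<in> {U. openin (sft_topology Q) U}"
  then have "openin (sft_topology Q) {x \<in> topspace (sft_topology Q). shift_pow k x \<in> U}"
    by (intro openin_continuous_map_preimage[OF continuous_map_shift_pow]) simp
  moreover have "{x \<in> topspace (sft_topology Q). shift_pow k x \<in> U} = shift_pow k -` U \<inter> space \<mu>"
    using gibbs_space[OF \<mu>] by auto
  ultimately show "shift_pow k -` U \<inter> space \<mu> \<in> sets \<mu>"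
    using gibbs_open_sets[OF \<mu>] by simp
qed

lemma gibbs_shift_preserving:
  assumes \<mu>: "gibbs_measure Q \<phi> \<mu>" and A: "A \<in> sets \<mu>"
  shows "measure \<mu> (shift_pow k -` A \<inter> space \<mu>) = measure \<mu> A"
proof -
  have pre: "shift_pow k -` A \<inter> space \<mu> \<in> sets \<mu>" if "A \<in> sets \<mu>" for A k
    using measurable_sets[OF gibbs_shift_measurable[OF \<mu>] that] .
  have comp: "shift_pow k -` (shift_pow l -` A \<inter> space \<mu>) \<inter> space \<mu> = shift_pow (l + k) -` A \<inter> space \<mu>" for k l A
    using gibbs_space[OF \<mu>] by (auto simp: shift_pow_add)
  have 1: "measure \<mu> (shift_pow 1 -` A \<inter> space \<mu>) = measure \<mu> A" if "A \<in> sets \<mu>" for A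
  proof -
    have "distr \<mu> \<mu> (shift_pow 1) = \<mu>" using \<mu> by (simp add: gibbs_measure_def)
    then show ?thesis using measure_distr[OF gibbs_shift_measurable[OF \<mu>] that, of 1] by simp
  qed
  have nat: "measure \<mu> (shift_pow (int n) -` A \<inter> space \<mu>) = measure \<mu> A" if "A \<in> sets \<mu>" for A n
    using that
  proof (induction n arbitrary: A)
    case 0
    then have "shift_pow 0 -` A \<inter> space \<mu> = A" using sets.sets_into_space by auto
    then show ?case by (simp only: of_nat_0)
  next
    case (Suc n)
    have "measure \<mu> (shift_pow (int n) -` (shift_pow 1 -` A \<inter> space \<mu>) \<inter> space \<mu>) = measure \<mu> A"
      using Suc.IH[OF pre[OF Suc.prems, of 1]] 1[OF Suc.prems] by simp
    then show ?case unfolding comp by simp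
  qed
  show ?thesis
  proof (cases "k \<ge> 0")
    case True
    then show ?thesis using nat[OF A, of "nat k"] by simp
  next
    case False
    \<comment> \<open>For negative \<open>k\<close>, pull back once more by the positive power
      \<open>- k\<close>: this preserves the measure and restores \<open>A\<close>.\<close>
    have "measure \<mu> (shift_pow (int (nat (- k))) -` (shift_pow k -` A \<inter> space \<mu>) \<inter> space \<mu>) = measure \<mu> (shift_pow k -` A \<inter> space \<mu>)"
      by (rule nat[OF pre[OF A]])
    moreover have "shift_pow (k + int (nat (- k))) -` A \<inter> space \<mu> = A"
      using False sets.sets_into_space[OF A] by auto
    ultimately show ?thesis unfolding comp by simp
  qed
qed

text \<open>Compare the three cylinders along one orbit: a point \<open>x\<close> of
  \<open>[ab]\<close> lies in \<open>[a]\<close>, its image after \<open>length as\<close> steps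
  lies in \<open>[b]\<close>, and the Birkhoff weights multiply. One upper and two lower Gibbs
  bounds give \<open>C^3\<close>; the maximum with 1 is taken so that powers of \<open>K\<close> can
  be compared.\<close>

lemma gibbs_quasi_Bernoulli:
  assumes \<mu>: "gibbs_measure Q \<phi> \<mu>"
  obtains K where "K \<ge> 1"
    "\<And>as bs. measure \<mu> (cylinder Q (as @ bs)) \<le> K * (measure \<mu> (cylinder Q as) * measure \<mu> (cylinder Q bs))"
proof -
  obtain P C where C: "C > 0" and gibbs: "\<And>as x. x \<in> cylinder Q as \<Longrightarrow>
      1 / C \<le> measure \<mu> (cylinder Q as) / exp (birkhoff_sum \<phi> (length as) x - real (length as) * P) \<and>
      measure \<mu> (cylinder Q as) / exp (birkhoff_sum \<phi> (length as) x - real (length as) * P) \<le> C"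
    using \<mu> unfolding gibbs_measure_def Let_def by blast
  define w where "w n x = exp (birkhoff_sum \<phi> n x - real n * P)" for n x
  have up: "measure \<mu> (cylinder Q as) \<le> C * w (length as) x" if "x \<in> cylinder Q as" for as x
    using gibbs[OF that] by (simp add: w_def divide_simps)
  have lo: "w (length as) x \<le> C * measure \<mu> (cylinder Q as)" if "x \<in> cylinder Q as" for as x
    using gibbs[OF that] C by (simp add: w_def divide_simps mult.commute)
  have "measure \<mu> (cylinder Q (as @ bs)) \<le> (C * C * C) * (measure \<mu> (cylinder Q as) * measure \<mu> (cylinder Q bs))" for as bs
  proof (cases "cylinder Q (as @ bs) = {}")
    case True
    then show ?thesis using C by simp
  next
    case False
    then obtain x where x: "x \<in> cylinder Q (as @ bs)" by blast
    let ?y = "shift_pow (int (length as)) x"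
    have xa: "x \<in> cylinder Q as"
      using x by (auto simp: cylinder_def nth_append)
    have "?y (int j) = bs ! j" if "j < length bs" for j
    proof -
      have "x (int (length as + j)) = (as @ bs) ! (length as + j)"
        using x that unfolding cylinder_def by (auto simp del: of_nat_add)
      then show ?thesis by (simp add: shift_pow_def add.commute nth_append)
    qed
    then have yb: "?y \<in> cylinder Q bs"
      using x by (auto simp: cylinder_def)
    have "birkhoff_sum \<phi> (length as + length bs) x = birkhoff_sum \<phi> (length as) x + birkhoff_sum \<phi> (length bs) ?y"
    proof -
      have "(\<Sum>j<length as + m. \<phi> (shift_pow (int j) x)) =
         (\<Sum>j<length as. \<phi> (shift_pow (int j) x)) + (\<Sum>j<m. \<phi> (shift_pow (int j) ?y))" for m
        by (induction m) (simp_all add: shift_pow_add add.commute)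
      then show ?thesis by (simp add: birkhoff_sum_def)
    qed
    then have "w (length (as @ bs)) x = w (length as) x * w (length bs) ?y"
      by (simp add: w_def mult_exp_exp algebra_simps)
    then have "measure \<mu> (cylinder Q (as @ bs)) \<le> C * (w (length as) x * w (length bs) ?y)"
      using up[OF x] by simp
    also have "\<dots> \<le> C * ((C * measure \<mu> (cylinder Q as)) * (C * measure \<mu> (cylinder Q bs)))"
      using C lo[OF xa] lo[OF yb] by (intro mult_left_mono mult_mono) (auto simp: w_def)
    finally show ?thesis by (simp add: mult_ac)
  qed
  then have "measure \<mu> (cylinder Q (as @ bs)) \<le> max 1 (C * C * C) * (measure \<mu> (cylinder Q as) * measure \<mu> (cylinder Q bs))" for as bs
    by (rule order_trans) (intro mult_right_mono, auto)
  then show thesis using that[of "max 1 (C * C * C)"] by simp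
qed

section \<open>Visits to events that depend on finitely many coordinates\<close>

definition depends_on_first :: "nat \<Rightarrow> ((int \<Rightarrow> 'a) \<Rightarrow> bool) \<Rightarrow> bool" where
  "depends_on_first n P \<longleftrightarrow> (\<forall>x y. (\<forall>j<n. x (int j) = y (int j)) \<longrightarrow> P x = P y)"

definition words :: "('a \<Rightarrow> 'a \<Rightarrow> bool) \<Rightarrow> nat \<Rightarrow> ((int \<Rightarrow> 'a) \<Rightarrow> bool) \<Rightarrow> 'a list set" where
  "words Q n P = (\<lambda>x. map (\<lambda>j. x (int j)) [0..<n]) ` {x\<in>sft Q. P x}"

lemma finite_words: "finite (words (Q :: 'a::finite \<Rightarrow> 'a \<Rightarrow> bool) n P)"
proof (rule finite_subset)
  show "words Q n P \<subseteq> {w. set w \<subseteq> UNIV \<and> length w = n}" by (auto simp: words_def)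
qed (rule finite_lists_length_eq, simp)

lemma cylinder_words:
  assumes "depends_on_first n P" "w \<in> words Q n P"
  shows "cylinder Q w = {x\<in>sft Q. map (\<lambda>j. x (int j)) [0..<n] = w}" "x \<in> cylinder Q w \<Longrightarrow> P x" "length w = n"
proof -
  obtain y where y: "y \<in> sft Q" "P y" "w = map (\<lambda>j. y (int j)) [0..<n]"
    using assms(2) by (auto simp: words_def)
  then show len: "length w = n" by simp
  show eq: "cylinder Q w = {x\<in>sft Q. map (\<lambda>j. x (int j)) [0..<n] = w}"
    unfolding cylinder_def len by (auto simp: list_eq_iff_nth_eq len)
  assume "x \<in> cylinder Q w"
  then have "\<forall>j<n. x (int j) = y (int j)" using y(3) by (auto simp: cylinder_def)
  then show "P x" using y(2) assms(1) by (auto simp: depends_on_first_def)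
qed

lemma depends_eq_Union_cylinder:
  assumes "depends_on_first n P"
  shows "{x\<in>sft Q. P x} = (\<Union>w\<in>words Q n P. cylinder Q w)"
proof (intro equalityI subsetI)
  fix x assume x: "x \<in> {x\<in>sft Q. P x}"
  let ?w = "map (\<lambda>j. x (int j)) [0..<n]"
  have "?w \<in> words Q n P" using x by (auto simp: words_def)
  moreover have "x \<in> cylinder Q ?w" using x by (auto simp: cylinder_def)
  ultimately show "x \<in> (\<Union>w\<in>words Q n P. cylinder Q w)" by blast
next
  fix x assume "x \<in> (\<Union>w\<in>words Q n P. cylinder Q w)"
  then obtain w where w: "w \<in> words Q n P" "x \<in> cylinder Q w" by blast
  have "P x" by (rule cylinder_words(2)[OF assms w])
  then show "x \<in> {x\<in>sft Q. P x}" using w(2) by (auto simp: cylinder_def)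
qed

lemma openin_cylinder: "openin (sft_topology Q) (cylinder Q w)"
  unfolding openin_sft
proof (intro conjI ballI)
  show "cylinder Q w \<subseteq> sft Q" by (auto simp: cylinder_def)
  fix x assume x: "x \<in> cylinder Q w"
  show "\<exists>W::nat. \<forall>y\<in>sft Q. agree_on {- int W..int W} x y \<longrightarrow> y \<in> cylinder Q w"
    using x by (intro exI[of _ "length w"]) (auto simp: cylinder_def agree_on_def)
qed

lemma gibbs_depends_sets:
  fixes Q :: "'a::finite \<Rightarrow> 'a \<Rightarrow> bool"
  assumes \<mu>: "gibbs_measure Q \<phi> \<mu>" and "depends_on_first n P"
  shows "{x\<in>sft Q. P x} \<in> sets \<mu>"
  unfolding depends_eq_Union_cylinder[OF assms(2)]
  using finite_words gibbs_open_sets[OF \<mu> openin_cylinder] by (intro sets.finite_UN) auto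

lemma gibbs_measure_depends:
  fixes Q :: "'a::finite \<Rightarrow> 'a \<Rightarrow> bool"
  assumes \<mu>: "gibbs_measure Q \<phi> \<mu>" and "depends_on_first n P"
  shows "measure \<mu> {x\<in>sft Q. P x} = (\<Sum>w\<in>words Q n P. measure \<mu> (cylinder Q w))"
proof -
  interpret prob_space \<mu> by (rule gibbs_prob_space[OF \<mu>])
  show ?thesis
    unfolding depends_eq_Union_cylinder[OF assms(2)]
  proof (rule finite_measure_finite_Union[OF finite_words])
    show "cylinder Q ` words Q n P \<subseteq> sets \<mu>" using gibbs_open_sets[OF \<mu> openin_cylinder] by auto
    show "disjoint_family_on (cylinder Q) (words Q n P)"
      unfolding disjoint_family_on_def using cylinder_words(1)[OF assms(2)] by auto
  qed
qed

text \<open>Quasi-Bernoulli summed over words. Two events read from consecutive blocks are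
  independent up to the factor \<open>K\<close>, whatever the lengths of the blocks.\<close>

lemma gibbs_product_bound:
  fixes Q :: "'a::finite \<Rightarrow> 'a \<Rightarrow> bool"
  assumes \<mu>: "gibbs_measure Q \<phi> \<mu>" and P: "depends_on_first m P" and R: "depends_on_first n R"
    and K: "K \<ge> 1" "\<And>as bs. measure \<mu> (cylinder Q (as @ bs)) \<le> K * (measure \<mu> (cylinder Q as) * measure \<mu> (cylinder Q bs))"
  shows "measure \<mu> {x\<in>sft Q. P x \<and> R (shift_pow (int m) x)} \<le> K * (measure \<mu> {x\<in>sft Q. P x} * measure \<mu> {x\<in>sft Q. R x})"
proof -
  interpret prob_space \<mu> by (rule gibbs_prob_space[OF \<mu>])
  have "{x\<in>sft Q. P x \<and> R (shift_pow (int m) x)} \<subseteq> (\<Union>a\<in>words Q m P. \<Union>b\<in>words Q n R. cylinder Q (a @ b))"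
  proof
    fix x assume "x \<in> {x\<in>sft Q. P x \<and> R (shift_pow (int m) x)}"
    then have x: "x \<in> sft Q" "P x" "R (shift_pow (int m) x)" by auto
    let ?a = "map (\<lambda>j. x (int j)) [0..<m]" and ?b = "map (\<lambda>j. shift_pow (int m) x (int j)) [0..<n]"
    have "?a \<in> words Q m P" using x by (auto simp: words_def)
    moreover have "?b \<in> words Q n R" using x unfolding words_def by (intro imageI) simp
    moreover have "x \<in> cylinder Q (?a @ ?b)"
      using x by (auto simp: cylinder_def nth_append shift_pow_def of_nat_diff)
    ultimately show "x \<in> (\<Union>a\<in>words Q m P. \<Union>b\<in>words Q n R. cylinder Q (a @ b))" by blast
  qed
  then have "measure \<mu> {x\<in>sft Q. P x \<and> R (shift_pow (int m) x)} \<le> measure \<mu> (\<Union>a\<in>words Q m P. \<Union>b\<in>words Q n R. cylinder Q (a @ b))"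
    using gibbs_open_sets[OF \<mu> openin_cylinder] by (intro finite_measure_mono sets.finite_UN finite_words) auto
  also have "\<dots> \<le> (\<Sum>a\<in>words Q m P. measure \<mu> (\<Union>b\<in>words Q n R. cylinder Q (a @ b)))"
    using gibbs_open_sets[OF \<mu> openin_cylinder]
    by (intro finite_measure_subadditive_finite finite_words) (auto intro!: sets.finite_UN finite_words)
  also have "\<dots> \<le> (\<Sum>a\<in>words Q m P. \<Sum>b\<in>words Q n R. measure \<mu> (cylinder Q (a @ b)))"
    using gibbs_open_sets[OF \<mu> openin_cylinder]
    by (intro sum_mono finite_measure_subadditive_finite finite_words) auto
  also have "\<dots> \<le> (\<Sum>a\<in>words Q m P. \<Sum>b\<in>words Q n R. K * (measure \<mu> (cylinder Q a) * measure \<mu> (cylinder Q b)))"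
    by (intro sum_mono K)
  also have "\<dots> = K * ((\<Sum>a\<in>words Q m P. measure \<mu> (cylinder Q a)) * (\<Sum>b\<in>words Q n R. measure \<mu> (cylinder Q b)))"
    unfolding sum_product by (simp only: sum_distrib_left)
  finally show ?thesis
    by (simp add: gibbs_measure_depends[OF \<mu> P] gibbs_measure_depends[OF \<mu> R])
qed

lemma depends_on_first_blocks:
  assumes "\<And>k. depends_on_first W (P k)"
  shows "depends_on_first (m * W) (\<lambda>x. \<forall>k<m. P k (shift_pow (int (k * W)) x))"
  unfolding depends_on_first_def
proof (intro allI impI)
  fix x y :: "int \<Rightarrow> 'a" assume xy: "\<forall>j<m * W. x (int j) = y (int j)"
  have "P k (shift_pow (int (k * W)) x) = P k (shift_pow (int (k * W)) y)" if "k < m" for k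
  proof -
    have "shift_pow (int (k * W)) x (int j) = shift_pow (int (k * W)) y (int j)" if "j < W" for j
    proof -
      have "j + k * W < Suc k * W" using that by simp
      also have "Suc k * W \<le> m * W" using \<open>k < m\<close> by (intro mult_le_mono1) simp
      finally have "x (int (j + k * W)) = y (int (j + k * W))" using xy by blast
      then show ?thesis by (simp add: shift_pow_def)
    qed
    then show ?thesis using assms[of k] by (simp add: depends_on_first_def)
  qed
  then show "(\<forall>k<m. P k (shift_pow (int (k * W)) x)) = (\<forall>k<m. P k (shift_pow (int (k * W)) y))" by blast
qed

text \<open>The event may vary with the block, so that blocks without a constraint can carry the
  trivial event.\<close>

lemma gibbs_blocks_bound:
  fixes Q :: "'a::finite \<Rightarrow> 'a \<Rightarrow> bool"
  assumes \<mu>: "gibbs_measure Q \<phi> \<mu>" and P: "\<And>k. depends_on_first W (P k)"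
    and K: "K \<ge> 1" "\<And>as bs. measure \<mu> (cylinder Q (as @ bs)) \<le> K * (measure \<mu> (cylinder Q as) * measure \<mu> (cylinder Q bs))"
  shows "measure \<mu> {x\<in>sft Q. \<forall>k<m. P k (shift_pow (int (k * W)) x)} \<le> K ^ m * (\<Prod>k<m. measure \<mu> {x\<in>sft Q. P k x})"
proof (induction m)
  case 0
  interpret prob_space \<mu> by (rule gibbs_prob_space[OF \<mu>])
  show ?case by simp
next
  case (Suc m)
  have "{x\<in>sft Q. \<forall>k<Suc m. P k (shift_pow (int (k * W)) x)} =
     {x\<in>sft Q. (\<forall>k<m. P k (shift_pow (int (k * W)) x)) \<and> P m (shift_pow (int (m * W)) x)}"
    by (auto simp: less_Suc_eq)
  then have "measure \<mu> {x\<in>sft Q. \<forall>k<Suc m. P k (shift_pow (int (k * W)) x)} \<le>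
     K * (measure \<mu> {x\<in>sft Q. \<forall>k<m. P k (shift_pow (int (k * W)) x)} * measure \<mu> {x\<in>sft Q. P m x})"
    using gibbs_product_bound[OF \<mu> depends_on_first_blocks[OF P, of m] P[of m] K] by simp
  also have "\<dots> \<le> K * ((K ^ m * (\<Prod>k<m. measure \<mu> {x\<in>sft Q. P k x})) * measure \<mu> {x\<in>sft Q. P m x})"
    using K Suc by (intro mult_left_mono mult_right_mono) auto
  finally show ?case by (simp add: mult_ac)
qed

text \<open>A union bound over the at most \<open>2^m\<close> sets of visited blocks. Each set has
  at least \<open>\<kappa> m\<close> elements, hence probability at most
  \<open>K^m (4 K)^(-m) = 4^(-m)\<close>; the threshold \<open>(4 K) powr (- 1 / \<kappa>)\<close>
  is chosen for this.\<close>

lemma gibbs_block_count: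
  fixes Q :: "'a::finite \<Rightarrow> 'a \<Rightarrow> bool"
  assumes \<mu>: "gibbs_measure Q \<phi> \<mu>" and P: "depends_on_first W P"
    and K: "K \<ge> 1" "\<And>as bs. measure \<mu> (cylinder Q (as @ bs)) \<le> K * (measure \<mu> (cylinder Q as) * measure \<mu> (cylinder Q bs))"
    and \<kappa>: "\<kappa> > 0" and small: "measure \<mu> {x\<in>sft Q. P x} \<le> (4 * K) powr (- 1 / \<kappa>)"
  shows "\<exists>A\<in>sets \<mu>. measure \<mu> A \<le> (1 / 2) ^ m \<and>
    (\<forall>x\<in>sft Q. real (card {k\<in>{..<m}. P (shift_pow (int (k * W)) x)}) \<ge> \<kappa> * real m \<longrightarrow> x \<in> A)"
proof -
  interpret prob_space \<mu> by (rule gibbs_prob_space[OF \<mu>])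
  define p where "p = (4 * K) powr (- 1 / \<kappa>)"
  have p: "0 < p" "p \<le> 1"
  proof -
    show "0 < p" using K by (simp add: p_def)
    have "(4 * K) powr (- 1 / \<kappa>) \<le> (4 * K) powr 0" using K \<kappa> by (intro powr_mono) auto
    then show "p \<le> 1" using K by (simp add: p_def)
  qed
  define \<R> where "\<R> = {R. R \<subseteq> {..<m} \<and> \<kappa> * real m \<le> real (card R)}"
  have fin: "finite \<R>" unfolding \<R>_def by (rule finite_subset[of _ "Pow {..<m}"]) auto
  define PR where "PR R k = (if k \<in> R then P else (\<lambda>_. True))" for R :: "nat set" and k
  have PR: "depends_on_first W (PR R k)" for R k
    using P by (auto simp: PR_def depends_on_first_def)
  define A where "A R = {x\<in>sft Q. \<forall>k<m. PR R k (shift_pow (int (k * W)) x)}" for R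
  have sets: "A R \<in> sets \<mu>" for R
    unfolding A_def by (rule gibbs_depends_sets[OF \<mu> depends_on_first_blocks[OF PR]])
  have AR: "measure \<mu> (A R) \<le> (1 / 4) ^ m" if "R \<in> \<R>" for R
  proof -
    have R: "R \<subseteq> {..<m}" "\<kappa> * real m \<le> real (card R)" using that by (auto simp: \<R>_def)
    have "measure \<mu> (A R) \<le> K ^ m * (\<Prod>k<m. measure \<mu> {x\<in>sft Q. PR R k x})"
      unfolding A_def by (rule gibbs_blocks_bound[OF \<mu> PR K])
    also have "(\<Prod>k<m. measure \<mu> {x\<in>sft Q. PR R k x}) \<le> (\<Prod>k<m. if k \<in> R then p else 1)"
      using small by (intro prod_mono) (auto simp: PR_def p_def)
    also have "(\<Prod>k<m. if k \<in> R then p else 1) = (\<Prod>k\<in>R. p)"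
      using R(1) by (intro prod.mono_neutral_cong_right) auto
    also have "\<dots> = p ^ card R" by simp
    also have "p ^ card R = p powr real (card R)" using p by (simp add: powr_realpow)
    also have "\<dots> \<le> p powr (\<kappa> * real m)" using p R(2) by (intro powr_mono') auto
    also have "\<dots> = (4 * K) powr (- real m)" using \<kappa> by (simp add: p_def powr_powr)
    also have "\<dots> = 1 / (4 * K) ^ m" using K by (simp add: powr_minus_divide powr_realpow)
    finally have "measure \<mu> (A R) \<le> K ^ m * (1 / (4 * K) ^ m)" using K by (simp add: mult_left_mono)
    also have "\<dots> = (1 / 4) ^ m" using K by (simp add: power_mult_distrib power_divide)
    finally show ?thesis .
  qed
  have "measure \<mu> (\<Union>R\<in>\<R>. A R) \<le> (\<Sum>R\<in>\<R>. measure \<mu> (A R))"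
    using sets by (intro finite_measure_subadditive_finite fin) auto
  also have "\<dots> \<le> (\<Sum>R\<in>\<R>. (1 / 4) ^ m)" by (intro sum_mono AR)
  also have "\<dots> = real (card \<R>) * (1 / 4) ^ m" by simp
  also have "\<dots> \<le> 2 ^ m * (1 / 4) ^ m"
  proof (intro mult_right_mono)
    have "card \<R> \<le> card (Pow {..<m})" by (rule card_mono) (auto simp: \<R>_def)
    then have "real (card \<R>) \<le> real (2 ^ m)" by (simp only: card_Pow finite_lessThan card_lessThan of_nat_le_iff)
    then show "real (card \<R>) \<le> 2 ^ m" by simp
  qed simp
  also have "\<dots> = (1 / 2) ^ m" by (simp flip: power_mult_distrib)
  finally have "measure \<mu> (\<Union>R\<in>\<R>. A R) \<le> (1 / 2) ^ m" .
  moreover have "(\<Union>R\<in>\<R>. A R) \<in> sets \<mu>" using sets fin by auto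
  moreover have "x \<in> (\<Union>R\<in>\<R>. A R)"
    if "x \<in> sft Q" "real (card {k\<in>{..<m}. P (shift_pow (int (k * W)) x)}) \<ge> \<kappa> * real m" for x
    using that by (auto simp: \<R>_def A_def PR_def intro!: exI[of _ "{k\<in>{..<m}. P (shift_pow (int (k * W)) x)}"])
  ultimately show ?thesis by blast
qed

text \<open>Pigeonhole on residues modulo \<open>W\<close>: an event depending on \<open>W\<close>
  coordinates, observed at times in one residue class, reads disjoint blocks. The added 1 accounts
  for the incomplete last block.\<close>

lemma residue_class_selection:
  fixes n W :: nat
  assumes W: "W \<ge> 1" and many: "real (card {j\<in>{..<n}. S j}) \<ge> t"
  shows "\<exists>s<W. real (card {k\<in>{..<n div W + 1}. S (k * W + s)}) \<ge> t / real W"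
proof (rule ccontr)
  assume "\<not> ?thesis"
  then have less: "real (card {k\<in>{..<n div W + 1}. S (k * W + s)}) < t / real W" if "s < W" for s
    using that by (auto simp: not_le)
  have "{j\<in>{..<n}. S j} \<subseteq> (\<Union>s<W. (\<lambda>k. k * W + s) ` {k\<in>{..<n div W + 1}. S (k * W + s)})"
  proof
    fix j assume j: "j \<in> {j\<in>{..<n}. S j}"
    have "j mod W < W" using W by simp
    moreover have "j div W \<in> {k\<in>{..<n div W + 1}. S (k * W + j mod W)}"
      using j by (auto simp: less_Suc_eq_le div_le_mono)
    ultimately show "j \<in> (\<Union>s<W. (\<lambda>k. k * W + s) ` {k\<in>{..<n div W + 1}. S (k * W + s)})"
      by (intro UN_I[of "j mod W"] image_eqI[of _ _ "j div W"]) auto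
  qed
  then have "card {j\<in>{..<n}. S j} \<le> card (\<Union>s<W. (\<lambda>k. k * W + s) ` {k\<in>{..<n div W + 1}. S (k * W + s)})"
    by (intro card_mono) auto
  also have "\<dots> \<le> (\<Sum>s<W. card ((\<lambda>k. k * W + s) ` {k\<in>{..<n div W + 1}. S (k * W + s)}))"
    by (rule card_UN_le) simp
  also have "\<dots> \<le> (\<Sum>s<W. card {k\<in>{..<n div W + 1}. S (k * W + s)})"
    by (intro sum_mono card_image_le) auto
  finally have "t \<le> (\<Sum>s<W. real (card {k\<in>{..<n div W + 1}. S (k * W + s)}))"
    using many by (simp flip: of_nat_sum)
  also have "\<dots> < (\<Sum>s<W. t / real W)" using W less by (intro sum_strict_mono) (auto simp: lessThan_empty_iff)
  also have "\<dots> = t" using W by simp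
  finally show False by simp
qed

text \<open>For \<open>n \<ge> W\<close> there are at most \<open>2 n / W\<close> blocks, so density
  \<open>\<kappa>\<close> among times leaves density \<open>\<kappa> / 2\<close> among the blocks of
  some residue class; hence the exponent \<open>- 2 / \<kappa>\<close>. The smallness condition does
  not involve \<open>W\<close>, so the event may be approximated with as many coordinates as
  necessary.\<close>

lemma gibbs_count:
  fixes Q :: "'a::finite \<Rightarrow> 'a \<Rightarrow> bool"
  assumes \<mu>: "gibbs_measure Q \<phi> \<mu>" and P: "depends_on_first W P" and W: "W \<ge> 1"
    and K: "K \<ge> 1" "\<And>as bs. measure \<mu> (cylinder Q (as @ bs)) \<le> K * (measure \<mu> (cylinder Q as) * measure \<mu> (cylinder Q bs))"
    and \<kappa>: "\<kappa> > 0" and small: "measure \<mu> {x\<in>sft Q. P x} \<le> (4 * K) powr (- 2 / \<kappa>)"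
  shows "\<exists>A. (\<forall>n. A n \<in> sets \<mu>) \<and> exp_small (\<lambda>n. measure \<mu> (A n)) \<and>
    (\<forall>n. \<forall>x\<in>sft Q. real (card {j\<in>{..<n}. P (shift_pow (int j) x)}) \<ge> \<kappa> * real n \<longrightarrow> x \<in> A n)"
proof -
  interpret prob_space \<mu> by (rule gibbs_prob_space[OF \<mu>])
  note sp = gibbs_space[OF \<mu>]
  have "\<exists>A. A \<in> sets \<mu> \<and> measure \<mu> A \<le> (1 / 2) ^ m \<and>
    (\<forall>x\<in>sft Q. real (card {k\<in>{..<m}. P (shift_pow (int (k * W)) x)}) \<ge> \<kappa> / 2 * real m \<longrightarrow> x \<in> A)" for m
    using gibbs_block_count[OF \<mu> P K, of "\<kappa> / 2" m] \<kappa> small by (simp add: Bex_def)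
  then have "\<exists>A. \<forall>m. A m \<in> sets \<mu> \<and> measure \<mu> (A m) \<le> (1 / 2) ^ m \<and>
    (\<forall>x\<in>sft Q. real (card {k\<in>{..<m}. P (shift_pow (int (k * W)) x)}) \<ge> \<kappa> / 2 * real m \<longrightarrow> x \<in> A m)"
    by (intro choice) blast
  then obtain A where A: "\<And>m. A m \<in> sets \<mu>" "\<And>m. measure \<mu> (A m) \<le> (1 / 2) ^ m"
    "\<And>m x. x \<in> sft Q \<Longrightarrow> real (card {k\<in>{..<m}. P (shift_pow (int (k * W)) x)}) \<ge> \<kappa> / 2 * real m \<Longrightarrow> x \<in> A m"
    by blast
  define Y where "Y n = (\<Union>s<W. shift_pow (int s) -` A (n div W + 1) \<inter> space \<mu>)" for n
  \<comment> \<open>For \<open>n < W\<close> there may be no complete block; these finitely many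
    \<open>n\<close> only affect the constant.\<close>
  define Z where "Z n = (if n < W then space \<mu> else Y n)" for n
  have pre: "shift_pow k -` A m \<inter> space \<mu> \<in> sets \<mu>" for k m
    using measurable_sets[OF gibbs_shift_measurable[OF \<mu>] A(1)] .
  have "Y n \<in> sets \<mu>" for n unfolding Y_def by (intro sets.finite_UN pre) simp
  then have "Z n \<in> sets \<mu>" for n by (simp add: Z_def)
  moreover have "exp_small (\<lambda>n. measure \<mu> (Z n))"
  proof (rule exp_small_eventually[of "\<lambda>n. real W * exp (- (ln 2 / real W) * real n)" W])
    show "exp_small (\<lambda>n. real W * exp (- (ln 2 / real W) * real n))"
      using W by (intro exp_smallI[of "ln 2 / real W" _ "real W"]) auto
    fix n assume n: "W \<le> n"
    have "measure \<mu> (Z n) \<le> (\<Sum>s<W. measure \<mu> (shift_pow (int s) -` A (n div W + 1) \<inter> space \<mu>))"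
    proof -
      have "measure \<mu> (Y n) \<le> (\<Sum>s<W. measure \<mu> (shift_pow (int s) -` A (n div W + 1) \<inter> space \<mu>))"
        unfolding Y_def by (rule finite_measure_subadditive_finite) (use pre in blast)+
      then show ?thesis using n by (simp only: Z_def not_less if_not_P)
    qed
    also have "\<dots> = (\<Sum>s<W. measure \<mu> (A (n div W + 1)))"
      by (intro sum.cong refl gibbs_shift_preserving[OF \<mu> A(1)])
    also have "\<dots> \<le> real W * (1 / 2) ^ (n div W + 1)"
      using A(2) by (simp add: mult_left_mono del: power_Suc)
    also have "(1 / 2 :: real) ^ (n div W + 1) = exp (- ln 2 * real (n div W + 1))"
    proof -
      have "exp (real (n div W + 1) * (- ln 2)) = exp (- ln 2 :: real) ^ (n div W + 1)"
        by (rule exp_of_nat_mult)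
      also have "exp (- ln 2 :: real) = 1 / 2" by (simp add: exp_minus)
      finally show ?thesis by (simp only: mult.commute)
    qed
    also have "\<dots> \<le> exp (- (ln 2 / real W) * real n)"
    proof -
      have "n < (n div W + 1) * W" using W by (simp add: dividend_less_div_times)
      then have "real n \<le> real ((n div W + 1) * W)" by (intro of_nat_mono) simp
      then have "real n / real W \<le> real (n div W + 1)" using W by (simp add: field_simps)
      then have "ln 2 * (real n / real W) \<le> ln 2 * real (n div W + 1)" by (intro mult_left_mono) auto
      then show ?thesis by simp
    qed
    finally show "measure \<mu> (Z n) \<le> real W * exp (- (ln 2 / real W) * real n)" by (simp add: mult_left_mono)
  qed (rule prob_le_1)
  moreover have "x \<in> Z n"
    if x: "x \<in> sft Q" and many: "real (card {j\<in>{..<n}. P (shift_pow (int j) x)}) \<ge> \<kappa> * real n" for x n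
  proof (cases "n < W")
    case True
    then show ?thesis using x sp by (simp add: Z_def)
  next
    case False
    obtain s where s: "s < W" "real (card {k\<in>{..<n div W + 1}. P (shift_pow (int (k * W + s)) x)}) \<ge> \<kappa> * real n / real W"
      using residue_class_selection[OF W many] by blast
    have d: "n div W \<ge> 1" using False W by (simp add: Suc_le_eq div_greater_zero_iff)
    have "real (n div W * W) \<le> real n" by (intro of_nat_mono) (rule div_times_less_eq_dividend)
    then have "real (n div W) \<le> real n / real W" using W by (simp add: field_simps)
    moreover have "real 1 \<le> real (n div W)" using d by (rule of_nat_mono)
    ultimately have "real (n div W + 1) / 2 \<le> real n / real W" unfolding of_nat_add by argo
    then have "\<kappa> * (real (n div W + 1) / 2) \<le> \<kappa> * (real n / real W)" using \<kappa> by (intro mult_left_mono) auto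
    then have "\<kappa> / 2 * real (n div W + 1) \<le> \<kappa> * real n / real W" by (simp add: mult.commute)
    also note s(2)
    finally have "\<kappa> / 2 * real (n div W + 1) \<le> real (card {k\<in>{..<n div W + 1}. P (shift_pow (int (k * W)) (shift_pow (int s) x))})"
      by (simp add: shift_pow_add)
    then have "shift_pow (int s) x \<in> A (n div W + 1)" using x by (intro A(3)) auto
    then show ?thesis using False s(1) x sp by (auto simp: Z_def Y_def)
  qed
  ultimately show ?thesis by blast
qed

text \<open>From sums to counts: a visit to \<open>P\<close> contributes at most \<open>B\<close>,
  any other time at most \<open>\<kappa> / 2\<close>, so a large sum requires at least
  \<open>\<kappa> n / (2 B)\<close> visits. The room between \<open>\<kappa> / 4\<close> and
  \<open>\<kappa> / 2\<close> is for the cylinder approximation.\<close>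

lemma gibbs_average:
  fixes Q :: "'a::finite \<Rightarrow> 'a \<Rightarrow> bool" and g :: "(int \<Rightarrow> 'a) \<Rightarrow> real"
  assumes \<mu>: "gibbs_measure Q \<phi> \<mu>"
    and K: "K \<ge> 1" "\<And>as bs. measure \<mu> (cylinder Q (as @ bs)) \<le> K * (measure \<mu> (cylinder Q as) * measure \<mu> (cylinder Q bs))"
    and \<kappa>: "\<kappa> > 0" and g: "continuous_map (sft_topology Q) euclideanreal g"
    and gB: "\<And>x. x \<in> sft Q \<Longrightarrow> g x \<le> B" and B: "B > 0"
    and small: "measure \<mu> {x\<in>sft Q. g x \<ge> \<kappa> / 4} \<le> (4 * K) powr (- 2 / (\<kappa> / (2 * B)))"
  shows "exp_small (\<lambda>n. \<P>(x in \<mu>. (\<Sum>j<n. max 0 (g (shift_pow (int j) x))) \<ge> \<kappa> * real n))"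
proof -
  interpret prob_space \<mu> by (rule gibbs_prob_space[OF \<mu>])
  note sp = gibbs_space[OF \<mu>]
  have \<kappa>': "\<kappa> / 4 < \<kappa> / 2" using \<kappa> by simp
  obtain W :: nat and P where P: "\<And>x y. agree_on {- int W..int W} x y \<Longrightarrow> P x = P y"
    "\<And>x. x \<in> sft Q \<Longrightarrow> g x \<ge> \<kappa> / 2 \<Longrightarrow> P x" "\<And>x. x \<in> sft Q \<Longrightarrow> P x \<Longrightarrow> g x > \<kappa> / 4"
    by (rule clopen_approximation[OF g \<kappa>']) blast
  \<comment> \<open>Cylinders start at coordinate 0, so the two-sided event is moved to the
    coordinates \<open>0, ..., 2 W\<close>; the shift by \<open>- int W\<close> below undoes
    this.\<close>
  define R where "R x = P (shift_pow (int W) x)" for x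
  have dep: "depends_on_first (2 * W + 1) R"
    unfolding depends_on_first_def
  proof (intro allI impI)
    fix x y :: "int \<Rightarrow> 'a" assume xy: "\<forall>j<2 * W + 1. x (int j) = y (int j)"
    have "agree_on {- int W..int W} (shift_pow (int W) x) (shift_pow (int W) y)"
      unfolding agree_on_def
    proof
      fix i assume "i \<in> {- int W..int W}"
      then have "nat (i + int W) < 2 * W + 1" "int (nat (i + int W)) = i + int W" by auto
      then show "shift_pow (int W) x i = shift_pow (int W) y i"
        using xy by (metis shift_pow_def)
    qed
    then show "R x = R y" unfolding R_def by (rule P(1))
  qed
  have gm: "{x\<in>sft Q. g x \<ge> \<kappa> / 4} \<in> sets \<mu>"
  proof -
    have "g \<in> borel_measurable \<mu>" by (rule gibbs_continuous_measurable[OF \<mu> g])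
    then have "{x\<in>space \<mu>. g x \<ge> \<kappa> / 4} \<in> sets \<mu>" by measurable
    then show ?thesis by (simp add: sp)
  qed
  have "measure \<mu> {x\<in>sft Q. R x} \<le> measure \<mu> (shift_pow (int W) -` {x\<in>sft Q. g x \<ge> \<kappa> / 4} \<inter> space \<mu>)"
  proof (rule finite_measure_mono)
    show "{x\<in>sft Q. R x} \<subseteq> shift_pow (int W) -` {x\<in>sft Q. g x \<ge> \<kappa> / 4} \<inter> space \<mu>"
    proof
      fix x assume "x \<in> {x\<in>sft Q. R x}"
      then show "x \<in> shift_pow (int W) -` {x\<in>sft Q. g x \<ge> \<kappa> / 4} \<inter> space \<mu>"
        using P(3)[of "shift_pow (int W) x"] by (simp add: R_def sp)
    qed
    show "shift_pow (int W) -` {x\<in>sft Q. g x \<ge> \<kappa> / 4} \<inter> space \<mu> \<in> sets \<mu>"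
      by (rule measurable_sets[OF gibbs_shift_measurable[OF \<mu>] gm])
  qed
  also have "\<dots> \<le> (4 * K) powr (- 2 / (\<kappa> / (2 * B)))"
    using small gibbs_shift_preserving[OF \<mu> gm] by simp
  finally have "\<exists>A. (\<forall>n. A n \<in> sets \<mu>) \<and> exp_small (\<lambda>n. measure \<mu> (A n)) \<and>
    (\<forall>n. \<forall>x\<in>sft Q. real (card {j\<in>{..<n}. R (shift_pow (int j) x)}) \<ge> \<kappa> / (2 * B) * real n \<longrightarrow> x \<in> A n)"
    by (intro gibbs_count[OF \<mu> dep _ K]) (use \<kappa> B in auto)
  then obtain A where A: "\<And>n. A n \<in> sets \<mu>" "exp_small (\<lambda>n. measure \<mu> (A n))"
    "\<And>n x. x \<in> sft Q \<Longrightarrow> real (card {j\<in>{..<n}. R (shift_pow (int j) x)}) \<ge> \<kappa> / (2 * B) * real n \<Longrightarrow> x \<in> A n"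
    by blast
  show ?thesis
  proof (rule exp_small_mono[OF A(2)])
    fix n
    have "\<P>(x in \<mu>. (\<Sum>j<n. max 0 (g (shift_pow (int j) x))) \<ge> \<kappa> * real n) \<le>
        measure \<mu> (shift_pow (- int W) -` A n \<inter> space \<mu>)"
    proof (rule finite_measure_mono)
      show "shift_pow (- int W) -` A n \<inter> space \<mu> \<in> sets \<mu>"
        by (rule measurable_sets[OF gibbs_shift_measurable[OF \<mu>] A(1)])
      show "{x\<in>space \<mu>. (\<Sum>j<n. max 0 (g (shift_pow (int j) x))) \<ge> \<kappa> * real n} \<subseteq> shift_pow (- int W) -` A n \<inter> space \<mu>"
      proof
        fix x assume "x \<in> {x\<in>space \<mu>. (\<Sum>j<n. max 0 (g (shift_pow (int j) x))) \<ge> \<kappa> * real n}"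
        then have x: "x \<in> sft Q" "(\<Sum>j<n. max 0 (g (shift_pow (int j) x))) \<ge> \<kappa> * real n" by (auto simp: sp)
        define S where "S = {j\<in>{..<n}. P (shift_pow (int j) x)}"
        have "(\<Sum>j<n. max 0 (g (shift_pow (int j) x))) \<le> (\<Sum>j<n. \<kappa> / 2 + (if j \<in> S then B else 0))"
        proof (intro sum_mono)
          fix j assume j: "j \<in> {..<n}"
          have "g (shift_pow (int j) x) \<le> B" by (rule gB) (simp add: x)
          moreover have "g (shift_pow (int j) x) < \<kappa> / 2" if "j \<notin> S"
            using P(2)[of "shift_pow (int j) x"] x(1) that j by (force simp: S_def)
          ultimately show "max 0 (g (shift_pow (int j) x)) \<le> \<kappa> / 2 + (if j \<in> S then B else 0)"
            using \<kappa> B by auto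
        qed
        also have "\<dots> = \<kappa> / 2 * real n + B * real (card S)"
        proof -
          have "(\<Sum>j<n. if j \<in> S then B else 0) = (\<Sum>j\<in>S. B)"
            by (rule sum.mono_neutral_cong_right) (auto simp: S_def)
          then show ?thesis by (simp add: sum.distrib)
        qed
        finally have "\<kappa> * real n \<le> \<kappa> / 2 * real n + B * real (card S)" using x(2) by simp
        then have "\<kappa> / (2 * B) * real n \<le> real (card S)" using B by (simp add: field_simps)
        moreover have "S = {j\<in>{..<n}. R (shift_pow (int j) (shift_pow (- int W) x))}"
          by (simp add: S_def R_def shift_pow_add)
        ultimately have "shift_pow (- int W) x \<in> A n" using x(1) by (intro A(3)) auto
        then show "x \<in> shift_pow (- int W) -` A n \<inter> space \<mu>" using x(1) sp by simp
      qed
    qed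
    also have "\<dots> = measure \<mu> (A n)" by (rule gibbs_shift_preserving[OF \<mu> A(1)])
    finally show "\<P>(x in \<mu>. (\<Sum>j<n. max 0 (g (shift_pow (int j) x))) \<ge> \<kappa> * real n) \<le> measure \<mu> (A n)" .
  qed
qed

section \<open>Linear cocycles over the shift\<close>

lemma matrix_inv_invertible:
  fixes A :: "real^'d^'d"
  assumes "invertible A"
  shows "A ** matrix_inv A = mat 1" "matrix_inv A ** A = mat 1"
proof -
  have "\<exists>A'. A ** A' = mat 1 \<and> A' ** A = mat 1" using assms by (simp add: invertible_def)
  from someI_ex[OF this] show "A ** matrix_inv A = mat 1" "matrix_inv A ** A = mat 1"
    by (simp_all add: matrix_inv_def)
qed

lemma tendsto_matrix_mult:
  fixes f :: "'x \<Rightarrow> real^'n^'m" and g :: "'x \<Rightarrow> real^'k^'n"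
  assumes "(f \<longlongrightarrow> A) F" "(g \<longlongrightarrow> B) F"
  shows "((\<lambda>x. f x ** g x) \<longlongrightarrow> A ** B) F"
  unfolding matrix_matrix_mult_def
  by (intro vec_tendstoI) (simp, intro tendsto_intros assms)

lemma tendsto_matrix_vector_mult:
  fixes f :: "'x \<Rightarrow> real^'n^'m" and g :: "'x \<Rightarrow> real^'n"
  assumes "(f \<longlongrightarrow> A) F" "(g \<longlongrightarrow> v) F"
  shows "((\<lambda>x. f x *v g x) \<longlongrightarrow> A *v v) F"
  unfolding matrix_vector_mult_def
  by (intro vec_tendstoI) (simp, intro tendsto_intros assms)

lemma tendsto_det:
  fixes f :: "'x \<Rightarrow> real^'n^'n"
  assumes "(f \<longlongrightarrow> A) F"
  shows "((\<lambda>x. det (f x)) \<longlongrightarrow> det A) F"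
  unfolding det_def by (intro tendsto_intros assms)

text \<open>Cramer's rule expresses the inverse by quotients of determinants. Away from invertible
  matrices \<open>matrix_inv\<close> is an arbitrary choice, so invertibility is required along the
  filter and not just at the limit.\<close>

lemma tendsto_matrix_inv:
  fixes f :: "'x \<Rightarrow> real^'n^'n"
  assumes f: "(f \<longlongrightarrow> A) F" and A: "invertible A" and inv: "\<forall>\<^sub>F x in F. invertible (f x)"
  shows "((\<lambda>x. matrix_inv (f x)) \<longlongrightarrow> matrix_inv A) F"
proof -
  define c where "c B = (\<chi> k l. det (\<chi> i j. if j = k then axis l 1 $ i else B $ i $ j) / det B)" for B :: "real^'n^'n"
  have c: "matrix_inv B = c B" if "invertible B" for B
  proof -
    have "det B \<noteq> 0" using that by (simp add: invertible_det_nz)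
    have "matrix_inv B $ k $ l = c B $ k $ l" for k l
    proof -
      have "B *v (matrix_inv B *v axis l 1) = axis l 1"
        by (simp add: matrix_vector_mul_assoc matrix_inv_invertible[OF that])
      then have "matrix_inv B *v axis l 1 = (\<chi> k. det (\<chi> i j. if j = k then axis l 1 $ i else B $ i $ j) / det B)"
        using cramer[OF \<open>det B \<noteq> 0\<close>] by blast
      moreover have "(matrix_inv B *v axis l 1) $ k = matrix_inv B $ k $ l"
        by (simp add: matrix_vector_mult_def axis_def if_distrib cong: if_cong)
      ultimately show ?thesis by (simp add: c_def)
    qed
    then show ?thesis by (simp add: vec_eq_iff)
  qed
  have "((\<lambda>x. c (f x)) \<longlongrightarrow> c A) F"
    unfolding c_def
  proof (intro vec_tendstoI, simp only: vec_lambda_beta, intro tendsto_divide tendsto_det f)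
    fix k l
    show "((\<lambda>x. \<chi> i j. if j = k then axis l 1 $ i else f x $ i $ j) \<longlongrightarrow>
        (\<chi> i j. if j = k then axis l 1 $ i else A $ i $ j)) F"
      by (intro vec_tendstoI) (auto intro!: tendsto_vec_nth f)
    show "det A \<noteq> 0" using A by (simp add: invertible_det_nz)
  qed
  then show ?thesis
    unfolding c[OF A] by (rule Lim_transform_eventually) (use inv in \<open>auto elim!: eventually_mono simp: c\<close>)
qed

lemma invertible_mat_1: "invertible (mat 1 :: real^'d^'d)"
  unfolding invertible_def by (intro exI[of _ "mat 1"]) simp

lemma invertible_matrix_inv:
  fixes A :: "real^'d^'d"
  assumes "invertible A"
  shows "invertible (matrix_inv A)"
  unfolding invertible_def using matrix_inv_invertible[OF assms] by (intro exI[of _ A]) simp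

lemma invertible_mult_nonzero:
  fixes A :: "real^'d^'d" and v :: "real^'d"
  assumes "invertible A" "v \<noteq> 0"
  shows "A *v v \<noteq> 0"
proof
  assume "A *v v = 0"
  then have "matrix_inv A *v (A *v v) = 0" by simp
  then show False using assms by (simp add: matrix_vector_mul_assoc matrix_inv_invertible)
qed

section \<open>The cocycle at integer times and its deviations\<close>

lemma cocycle_fwd_add:
  "cocycle_fwd M (n + m) x = cocycle_fwd M n (shift_pow (int m) x) ** cocycle_fwd M m x"
  by (induction n) (simp_all add: shift_pow_add matrix_mul_assoc)

text \<open>The product over the times \<open>a, ..., b - 1\<close>, written as a forward product
  based at \<open>T^a x\<close>: windows at negative times involve no inverse matrices. In
  applications \<open>\<Lambda>\<close> is the sum of the first \<open>i\<close> exponents.\<close>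

definition log_dev :: "((int \<Rightarrow> 'a) \<Rightarrow> real^'d^'d) \<Rightarrow> nat \<Rightarrow> real \<Rightarrow> int \<Rightarrow> int \<Rightarrow> (int \<Rightarrow> 'a) \<Rightarrow> real" where
  "log_dev M i \<Lambda> a b x = ln (ext_power_norm i (cocycle_fwd M (nat (b - a)) (shift_pow a x))) - real_of_int (b - a) * \<Lambda>"

lemma log_dev_shift: "log_dev M i \<Lambda> a b (shift_pow k x) = log_dev M i \<Lambda> (a + k) (b + k) x"
  by (simp add: log_dev_def shift_pow_add)

context
  fixes Q :: "'a::finite \<Rightarrow> 'a \<Rightarrow> bool" and M :: "(int \<Rightarrow> 'a) \<Rightarrow> real^'d^'d"
  assumes cl: "continuous_linear_cocycle Q M"
begin

lemma invertible_cocycle_base: "x \<in> sft Q \<Longrightarrow> invertible (M x)"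
  using cl by (simp add: continuous_linear_cocycle_def)

lemma invertible_cocycle_fwd: "x \<in> sft Q \<Longrightarrow> invertible (cocycle_fwd M n x)"
  by (induction n) (auto intro!: invertible_mult invertible_mat_1 invertible_cocycle_base)

lemma invertible_cocycle_bwd: "x \<in> sft Q \<Longrightarrow> invertible (cocycle_bwd M n x)"
  by (induction n) (auto intro!: invertible_mult invertible_mat_1 invertible_matrix_inv invertible_cocycle_base simp del: of_nat_Suc)

lemma invertible_cocycle: "x \<in> sft Q \<Longrightarrow> invertible (cocycle M n x)"
  by (simp add: cocycle_def invertible_cocycle_fwd invertible_cocycle_bwd)

lemma cocycle_step:
  assumes "x \<in> sft Q"
  shows "cocycle M (n + 1) x = M (shift_pow n x) ** cocycle M n x"
proof (cases "n \<ge> 0")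
  case True
  then have "nat (n + 1) = Suc (nat n)" by simp
  then show ?thesis using True by (simp add: cocycle_def)
next
  case False
  \<comment> \<open>At a negative time the outermost factor of \<open>cocycle_bwd\<close> is the
    inverse of the matrix applied next, and the two cancel.\<close>
  define k where "k = nat (- n - 1)"
  have n: "n = - int (Suc k)" using False by (simp add: k_def)
  have "M (shift_pow n x) ** cocycle M n x = (M (shift_pow n x) ** matrix_inv (M (shift_pow n x))) ** cocycle_bwd M k x"
    unfolding matrix_mul_assoc[symmetric] by (simp add: cocycle_def n nat_add_distrib del: of_nat_Suc)
  also have "\<dots> = cocycle_bwd M k x"
    using assms by (simp add: matrix_inv_invertible invertible_cocycle_base)
  also have "\<dots> = cocycle M (n + 1) x"
  proof -
    have "n + 1 = - int k" using n by simp
    then show ?thesis by (cases "k = 0") (simp_all add: cocycle_def)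
  qed
  finally show ?thesis by simp
qed

text \<open>Since \<open>p\<close> may be negative, the images of a vector at any two integer times
  are related by a forward product.\<close>

lemma cocycle_add:
  assumes "x \<in> sft Q"
  shows "cocycle M (p + int m) x = cocycle_fwd M m (shift_pow p x) ** cocycle M p x"
proof (induction m)
  case (Suc m)
  have "cocycle M (p + int (Suc m)) x = M (shift_pow (p + int m) x) ** cocycle M (p + int m) x"
    using cocycle_step[OF assms, of "p + int m"] by (simp add: algebra_simps)
  then show ?case by (simp add: Suc shift_pow_add matrix_mul_assoc add.commute)
qed simp

lemma cocycle_0: "cocycle M 0 x = mat 1"
  by (simp add: cocycle_def)

lemma continuous_cocycle_shift: "continuous_map (sft_topology Q) euclidean (\<lambda>x. M (shift_pow k x))"
  using continuous_map_compose[OF continuous_map_shift_pow, of Q euclidean M k] cl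
  by (simp add: continuous_linear_cocycle_def comp_def)

lemma continuous_cocycle_fwd: "continuous_map (sft_topology Q) euclidean (cocycle_fwd M n)"
proof (induction n)
  case (Suc n)
  then show ?case
    using continuous_cocycle_shift[of "int n"] by (auto simp: continuous_map_atin intro!: tendsto_matrix_mult)
qed (simp add: continuous_map_atin)

lemma continuous_cocycle_bwd: "continuous_map (sft_topology Q) euclidean (cocycle_bwd M n)"
proof (induction n)
  case (Suc n)
  have "((\<lambda>x. matrix_inv (M (shift_pow k x))) \<longlongrightarrow> matrix_inv (M (shift_pow k x))) (atin (sft_topology Q) x)"
    if x: "x \<in> sft Q" for x k
  proof (rule tendsto_matrix_inv)
    show "((\<lambda>x. M (shift_pow k x)) \<longlongrightarrow> M (shift_pow k x)) (atin (sft_topology Q) x)"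
      using continuous_cocycle_shift[of k] x by (simp add: continuous_map_atin)
    show "invertible (M (shift_pow k x))" using x by (simp add: invertible_cocycle_base)
    show "\<forall>\<^sub>F y in atin (sft_topology Q) x. invertible (M (shift_pow k y))"
      unfolding eventually_atin
      by (intro disjI2 exI[of _ "sft Q"]) (auto simp: x invertible_cocycle_base intro: openin_topspace[of "sft_topology Q", simplified])
  qed
  then show ?case
    using Suc by (auto simp: continuous_map_atin intro!: tendsto_matrix_mult simp del: of_nat_Suc)
qed (simp add: continuous_map_atin)

lemma continuous_cocycle: "continuous_map (sft_topology Q) euclidean (cocycle M n)"
  unfolding cocycle_def[abs_def] by (cases "n \<ge> 0") (simp_all add: continuous_cocycle_fwd continuous_cocycle_bwd)

lemma ext_power_cocycle_pos:
  "i \<le> CARD('d) \<Longrightarrow> x \<in> sft Q \<Longrightarrow> ext_power_norm i (cocycle_fwd M n x) > 0"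
  by (simp add: ext_power_norm_pos invertible_cocycle_fwd)

lemma continuous_ext_power_cocycle:
  "continuous_map (sft_topology Q) euclideanreal (\<lambda>x. ext_power_norm i (cocycle_fwd M n x))"
proof -
  have "continuous_map euclidean euclideanreal (ext_power_norm i :: real^'d^'d \<Rightarrow> real)"
    using continuous_on_ext_power_norm by (simp add: continuous_map_iff_continuous2)
  from continuous_map_compose[OF continuous_cocycle_fwd this] show ?thesis by (simp add: comp_def)
qed

lemma continuous_log_dev:
  assumes "i \<le> CARD('d)"
  shows "continuous_map (sft_topology Q) euclideanreal (log_dev M i \<Lambda> a b)"
proof -
  have "continuous_map (sft_topology Q) euclideanreal (\<lambda>x. ln (ext_power_norm i (cocycle_fwd M n x)))" for n
    using continuous_ext_power_cocycle[of i n] ext_power_cocycle_pos[OF assms, of _ n]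
    by (auto simp: continuous_map_atin intro!: tendsto_ln) (metis less_irrefl)
  from continuous_map_compose[OF continuous_map_shift_pow this]
  have "continuous_map (sft_topology Q) euclideanreal (\<lambda>x. ln (ext_power_norm i (cocycle_fwd M (nat (b - a)) (shift_pow a x))))"
    by (simp add: comp_def)
  then show ?thesis
    unfolding log_dev_def by (intro continuous_map_diff) auto
qed

lemma log_dev_sub:
  assumes i: "i \<le> CARD('d)" and x: "x \<in> sft Q" and "a \<le> b" "b \<le> c"
  shows "log_dev M i \<Lambda> a c x \<le> log_dev M i \<Lambda> a b x + log_dev M i \<Lambda> b c x"
proof -
  have n: "nat (c - a) = nat (c - b) + nat (b - a)" using assms by simp
  have s: "shift_pow (int (nat (b - a))) (shift_pow a x) = shift_pow b x"
    using assms by (simp add: shift_pow_add)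
  have "ext_power_norm i (cocycle_fwd M (nat (c - a)) (shift_pow a x)) \<le>
     ext_power_norm i (cocycle_fwd M (nat (c - b)) (shift_pow b x)) * ext_power_norm i (cocycle_fwd M (nat (b - a)) (shift_pow a x))"
    unfolding n cocycle_fwd_add s by (rule ext_power_norm_mult)
  then have "ln (ext_power_norm i (cocycle_fwd M (nat (c - a)) (shift_pow a x))) \<le>
     ln (ext_power_norm i (cocycle_fwd M (nat (c - b)) (shift_pow b x)) * ext_power_norm i (cocycle_fwd M (nat (b - a)) (shift_pow a x)))"
    using i x by (intro ln_mono) (auto simp: ext_power_cocycle_pos)
  also have "\<dots> = ln (ext_power_norm i (cocycle_fwd M (nat (c - b)) (shift_pow b x))) + ln (ext_power_norm i (cocycle_fwd M (nat (b - a)) (shift_pow a x)))"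
  proof (rule ln_mult_pos)
    show "ext_power_norm i (cocycle_fwd M (nat (c - b)) (shift_pow b x)) > 0"
      "ext_power_norm i (cocycle_fwd M (nat (b - a)) (shift_pow a x)) > 0"
      using i x by (auto intro!: ext_power_cocycle_pos)
  qed
  finally show ?thesis by (simp add: log_dev_def left_diff_distrib)
qed

text \<open>Compactness bounds a single step; subadditivity adds the steps up.\<close>

lemma log_dev_upper:
  assumes i: "i \<le> CARD('d)"
  shows "\<exists>B>0. \<forall>x\<in>sft Q. \<forall>a b. a \<le> b \<longrightarrow> log_dev M i \<Lambda> a b x \<le> B * real_of_int (b - a)"
proof -
  have "compactin (sft_topology Q) (sft Q)"
    using compact_space_sft[of Q] by (simp add: compact_space_def)
  then have "compactin euclideanreal (log_dev M i \<Lambda> 0 1 ` sft Q)"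
    using image_compactin continuous_log_dev[OF i] by blast
  then have "bounded (log_dev M i \<Lambda> 0 1 ` sft Q)" by (simp add: compact_imp_bounded)
  then obtain b where b: "b > 0" "\<And>x. x \<in> sft Q \<Longrightarrow> norm (log_dev M i \<Lambda> 0 1 x) \<le> b"
    unfolding bounded_pos by blast
  define B where "B = b"
  have B: "B > 0" "log_dev M i \<Lambda> 0 1 x \<le> B" if "x \<in> sft Q" for x
    using b that unfolding B_def by (simp_all add: abs_le_iff)
  have "log_dev M i \<Lambda> a (a + int n) x \<le> B * real n" if x: "x \<in> sft Q" for a n x
  proof (induction n)
    case 0
    have "ext_power_norm i (cocycle_fwd M 0 (shift_pow a x)) = 1"
      using ext_power_norm_mat_1[OF i] by simp
    then show ?case by (simp add: log_dev_def)
  next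
    case (Suc n)
    have "log_dev M i \<Lambda> a (a + int (Suc n)) x \<le> log_dev M i \<Lambda> a (a + int n) x + log_dev M i \<Lambda> (a + int n) (a + int (Suc n)) x"
      by (intro log_dev_sub i x) auto
    also have "log_dev M i \<Lambda> (a + int n) (a + int (Suc n)) x = log_dev M i \<Lambda> 0 1 (shift_pow (a + int n) x)"
      by (simp add: log_dev_shift algebra_simps)
    also have "\<dots> \<le> B" using x by (intro B) simp
    finally show ?case using Suc by (simp add: algebra_simps)
  qed
  note up = this
  have "log_dev M i \<Lambda> a b' x \<le> B * real_of_int (b' - a)" if "x \<in> sft Q" "a \<le> b'" for a b' x
    using up[OF that(1), of a "nat (b' - a)"] that(2) by simp
  then show ?thesis using b(1) unfolding B_def by blast
qed

text \<open>Only \<open>average_dev\<close> requires work. The deviation over \<open>N\<close> steps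
  divided by \<open>N\<close> is a continuous function to which \<open>gibbs_average\<close>
  applies, once large deviations have made its exceedance rare enough.\<close>

lemma log_dev_subadditive_cocycle:
  assumes \<mu>: "gibbs_measure Q \<phi> \<mu>" and ld: "exp_large_deviations_pos \<mu> M lam" and i: "i \<in> {1..CARD('d)}"
  shows "\<exists>B. subadditive_cocycle \<mu> shift_pow (log_dev M i (\<Sum>k=1..i. lam k)) B"
proof -
  define \<Lambda> where "\<Lambda> = (\<Sum>k=1..i. lam k)"
  have i': "i \<le> CARD('d)" using i by simp
  note sp = gibbs_space[OF \<mu>]
  interpret prob_space \<mu> by (rule gibbs_prob_space[OF \<mu>])
  obtain B where B: "B > 0" "\<And>x a b. x \<in> sft Q \<Longrightarrow> a \<le> b \<Longrightarrow> log_dev M i \<Lambda> a b x \<le> B * real_of_int (b - a)"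
    using log_dev_upper[OF i'] by blast
  obtain K where K: "K \<ge> 1"
    "\<And>as bs. measure \<mu> (cylinder Q (as @ bs)) \<le> K * (measure \<mu> (cylinder Q as) * measure \<mu> (cylinder Q bs))"
    by (rule gibbs_quasi_Bernoulli[OF \<mu>]) blast
  have meas: "log_dev M i \<Lambda> a b \<in> borel_measurable \<mu>" for a b
    by (rule gibbs_continuous_measurable[OF \<mu> continuous_log_dev[OF i']])
  have dev0: "log_dev M i \<Lambda> 0 (int n) x = ln (ext_power_norm i (cocycle M (int n) x)) - real n * \<Lambda>" for n x
    by (simp add: log_dev_def cocycle_def)
  have large: "exp_small (\<lambda>n. \<P>(x in \<mu>. \<bar>log_dev M i \<Lambda> 0 (int n) x\<bar> \<ge> \<eta> * real n))" if "\<eta> > 0" for \<eta>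
    unfolding dev0 using ld i that
    unfolding exp_large_deviations_pos_def exp_small_def \<Lambda>_def by (simp add: mult.commute)
  have average: "\<exists>N\<ge>1. exp_small (\<lambda>n. measure \<mu> {x\<in>space \<mu>.
          (\<Sum>j<n. max 0 (log_dev M i \<Lambda> (int j) (int j + int N) x)) \<ge> \<kappa> * real N * real n})" if \<kappa>: "\<kappa> > 0" for \<kappa>
  proof -
    \<comment> \<open>After division by \<open>N\<close> the upper bound \<open>B\<close> is the
      same for every \<open>N\<close>, so this target probability is fixed before \<open>N\<close>
      is chosen.\<close>
    define p where "p = (4 * K) powr (- 2 / (\<kappa> / (2 * B)))"
    have p: "p > 0" using K by (simp add: p_def)
    have "exp_small (\<lambda>n. \<P>(x in \<mu>. \<bar>log_dev M i \<Lambda> 0 (int n) x\<bar> \<ge> \<kappa> / 4 * real n))"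
      using \<kappa> by (intro large) simp
    then obtain K' c where c: "K' > 0" "c > 0"
      "\<And>n. \<P>(x in \<mu>. \<bar>log_dev M i \<Lambda> 0 (int n) x\<bar> \<ge> \<kappa> / 4 * real n) \<le> K' * exp (- c * real n)"
      by (rule exp_smallE) blast
    define N where "N = nat \<lceil>ln (K' / p) / c\<rceil> + 1"
    have N: "N \<ge> 1" "real N \<ge> ln (K' / p) / c" by (simp_all add: N_def) linarith
    have "K' * exp (- c * real N) \<le> p"
    proof -
      have "ln (K' / p) \<le> c * real N" using N(2) c(2) by (simp add: field_simps)
      then have "exp (- c * real N) \<le> exp (- ln (K' / p))" by simp
      also have "\<dots> = p / K'" using c p by (simp add: exp_minus)
      finally show ?thesis using c by (simp add: field_simps)
    qed
    with c(3)[of N] have small: "\<P>(x in \<mu>. \<bar>log_dev M i \<Lambda> 0 (int N) x\<bar> \<ge> \<kappa> / 4 * real N) \<le> p" by linarith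
    define g where "g x = log_dev M i \<Lambda> 0 (int N) x / real N" for x
    have gc: "continuous_map (sft_topology Q) euclideanreal g"
      unfolding g_def using N(1) by (intro continuous_map_real_divide continuous_log_dev[OF i']) auto
    have gB: "g x \<le> B" if "x \<in> sft Q" for x
      using B(2)[OF that, of 0 "int N"] N(1) by (simp add: g_def field_simps)
    have "exp_small (\<lambda>n. \<P>(x in \<mu>. (\<Sum>j<n. max 0 (g (shift_pow (int j) x))) \<ge> \<kappa> * real n))"
    proof (rule gibbs_average[OF \<mu> K \<kappa> gc gB B(1)])
      have "measure \<mu> {x\<in>sft Q. g x \<ge> \<kappa> / 4} \<le> \<P>(x in \<mu>. \<bar>log_dev M i \<Lambda> 0 (int N) x\<bar> \<ge> \<kappa> / 4 * real N)"
      proof (rule finite_measure_mono)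
        show "{x\<in>space \<mu>. \<bar>log_dev M i \<Lambda> 0 (int N) x\<bar> \<ge> \<kappa> / 4 * real N} \<in> sets \<mu>"
          using meas[of 0 "int N"] by measurable
        show "{x\<in>sft Q. g x \<ge> \<kappa> / 4} \<subseteq> {x\<in>space \<mu>. \<bar>log_dev M i \<Lambda> 0 (int N) x\<bar> \<ge> \<kappa> / 4 * real N}"
        proof clarify
          fix x assume "x \<in> sft Q" "\<kappa> / 4 \<le> g x"
          then have "\<kappa> / 4 * real N \<le> log_dev M i \<Lambda> 0 (int N) x" using N(1) by (simp add: g_def field_simps)
          then show "x \<in> space \<mu> \<and> \<kappa> / 4 * real N \<le> \<bar>log_dev M i \<Lambda> 0 (int N) x\<bar>" using \<open>x \<in> sft Q\<close> sp by simp
        qed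
      qed
      also note small
      finally show "measure \<mu> {x\<in>sft Q. g x \<ge> \<kappa> / 4} \<le> (4 * K) powr (- 2 / (\<kappa> / (2 * B)))" by (simp add: p_def)
    qed simp
    moreover have "(\<kappa> * real N * real n \<le> (\<Sum>j<n. max 0 (log_dev M i \<Lambda> (int j) (int j + int N) x))) \<longleftrightarrow>
        (\<kappa> * real n \<le> (\<Sum>j<n. max 0 (g (shift_pow (int j) x))))" for x n
    proof -
      have "max 0 (log_dev M i \<Lambda> (int j) (int j + int N) x) = real N * max 0 (g (shift_pow (int j) x))" for j
        using N(1) by (simp add: g_def log_dev_shift max_def add.commute field_simps)
      then have "(\<Sum>j<n. max 0 (log_dev M i \<Lambda> (int j) (int j + int N) x)) = real N * (\<Sum>j<n. max 0 (g (shift_pow (int j) x)))"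
        by (simp add: sum_distrib_left)
      moreover have "\<kappa> * real N * real n = real N * (\<kappa> * real n)" by simp
      ultimately show ?thesis using N(1) by (simp only: mult_le_cancel_left_pos of_nat_0_less_iff)
    qed
    ultimately show ?thesis using N(1) by auto
  qed
  have "subadditive_cocycle \<mu> shift_pow (log_dev M i \<Lambda>) B"
  proof
    show "shift_pow k \<in> measurable \<mu> \<mu>" for k by (rule gibbs_shift_measurable[OF \<mu>])
    show "A \<in> sets \<mu> \<Longrightarrow> measure \<mu> (shift_pow k -` A \<inter> space \<mu>) = measure \<mu> A" for A k
      by (rule gibbs_shift_preserving[OF \<mu>])
    show "x \<in> space \<mu> \<Longrightarrow> a \<le> b \<Longrightarrow> b \<le> c \<Longrightarrow> log_dev M i \<Lambda> a c x \<le> log_dev M i \<Lambda> a b x + log_dev M i \<Lambda> b c x" for a b c x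
      using log_dev_sub[OF i'] sp by simp
  qed (use B meas large average sp log_dev_shift in auto)
  then show ?thesis by (auto simp: \<Lambda>_def)
qed

end

section \<open>Bounds on the Pesin function\<close>

abbreviation lyapunov_dev :: "((int \<Rightarrow> 'a) \<Rightarrow> real^'d^'d) \<Rightarrow> (nat \<Rightarrow> real) \<Rightarrow> nat \<Rightarrow> int \<Rightarrow> int \<Rightarrow> (int \<Rightarrow> 'a) \<Rightarrow> real" where
  "lyapunov_dev M lam i \<equiv> log_dev M i (\<Sum>k=1..i. lam k)"

definition regular :: "((int \<Rightarrow> 'a) \<Rightarrow> real^'d^'d) \<Rightarrow> (nat \<Rightarrow> real) \<Rightarrow> real \<Rightarrow> nat \<Rightarrow> (int \<Rightarrow> 'a) \<Rightarrow> bool" where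
  "regular M lam \<eta> L x \<longleftrightarrow> (\<forall>i\<in>{1..CARD('d)}. good (lyapunov_dev M lam i) \<eta> L x)"

text \<open>A common upper bound for all gaps, the \<open>G\<close> of
  \<open>growth_two_sided\<close>. It enters the constant because the jump length \<open>t\<close>
  there is rounded to an integer.\<close>

definition gap_bound :: "nat \<Rightarrow> (nat \<Rightarrow> real) \<Rightarrow> real" where
  "gap_bound d lam = (\<Sum>k\<in>{1..<d}. \<bar>lam k - lam (Suc k)\<bar>)"

definition pesin_const :: "nat \<Rightarrow> (nat \<Rightarrow> real) \<Rightarrow> real" where
  "pesin_const d lam = (2 * (real d + 1))\<^sup>2 * exp (gap_bound d lam)"

text \<open>The error per unit of time must be small against every genuine gap, with the constant 24
  of \<open>growth_upper_of_dichotomy\<close>. Equal consecutive exponents impose nothing.\<close>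

definition small_rate :: "nat \<Rightarrow> (nat \<Rightarrow> real) \<Rightarrow> real \<Rightarrow> bool" where
  "small_rate d lam \<eta> \<longleftrightarrow> 0 < \<eta> \<and>
     (\<forall>k\<in>{1..<d}. lam (Suc k) < lam k \<longrightarrow> \<eta> \<le> (lam k - lam (Suc k)) / 24)"

lemma small_rate_exists:
  assumes "e > 0"
  obtains \<eta> where "small_rate d lam \<eta>" "\<eta> \<le> e"
proof -
  define S where "S = insert e ((\<lambda>k. (lam k - lam (Suc k)) / 24) ` {k\<in>{1..<d}. lam (Suc k) < lam k})"
  have S: "finite S" "S \<noteq> {}" by (auto simp: S_def)
  have "Min S > 0" using S assms by (subst Min_gr_iff) (auto simp: S_def)
  moreover have "Min S \<le> (lam k - lam (Suc k)) / 24" if "k \<in> {1..<d}" "lam (Suc k) < lam k" for k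
    using that by (intro Min_le S) (auto simp: S_def)
  moreover have "Min S \<le> e" by (intro Min_le S) (auto simp: S_def)
  ultimately show thesis using that[of "Min S"] unfolding small_rate_def by blast
qed

lemma gap_bound_ge: "k \<in> {1..<d} \<Longrightarrow> lam k - lam (Suc k) \<le> gap_bound d lam"
  unfolding gap_bound_def
  by (rule order_trans[OF abs_ge_self]) (rule member_le_sum[of k "{1..<d}" "\<lambda>k. \<bar>lam k - lam (Suc k)\<bar>"], auto)

text \<open>The abstract growth bound for the orbit of \<open>v\<close>, with exterior norms of
  forward products as \<open>N\<close>. The times \<open>p\<close> and \<open>q\<close> may come in
  either order and have any sign, as the supremum in the Pesin function demands.\<close>

lemma regular_growth:
  fixes M :: "(int \<Rightarrow> 'a::finite) \<Rightarrow> real^'d^'d" and lam :: "nat \<Rightarrow> real" and \<eta> :: real and v :: "real^'d" and p q :: int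
  assumes cl: "continuous_linear_cocycle Q M" and x: "x \<in> sft Q"
    and reg: "regular M lam \<eta> L x" and \<eta>: "small_rate CARD('d) lam \<eta>"
    and dec: "\<And>k. k \<in> {1..<CARD('d)} \<Longrightarrow> lam (Suc k) \<le> lam k"
    and i: "i \<in> distinct_exponent_indices CARD('d) lam"
    and v: "v \<in> oseledets_space M (lam i) x" "v \<noteq> 0"
  shows "norm (cocycle M q x *v v) * exp (- ((q - p) * lam i))
     \<le> pesin_const CARD('d) lam * exp (12 * \<eta> * (real L + \<bar>p\<bar> + \<bar>q\<bar>)) * norm (cocycle M p x *v v)"
proof -
  define w where "w n = cocycle M n x *v v" for n
  define A where "A p q = cocycle_fwd M (nat (q - p)) (shift_pow p x)" for p q
  have w: "w q = A p q *v w p" if "p \<le> q" for p q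
    using cocycle_add[OF cl x, of p "nat (q - p)"] that
    by (simp add: w_def A_def matrix_vector_mul_assoc)
  have AA: "A p r = A q r ** A p q" if "p \<le> q" "q \<le> r" for p q r
  proof -
    have n: "nat (r - p) = nat (r - q) + nat (q - p)" using that by simp
    have s: "shift_pow (int (nat (q - p))) (shift_pow p x) = shift_pow q x"
      using that by (simp add: shift_pow_add)
    show ?thesis unfolding A_def n cocycle_fwd_add s ..
  qed
  have "norm (w q) * exp (- ((q - p) * lam i))
     \<le> (2 * (real CARD('d) + 1))\<^sup>2 * exp (gap_bound CARD('d) lam) * exp (12 * \<eta> * (real L + \<bar>p\<bar> + \<bar>q\<bar>)) * norm (w p)"
  proof (rule growth_two_sided[where a = "\<lambda>n. norm (w n)" and d = "CARD('d)" and N = "\<lambda>k p q. ext_power_norm k (A p q)"])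
    show "norm (w n) > 0" for n
      using invertible_mult_nonzero[OF invertible_cocycle[OF cl x] v(2)] by (simp add: w_def)
  next
    fix k and p q r :: int assume pqr: "p \<le> q" "q \<le> r"
    show "ext_power_norm k (A p r) * norm (w q) \<le> (real k + 1) * ext_power_norm k (A q r) * ext_power_norm (Suc k) (A p q) * norm (w p)
        + real k * norm (w r) * ext_power_norm (k - 1) (A q r) * ext_power_norm k (A p q)"
      using ext_power_norm_growth[of k "A q r" "A p q" "w p"]
      by (simp only: w[OF pqr(1), symmetric] w[OF pqr(2), symmetric] AA[OF pqr, symmetric])
  next
    fix k and p q :: int assume "k \<le> CARD('d)"
    then show "ext_power_norm k (A p q) > 0"
      unfolding A_def by (intro ext_power_cocycle_pos[OF cl]) (auto simp: x)
  next
    fix k and p q :: int assume k: "k \<in> {1..CARD('d)}" and pq: "p \<le> q"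
    have "good (lyapunov_dev M lam k) \<eta> L x" using reg k by (auto simp: regular_def)
    from goodD[OF this pq] show "\<bar>ln (ext_power_norm k (A p q)) - (q - p) * (\<Sum>j=1..k. lam j)\<bar> \<le> \<eta> * (real L + \<bar>p\<bar> + \<bar>q\<bar>)"
      by (simp add: log_dev_def A_def)
  next
    show "((\<lambda>n::int. ln (norm (w n)) / n) \<longlongrightarrow> lam i) at_top" "((\<lambda>n::int. ln (norm (w n)) / n) \<longlongrightarrow> lam i) at_bot"
      using v by (auto simp: oseledets_space_def w_def)
  next
    show "ext_power_norm 0 (A p q) = 1" "ext_power_norm (Suc CARD('d)) (A p q) = 0" for p q
      by (simp_all add: ext_power_norm_0 ext_power_norm_eq_0)
    show "0 \<le> \<eta>" "0 \<le> real L" using \<eta> by (simp_all add: small_rate_def)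
    show "0 \<le> gap_bound CARD('d) lam" unfolding gap_bound_def by (intro sum_nonneg) simp
    show "\<eta> \<le> (lam k - lam (Suc k)) / 24 \<and> lam k - lam (Suc k) \<le> gap_bound CARD('d) lam"
      if "k \<in> {1..<CARD('d)}" "lam (Suc k) < lam k" for k
      using \<eta> that gap_bound_ge[OF that(1)] unfolding small_rate_def by blast
  qed (rule dec i; assumption?)+
  then show ?thesis by (simp add: pesin_const_def w_def)
qed

lemma pesin_const_pos: "pesin_const d lam > 0"
  by (simp add: pesin_const_def add_nonneg_eq_0_iff)

text \<open>With \<open>\<eta> \<le> \<epsilon> / 24\<close> the error
  \<open>12 \<eta> (|m| + |n|)\<close> is cancelled by the weight
  \<open>exp (- (|n| + |m|) \<epsilon> / 2)\<close>, and only the contribution of \<open>L\<close>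
  remains.\<close>

lemma regular_pesin_bound:
  fixes M :: "(int \<Rightarrow> 'a::finite) \<Rightarrow> real^'d^'d" and lam :: "nat \<Rightarrow> real" and \<eta> \<epsilon> :: real
  assumes cl: "continuous_linear_cocycle Q M" and x: "x \<in> sft Q"
    and reg: "regular M lam \<eta> L x" and \<eta>: "small_rate CARD('d) lam \<eta>" "\<eta> \<le> \<epsilon> / 24"
    and dec: "\<And>k. k \<in> {1..<CARD('d)} \<Longrightarrow> lam (Suc k) \<le> lam k"
  shows "pesin_function M lam \<epsilon> x \<le> ennreal (pesin_const CARD('d) lam * exp (12 * \<eta> * real L))"
  unfolding pesin_function_def
proof (intro SUP_least)
  fix i v and mn :: "int \<times> int"
  assume i: "i \<in> distinct_exponent_indices CARD('d) lam" and "v \<in> oseledets_space M (lam i) x - {0}"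
  then have v: "v \<in> oseledets_space M (lam i) x" "v \<noteq> 0" by auto
  obtain m n where mn: "mn = (m, n)" by (cases mn)
  let ?D = "pesin_const CARD('d) lam"
  have pos: "norm (cocycle M m x *v v) > 0"
    using invertible_mult_nonzero[OF invertible_cocycle[OF cl x] v(2)] by simp
  have "12 * \<eta> * (real L + \<bar>m\<bar> + \<bar>n\<bar>) \<le> 12 * \<eta> * real L + of_int (\<bar>n\<bar> + \<bar>m\<bar>) * \<epsilon> / 2"
  proof -
    have "12 * \<eta> * of_int (\<bar>n\<bar> + \<bar>m\<bar>) \<le> 12 * (\<epsilon> / 24) * of_int (\<bar>n\<bar> + \<bar>m\<bar>)"
      using \<eta>(2) by (intro mult_right_mono) auto
    then show ?thesis by (simp add: algebra_simps)
  qed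
  then have e: "exp (12 * \<eta> * (real L + \<bar>m\<bar> + \<bar>n\<bar>)) * exp (- (of_int (\<bar>n\<bar> + \<bar>m\<bar>) * \<epsilon> / 2)) \<le> exp (12 * \<eta> * real L)"
    unfolding mult_exp_exp exp_le_cancel_iff by simp
  have "norm (cocycle M n x *v v) / norm (cocycle M m x *v v) * exp (- (of_int (n - m) * lam i))
      \<le> ?D * exp (12 * \<eta> * (real L + \<bar>m\<bar> + \<bar>n\<bar>))"
    using regular_growth[OF cl x reg \<eta>(1) dec i v, of n m] pos by (simp add: field_simps)
  then have "norm (cocycle M n x *v v) / norm (cocycle M m x *v v) * exp (- (of_int (n - m) * lam i))
          * exp (- (of_int (\<bar>n\<bar> + \<bar>m\<bar>) * \<epsilon> / 2))
      \<le> ?D * exp (12 * \<eta> * (real L + \<bar>m\<bar> + \<bar>n\<bar>)) * exp (- (of_int (\<bar>n\<bar> + \<bar>m\<bar>) * \<epsilon> / 2))"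
    by (intro mult_right_mono) auto
  also have "\<dots> \<le> ?D * exp (12 * \<eta> * real L)"
    using e pesin_const_pos[of "CARD('d)" lam] by (simp only: mult.assoc mult_le_cancel_left_pos)
  finally have "ennreal (norm (cocycle M n x *v v) / norm (cocycle M m x *v v) * exp (- (of_int (n - m) * lam i))
          * exp (- (of_int (\<bar>n\<bar> + \<bar>m\<bar>) * \<epsilon> / 2))) \<le> ennreal (?D * exp (12 * \<eta> * real L))"
    by (rule ennreal_leI)
  then show "(case mn of (m, n) \<Rightarrow> ennreal (norm (cocycle M n x *v v) / norm (cocycle M m x *v v)
       * exp (- (of_int (n - m) * lam i)) * exp (- (of_int (\<bar>n\<bar> + \<bar>m\<bar>) * \<epsilon> / 2))))
     \<le> ennreal (?D * exp (12 * \<eta> * real L))"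
    by (simp add: mn)
qed

section \<open>Measurability of the Pesin function\<close>

text \<open>Projection along a compact factor is a closed map. All conditions must hold for one
  common \<open>v\<close>, so they are intersected in the product before projecting; the index type
  may then be arbitrary.\<close>

lemma closedin_projection:
  fixes f g :: "'j \<Rightarrow> (int \<Rightarrow> 'a) \<Rightarrow> real^'d \<Rightarrow> real"
  assumes f: "\<And>j. continuous_map (prod_topology (sft_topology Q) (top_of_set (sphere 0 1))) euclideanreal (\<lambda>p. f j (fst p) (snd p))"
    and g: "\<And>j. continuous_map (prod_topology (sft_topology Q) (top_of_set (sphere 0 1))) euclideanreal (\<lambda>p. g j (fst p) (snd p))"
  shows "closedin (sft_topology Q) {x\<in>sft Q. \<exists>v\<in>sphere 0 1. \<forall>j. f j x v \<le> g j x v}"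
proof -
  let ?Y = "top_of_set (sphere 0 1 :: (real^'d) set)"
  let ?P = "prod_topology (sft_topology Q) ?Y"
  define F where "F j = {p \<in> topspace ?P. g j (fst p) (snd p) - f j (fst p) (snd p) \<in> {0..}}" for j
  have "closedin ?P (F j)" for j
    unfolding F_def by (rule closedin_continuous_map_preimage[OF continuous_map_diff[OF g f]]) simp
  then have "closedin ?P (topspace ?P \<inter> (\<Inter>j. F j))"
    by (intro closedin_Int closedin_topspace closedin_INT) auto
  moreover have "compact_space ?Y"
    by (intro compact_space_subtopology) simp
  then have "closed_map ?P (sft_topology Q) fst" by (rule closed_map_fst)
  ultimately have "closedin (sft_topology Q) (fst ` (topspace ?P \<inter> (\<Inter>j. F j)))"
    unfolding closed_map_def by blast
  moreover have "fst ` (topspace ?P \<inter> (\<Inter>j. F j)) = {x\<in>sft Q. \<exists>v\<in>sphere 0 1. \<forall>j. f j x v \<le> g j x v}"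
  proof (intro equalityI subsetI)
    fix x assume "x \<in> fst ` (topspace ?P \<inter> (\<Inter>j. F j))"
    then obtain p where p: "p \<in> topspace ?P" "\<And>j. p \<in> F j" "x = fst p" by blast
    then have "x \<in> sft Q" "snd p \<in> sphere 0 1" by auto
    moreover have "f j x (snd p) \<le> g j x (snd p)" for j using p(2)[of j] p(3) by (simp add: F_def)
    ultimately show "x \<in> {x\<in>sft Q. \<exists>v\<in>sphere 0 1. \<forall>j. f j x v \<le> g j x v}" by blast
  next
    fix x assume "x \<in> {x\<in>sft Q. \<exists>v\<in>sphere 0 1. \<forall>j. f j x v \<le> g j x v}"
    then obtain v where v: "x \<in> sft Q" "v \<in> sphere 0 1" "\<And>j. f j x v \<le> g j x v" by blast
    then have "(x, v) \<in> topspace ?P \<inter> (\<Inter>j. F j)" by (simp add: F_def)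
    then show "x \<in> fst ` (topspace ?P \<inter> (\<Inter>j. F j))" by force
  qed
  ultimately show ?thesis by simp
qed

lemma continuous_cocycle_norm:
  fixes M :: "(int \<Rightarrow> 'a::finite) \<Rightarrow> real^'d^'d"
  assumes "continuous_linear_cocycle Q M"
  shows "continuous_map (prod_topology (sft_topology Q) (top_of_set (sphere 0 1))) euclideanreal
     (\<lambda>p. norm (cocycle M n (fst p) *v snd p))"
proof -
  let ?P = "prod_topology (sft_topology Q) (top_of_set (sphere 0 1 :: (real^'d) set))"
  have "continuous_map ?P euclidean (\<lambda>p. cocycle M n (fst p))"
    using continuous_map_compose[OF continuous_map_fst continuous_cocycle[OF assms]] by (simp add: comp_def)
  moreover have "continuous_map ?P euclidean snd"
    using continuous_map_snd continuous_map_in_subtopology by blast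
  ultimately show ?thesis
    by (auto simp: continuous_map_atin intro!: tendsto_norm tendsto_matrix_vector_mult)
qed

text \<open>Allows normalization to the compact unit sphere: the factor \<open>c\<close> contributes
  \<open>ln c / n\<close>, which tends to 0.\<close>

lemma oseledets_scale:
  fixes M :: "(int \<Rightarrow> 'a::finite) \<Rightarrow> real^'d^'d" and v :: "real^'d"
  assumes "continuous_linear_cocycle Q M" "x \<in> sft Q" and v: "v \<in> oseledets_space M l x" "v \<noteq> 0" and c: "c > 0"
  shows "c *\<^sub>R v \<in> oseledets_space M l x"
proof -
  have nz: "norm (cocycle M n x *v v) > 0" for n
    using invertible_mult_nonzero[OF invertible_cocycle[OF assms(1,2)] v(2)] by simp
  have eq: "ln (norm (cocycle M n x *v (c *\<^sub>R v))) / real_of_int n = ln c / real_of_int n + ln (norm (cocycle M n x *v v)) / real_of_int n" for n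
    using c nz[of n] by (simp add: matrix_vector_mult_scaleR ln_mult_pos add_divide_distrib)
  have top: "((\<lambda>n::int. ln c / real_of_int n) \<longlongrightarrow> 0) at_top"
    by (rule real_tendsto_divide_at_top[OF tendsto_const filterlim_real_of_int_at_top])
  have neg: "filterlim (uminus :: int \<Rightarrow> int) at_top at_bot"
    unfolding filterlim_at_top
  proof
    fix Z :: int
    show "\<forall>\<^sub>F n in at_bot. Z \<le> - n"
      using eventually_le_at_bot[of "- Z"] by (rule eventually_mono) simp
  qed
  have bot: "((\<lambda>n::int. ln c / real_of_int n) \<longlongrightarrow> 0) at_bot"
    using tendsto_minus[OF filterlim_compose[OF top neg]] by simp
  show ?thesis
    using v c tendsto_add[OF top, of "\<lambda>n. ln (norm (cocycle M n x *v v)) / real_of_int n" l]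
      tendsto_add[OF bot, of "\<lambda>n. ln (norm (cocycle M n x *v v)) / real_of_int n" l]
    by (auto simp: oseledets_space_def eq)
qed

text \<open>For each slope \<open>1 / (k + 1)\<close> one constant \<open>D k\<close> suffices. With
  constants independent of \<open>x\<close>, these inequalities are closed conditions on
  \<open>(x, v)\<close>, in contrast to the limits.\<close>

lemma oseledetsI:
  fixes v :: "real^'d"
  assumes pos: "\<And>n. norm (cocycle M n x *v v) > 0" and v: "v \<noteq> 0"
    and D: "\<And>k. D k > 0"
    and up: "\<And>k n. norm (cocycle M n x *v v) \<le> D k * exp (real_of_int n * l + real_of_int \<bar>n\<bar> / real (Suc k))"
    and lo: "\<And>k n. exp (real_of_int n * l - real_of_int \<bar>n\<bar> / real (Suc k)) \<le> D k * norm (cocycle M n x *v v)"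
  shows "v \<in> oseledets_space M l x"
proof -
  define h where "h n = ln (norm (cocycle M n x *v v))" for n
  have h: "\<bar>h n - real_of_int n * l\<bar> \<le> \<bar>ln (D k)\<bar> + real_of_int \<bar>n\<bar> / real (Suc k)" for n k
  proof -
    have "h n \<le> ln (D k * exp (real_of_int n * l + real_of_int \<bar>n\<bar> / real (Suc k)))"
      unfolding h_def using pos up by (intro ln_mono) auto
    then have 1: "h n \<le> ln (D k) + (real_of_int n * l + real_of_int \<bar>n\<bar> / real (Suc k))"
      using D[of k] by (simp add: ln_mult_pos)
    have "ln (exp (real_of_int n * l - real_of_int \<bar>n\<bar> / real (Suc k))) \<le> ln (D k * norm (cocycle M n x *v v))"
      using lo by (intro ln_mono) auto
    then have 2: "real_of_int n * l - real_of_int \<bar>n\<bar> / real (Suc k) \<le> ln (D k) + h n"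
      using D[of k] pos[of n] unfolding h_def by (simp add: ln_mult_pos)
    from 1 2 show ?thesis by linarith
  qed
  have close: "\<exists>N. \<forall>n. \<bar>n\<bar> \<ge> N \<longrightarrow> dist (h n / real_of_int n) l < e" if e: "e > 0" for e
  proof -
    obtain k where k: "1 / real (Suc k) < e / 2" using e nat_approx_posE[of "e / 2"] by auto
    \<comment> \<open>Half of \<open>e\<close> pays for the slope \<open>1 / (k + 1)\<close>, the
      other half for \<open>ln (D k) / n\<close>.\<close>
    define N where "N = max 1 (\<lceil>2 * \<bar>ln (D k)\<bar> / e\<rceil> + 1)"
    have "dist (h n / real_of_int n) l < e" if n: "\<bar>n\<bar> \<ge> N" for n
    proof -
      have n1: "n \<noteq> 0" "2 * \<bar>ln (D k)\<bar> / e < real_of_int \<bar>n\<bar>" using n unfolding N_def by linarith+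
      have a: "real_of_int \<bar>n\<bar> > 0" using n1(1) by simp
      have "dist (h n / real_of_int n) l = \<bar>(h n - real_of_int n * l) / real_of_int n\<bar>"
        using n1(1) by (simp add: dist_real_def diff_divide_distrib)
      also have "\<dots> = \<bar>h n - real_of_int n * l\<bar> / real_of_int \<bar>n\<bar>" by simp
      also have "\<dots> \<le> (\<bar>ln (D k)\<bar> + real_of_int \<bar>n\<bar> / real (Suc k)) / real_of_int \<bar>n\<bar>"
        using h a by (intro divide_right_mono) auto
      also have "\<dots> = \<bar>ln (D k)\<bar> / real_of_int \<bar>n\<bar> + 1 / real (Suc k)"
        using a by (simp only: add_divide_distrib) simp
      also have "\<bar>ln (D k)\<bar> / real_of_int \<bar>n\<bar> \<le> e / 2"
        using n1(2) a e by (simp add: field_simps)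
      finally show ?thesis using k by linarith
    qed
    then show ?thesis by blast
  qed
  have "((\<lambda>n. h n / real_of_int n) \<longlongrightarrow> l) at_top"
  proof (rule tendstoI)
    fix e :: real assume "e > 0"
    then obtain N where N: "\<And>n. \<bar>n\<bar> \<ge> N \<Longrightarrow> dist (h n / real_of_int n) l < e" using close by blast
    show "\<forall>\<^sub>F n in at_top. dist (h n / real_of_int n) l < e"
      using eventually_ge_at_top[of N] by (rule eventually_mono) (simp add: N)
  qed
  moreover have "((\<lambda>n. h n / real_of_int n) \<longlongrightarrow> l) at_bot"
  proof (rule tendstoI)
    fix e :: real assume "e > 0"
    then obtain N where N: "\<And>n. \<bar>n\<bar> \<ge> N \<Longrightarrow> dist (h n / real_of_int n) l < e" using close by blast
    show "\<forall>\<^sub>F n in at_bot. dist (h n / real_of_int n) l < e"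
      using eventually_le_at_bot[of "- N"] by (rule eventually_mono) (simp add: N)
  qed
  ultimately show ?thesis using v by (simp add: oseledets_space_def h_def)
qed

text \<open>The strict inequality becomes a countable union over \<open>q\<close> of weak ones, with
  denominators cleared so that both sides are continuous; the ratio is homogeneous of degree 0 in
  \<open>v\<close>, so unit vectors suffice.\<close>

lemma pesin_function_gt_iff:
  fixes M :: "(int \<Rightarrow> 'a::finite) \<Rightarrow> real^'d^'d" and lam :: "nat \<Rightarrow> real" and C \<epsilon> :: real
  assumes cl: "continuous_linear_cocycle Q M" "x \<in> sft Q" and C: "C \<ge> 0"
  shows "pesin_function M lam \<epsilon> x > ennreal C \<longleftrightarrow>
    (\<exists>i\<in>distinct_exponent_indices CARD('d) lam. \<exists>v\<in>sphere 0 1 \<inter> oseledets_space M (lam i) x. \<exists>m n :: int. \<exists>q :: nat.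
      (C + 1 / real (Suc q)) * norm (cocycle M m x *v v) \<le>
        norm (cocycle M n x *v v) * (exp (- (of_int (n - m) * lam i)) * exp (- (of_int (\<bar>n\<bar> + \<bar>m\<bar>) * \<epsilon> / 2))))"
    (is "?L \<longleftrightarrow> ?R")
proof -
  define w where "w i m n = exp (- (of_int (n - m) * lam i)) * exp (- (of_int (\<bar>n\<bar> + \<bar>m\<bar>) * \<epsilon> / 2))" for i and m n :: int
  have nz: "norm (cocycle M n x *v v) > 0" if "v \<noteq> 0" for n v
    using invertible_mult_nonzero[OF invertible_cocycle[OF cl] that] by simp
  have L: "?L \<longleftrightarrow> (\<exists>i\<in>distinct_exponent_indices CARD('d) lam. \<exists>v\<in>oseledets_space M (lam i) x - {0}. \<exists>m n.
      C < norm (cocycle M n x *v v) / norm (cocycle M m x *v v) * w i m n)"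
    unfolding pesin_function_def w_def using C
    by (simp add: less_SUP_iff ennreal_less_iff mult.assoc)
  have ratio: "C < norm (cocycle M n x *v v) / norm (cocycle M m x *v v) * w i m n \<longleftrightarrow>
      (\<exists>q::nat. (C + 1 / real (Suc q)) * norm (cocycle M m x *v v) \<le> norm (cocycle M n x *v v) * w i m n)"
    if v0: "v \<noteq> 0" for v i m n
  proof
    assume "C < norm (cocycle M n x *v v) / norm (cocycle M m x *v v) * w i m n"
    then obtain q where "1 / real (Suc q) < norm (cocycle M n x *v v) / norm (cocycle M m x *v v) * w i m n - C"
      using nat_approx_posE[of "norm (cocycle M n x *v v) / norm (cocycle M m x *v v) * w i m n - C"] by auto
    then have "C + 1 / real (Suc q) \<le> norm (cocycle M n x *v v) * w i m n / norm (cocycle M m x *v v)" by simp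
    then show "\<exists>q::nat. (C + 1 / real (Suc q)) * norm (cocycle M m x *v v) \<le> norm (cocycle M n x *v v) * w i m n"
      using nz[OF v0, of m] by (auto simp: pos_le_divide_eq)
  next
    assume "\<exists>q::nat. (C + 1 / real (Suc q)) * norm (cocycle M m x *v v) \<le> norm (cocycle M n x *v v) * w i m n"
    then obtain q :: nat where "C + 1 / real (Suc q) \<le> norm (cocycle M n x *v v) * w i m n / norm (cocycle M m x *v v)"
      using nz[OF v0, of m] by (auto simp: pos_le_divide_eq)
    moreover have "0 < 1 / real (Suc q)" by simp
    ultimately have "C < norm (cocycle M n x *v v) * w i m n / norm (cocycle M m x *v v)" by linarith
    then show "C < norm (cocycle M n x *v v) / norm (cocycle M m x *v v) * w i m n" by simp
  qed
  have scale: "norm (cocycle M n x *v (v /\<^sub>R norm v)) / norm (cocycle M m x *v (v /\<^sub>R norm v)) = norm (cocycle M n x *v v) / norm (cocycle M m x *v v)"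
    if "v \<noteq> 0" for v and m n
    using that by (simp add: matrix_vector_mult_scaleR)
  show ?thesis
  proof
    assume ?L
    then obtain i v m n where i: "i \<in> distinct_exponent_indices CARD('d) lam" and v: "v \<in> oseledets_space M (lam i) x" "v \<noteq> 0"
      and C': "C < norm (cocycle M n x *v v) / norm (cocycle M m x *v v) * w i m n" unfolding L by blast
    let ?u = "v /\<^sub>R norm v"
    have "?u \<in> sphere 0 1 \<inter> oseledets_space M (lam i) x"
      using v oseledets_scale[OF cl v, of "inverse (norm v)"] by simp
    moreover have "?u \<noteq> 0" using v by simp
    moreover from ratio[OF this] C' have "\<exists>q::nat. (C + 1 / real (Suc q)) * norm (cocycle M m x *v ?u) \<le> norm (cocycle M n x *v ?u) * w i m n"
      unfolding scale[OF v(2)] by blast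
    ultimately show ?R using i unfolding w_def by blast
  next
    assume ?R
    then obtain i v m n q where i: "i \<in> distinct_exponent_indices CARD('d) lam" and v: "v \<in> sphere 0 1" "v \<in> oseledets_space M (lam i) x"
      and C': "(C + 1 / real (Suc q)) * norm (cocycle M m x *v v) \<le> norm (cocycle M n x *v v) * w i m n" unfolding w_def by blast
    have "v \<noteq> 0" using v(1) by auto
    then show ?L unfolding L using i v(2) ratio[OF \<open>v \<noteq> 0\<close>] C' by blast
  qed
qed

lemma exp_small_less:
  assumes "exp_small f" "e > 0"
  shows "\<exists>n. f n < e"
proof -
  obtain K c where f: "K > 0" "c > 0" "\<And>n. f n \<le> K * exp (- c * real n)"
    using assms(1) by (rule exp_smallE) blast
  define n where "n = nat \<lceil>ln (K / e) / c\<rceil> + 1"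
  have "real n > ln (K / e) / c" unfolding n_def by linarith
  then have "ln (K / e) < c * real n" using f(2) by (simp add: field_simps)
  then have "exp (- c * real n) < exp (- ln (K / e))" by simp
  also have "exp (- ln (K / e)) = e / K" using f(1) assms(2) by (simp add: exp_minus)
  finally have "K * exp (- c * real n) < e" using f(1) by (simp add: field_simps)
  with f(3)[of n] show ?thesis by (intro exI[of _ n]) linarith
qed

text \<open>The null part of a completion-measurable set must pull back to a null set, which is
  invariance of \<open>\<mu>\<close>.\<close>

lemma gibbs_completion_shift:
  assumes \<mu>: "gibbs_measure Q \<phi> \<mu>" and A: "A \<in> sets (completion \<mu>)"
  shows "shift_pow k -` A \<inter> space \<mu> \<in> sets (completion \<mu>)"
proof -
  interpret prob_space \<mu> by (rule gibbs_prob_space[OF \<mu>])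
  obtain S N N' where N: "A = S \<union> N" "N \<subseteq> N'" "N' \<in> null_sets \<mu>" "S \<in> sets \<mu>"
    using A by (rule sets_completionE)
  have N': "N' \<in> sets \<mu>" using N(3) by auto
  have pre: "shift_pow k -` B \<inter> space \<mu> \<in> sets \<mu>" if "B \<in> sets \<mu>" for B
    using measurable_sets[OF gibbs_shift_measurable[OF \<mu>] that] .
  have "measure \<mu> (shift_pow k -` N' \<inter> space \<mu>) = 0"
    using gibbs_shift_preserving[OF \<mu> N'] N(3) by (simp add: measure_def null_sets_def)
  then have "shift_pow k -` N' \<inter> space \<mu> \<in> null_sets \<mu>"
    using pre[OF N'] by (simp add: null_sets_def emeasure_eq_measure)
  then show ?thesis
    using N pre by (intro sets_completionI[of _ "shift_pow k -` S \<inter> space \<mu>" "shift_pow k -` N \<inter> space \<mu>" "shift_pow k -` N' \<inter> space \<mu>"]) auto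
qed

section \<open>Measure and frequency of regular points\<close>

lemma regular_meas:
  fixes M :: "(int \<Rightarrow> 'a::finite) \<Rightarrow> real^'d^'d"
  assumes "continuous_linear_cocycle Q M" "gibbs_measure Q \<phi> \<mu>" "exp_large_deviations_pos \<mu> M lam"
  shows "{x\<in>space \<mu>. regular M lam \<eta> L x} \<in> sets \<mu>"
proof -
  have "{x\<in>space \<mu>. good (lyapunov_dev M lam i) \<eta> L x} \<in> sets \<mu>" if "i \<in> {1..CARD('d)}" for i
    using log_dev_subadditive_cocycle[OF assms that] subadditive_cocycle.good_meas by (auto simp: pred_def)
  then have "{x\<in>space \<mu>. \<forall>i\<in>{1..CARD('d)}. good (lyapunov_dev M lam i) \<eta> L x} \<in> sets \<mu>"
    by (intro sets.sets_Collect_finite_All) auto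
  then show ?thesis by (simp add: regular_def)
qed

lemma regular_large:
  fixes M :: "(int \<Rightarrow> 'a::finite) \<Rightarrow> real^'d^'d"
  assumes cl: "continuous_linear_cocycle Q M" and \<mu>: "gibbs_measure Q \<phi> \<mu>"
    and ld: "exp_large_deviations_pos \<mu> M lam" and \<eta>: "\<eta> > 0" and e: "e > 0"
  shows "\<exists>L. \<P>(x in \<mu>. \<not> regular M lam \<eta> L x) < e"
proof -
  interpret prob_space \<mu> by (rule gibbs_prob_space[OF \<mu>])
  define B where "B i L = {x\<in>space \<mu>. \<not> good (lyapunov_dev M lam i) \<eta> L x}" for i L
  have B: "exp_small (\<lambda>L. measure \<mu> (B i L))" "B i L \<in> sets \<mu>" if i: "i \<in> {1..CARD('d)}" for i L
  proof -
    obtain b where sc: "subadditive_cocycle \<mu> shift_pow (lyapunov_dev M lam i) b"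
      using log_dev_subadditive_cocycle[OF cl \<mu> ld i] by blast
    show "exp_small (\<lambda>L. measure \<mu> (B i L))"
      unfolding B_def by (rule subadditive_cocycle.measure_not_good[OF sc \<eta>])
    have "{x\<in>space \<mu>. good (lyapunov_dev M lam i) \<eta> L x} \<in> sets \<mu>"
      using subadditive_cocycle.good_meas[OF sc] by (simp add: pred_def)
    then show "B i L \<in> sets \<mu>" unfolding B_def by (rule sets.sets_Collect_neg)
  qed
  have "exp_small (\<lambda>L. \<Sum>i\<in>{1..CARD('d)}. measure \<mu> (B i L))"
    using B(1) by (intro exp_small_sum) auto
  then obtain L where L: "(\<Sum>i\<in>{1..CARD('d)}. measure \<mu> (B i L)) < e"
    using exp_small_less e by blast
  have "{x\<in>space \<mu>. \<not> regular M lam \<eta> L x} = (\<Union>i\<in>{1..CARD('d)}. B i L)"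
    by (auto simp: regular_def B_def)
  then have "\<P>(x in \<mu>. \<not> regular M lam \<eta> L x) \<le> (\<Sum>i\<in>{1..CARD('d)}. measure \<mu> (B i L))"
    using B(2) by (simp only:) (intro finite_measure_subadditive_finite, auto)
  with L show ?thesis by (intro exI[of _ L]) linarith
qed

text \<open>If a proportion \<open>\<delta>\<close> of the times is irregular, then one of the
  \<open>d\<close> exterior powers is bad for a proportion of at least
  \<open>\<delta> / d\<close>.\<close>

lemma regular_count:
  fixes M :: "(int \<Rightarrow> 'a::finite) \<Rightarrow> real^'d^'d"
  assumes cl: "continuous_linear_cocycle Q M" and \<mu>: "gibbs_measure Q \<phi> \<mu>"
    and ld: "exp_large_deviations_pos \<mu> M lam" and \<eta>: "\<eta> > 0" and \<delta>: "\<delta> > 0"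
  shows "\<exists>L Z. (\<forall>n. Z n \<in> sets \<mu>) \<and> exp_small (\<lambda>n. measure \<mu> (Z n)) \<and>
     (\<forall>x\<in>space \<mu>. \<forall>n. real (card {j\<in>{..<n}. \<not> regular M lam \<eta> L (shift_pow (int j) x)}) \<ge> \<delta> * real n \<longrightarrow> x \<in> Z n)"
proof -
  interpret prob_space \<mu> by (rule gibbs_prob_space[OF \<mu>])
  define d where "d = CARD('d)"
  have d: "d > 0" by (simp add: d_def)
  have "\<forall>i\<in>{1..d}. \<exists>LZ. (\<forall>n. snd LZ n \<in> sets \<mu>) \<and> exp_small (\<lambda>n. measure \<mu> (snd LZ n)) \<and>
     (\<forall>x\<in>space \<mu>. \<forall>n. real (card {j\<in>{..<n}. \<not> good (lyapunov_dev M lam i) \<eta> (fst LZ) (shift_pow (int j) x)}) \<ge> \<delta> / real d * real n \<longrightarrow> x \<in> snd LZ n)"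
  proof
    fix i assume "i \<in> {1..d}"
    then obtain b where sc: "subadditive_cocycle \<mu> shift_pow (lyapunov_dev M lam i) b"
      using log_dev_subadditive_cocycle[OF cl \<mu> ld] unfolding d_def by blast
    have "\<delta> / real d > 0" using \<delta> d by simp
    from subadditive_cocycle.count_not_good[OF sc \<eta> this]
    obtain L Z where "(\<forall>n. Z n \<in> sets \<mu>) \<and> exp_small (\<lambda>n. measure \<mu> (Z n)) \<and>
     (\<forall>x\<in>space \<mu>. \<forall>n. real (card {j\<in>{..<n}. \<not> good (lyapunov_dev M lam i) \<eta> L (shift_pow (int j) x)}) \<ge> \<delta> / real d * real n \<longrightarrow> x \<in> Z n)"
      by blast
    then show "\<exists>LZ. (\<forall>n. snd LZ n \<in> sets \<mu>) \<and> exp_small (\<lambda>n. measure \<mu> (snd LZ n)) \<and>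
     (\<forall>x\<in>space \<mu>. \<forall>n. real (card {j\<in>{..<n}. \<not> good (lyapunov_dev M lam i) \<eta> (fst LZ) (shift_pow (int j) x)}) \<ge> \<delta> / real d * real n \<longrightarrow> x \<in> snd LZ n)"
      by (intro exI[of _ "(L, Z)"]) simp
  qed
  from bchoice[OF this] obtain F where F: "\<And>i n. i \<in> {1..d} \<Longrightarrow> snd (F i) n \<in> sets \<mu>"
    "\<And>i. i \<in> {1..d} \<Longrightarrow> exp_small (\<lambda>n. measure \<mu> (snd (F i) n))"
    "\<And>i x n. i \<in> {1..d} \<Longrightarrow> x \<in> space \<mu> \<Longrightarrow>
       real (card {j\<in>{..<n}. \<not> good (lyapunov_dev M lam i) \<eta> (fst (F i)) (shift_pow (int j) x)}) \<ge> \<delta> / real d * real n \<Longrightarrow> x \<in> snd (F i) n"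
    by blast
  \<comment> \<open>Goodness is monotone in the threshold, so any common upper bound of the finitely
    many thresholds will do; the sum is one.\<close>
  define L where "L = (\<Sum>i\<in>{1..d}. fst (F i))"
  define Z where "Z n = (\<Union>i\<in>{1..d}. snd (F i) n)" for n
  have L: "fst (F i) \<le> L" if "i \<in> {1..d}" for i
    unfolding L_def using that by (intro member_le_sum) auto
  have "Z n \<in> sets \<mu>" for n unfolding Z_def using F(1) by (intro sets.finite_UN) auto
  moreover have "exp_small (\<lambda>n. measure \<mu> (Z n))"
  proof (rule exp_small_mono)
    show "exp_small (\<lambda>n. \<Sum>i\<in>{1..d}. measure \<mu> (snd (F i) n))" using F(2) by (intro exp_small_sum) auto
    show "measure \<mu> (Z n) \<le> (\<Sum>i\<in>{1..d}. measure \<mu> (snd (F i) n))" for n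
      unfolding Z_def using F(1) by (intro finite_measure_subadditive_finite) auto
  qed
  moreover have "x \<in> Z n"
    if x: "x \<in> space \<mu>" and many: "real (card {j\<in>{..<n}. \<not> regular M lam \<eta> L (shift_pow (int j) x)}) \<ge> \<delta> * real n" for x n
  proof (rule ccontr)
    assume "x \<notin> Z n"
    define S where "S i = {j\<in>{..<n}. \<not> good (lyapunov_dev M lam i) \<eta> (fst (F i)) (shift_pow (int j) x)}" for i
    have S: "real (card (S i)) < \<delta> / real d * real n" if "i \<in> {1..d}" for i
      using F(3)[OF that x, of n] \<open>x \<notin> Z n\<close> that unfolding S_def Z_def by fastforce
    have "{j\<in>{..<n}. \<not> regular M lam \<eta> L (shift_pow (int j) x)} \<subseteq> (\<Union>i\<in>{1..d}. S i)"
    proof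
      fix j assume j: "j \<in> {j\<in>{..<n}. \<not> regular M lam \<eta> L (shift_pow (int j) x)}"
      then obtain i where "i \<in> {1..d}" "\<not> good (lyapunov_dev M lam i) \<eta> L (shift_pow (int j) x)"
        by (auto simp: regular_def d_def)
      then have "\<not> good (lyapunov_dev M lam i) \<eta> (fst (F i)) (shift_pow (int j) x)"
        using good_mono[OF _ L[OF \<open>i \<in> {1..d}\<close>], of "lyapunov_dev M lam i" \<eta> "shift_pow (int j) x"] by blast
      then show "j \<in> (\<Union>i\<in>{1..d}. S i)" using j \<open>i \<in> {1..d}\<close> unfolding S_def by blast
    qed
    then have "card {j\<in>{..<n}. \<not> regular M lam \<eta> L (shift_pow (int j) x)} \<le> card (\<Union>i\<in>{1..d}. S i)"
      by (intro card_mono) (auto simp: S_def)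
    also have "\<dots> \<le> (\<Sum>i\<in>{1..d}. card (S i))" by (rule card_UN_le) simp
    finally have "\<delta> * real n \<le> (\<Sum>i\<in>{1..d}. real (card (S i)))"
      using many by (simp flip: of_nat_sum)
    also have "\<dots> < (\<Sum>i\<in>{1..d}. \<delta> / real d * real n)"
      by (rule sum_strict_mono) (use S d in auto)
    also have "\<dots> = \<delta> * real n" using d by simp
    finally show False by simp
  qed
  ultimately show ?thesis by blast
qed

text \<open>Membership in an Oseledets space is defined by limits and is not a closed condition. On
  each set \<open>G r\<close> it becomes closed, because the constants in \<open>char\<close> do not
  depend on the point.\<close>

lemma pesin_level_sets:
  fixes M :: "(int \<Rightarrow> 'a::finite) \<Rightarrow> real^'d^'d" and lam :: "nat \<Rightarrow> real" and C \<epsilon> :: real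
  assumes cl: "continuous_linear_cocycle Q M" and \<mu>: "gibbs_measure Q \<phi> \<mu>"
    and ld: "exp_large_deviations_pos \<mu> M lam" and C: "C \<ge> 0"
    and dec: "\<And>k. k \<in> {1..<CARD('d)} \<Longrightarrow> lam (Suc k) \<le> lam k"
  shows "{x\<in>sft Q. pesin_function M lam \<epsilon> x > ennreal C} \<in> sets (completion \<mu>)"
proof -
  interpret prob_space \<mu> by (rule gibbs_prob_space[OF \<mu>])
  note sp = gibbs_space[OF \<mu>]
  let ?I = "distinct_exponent_indices CARD('d) lam"
  \<comment> \<open>The rate \<open>H k\<close> is chosen so that the error
    \<open>12 H k |n|\<close> of \<open>regular_growth\<close> is at most
    \<open>|n| / (k + 1)\<close>, the slope used in \<open>oseledetsI\<close>.\<close>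
  have "\<exists>\<eta>. small_rate CARD('d) lam \<eta> \<and> \<eta> \<le> 1 / (12 * real (Suc k))" for k
    by (rule small_rate_exists[of "1 / (12 * real (Suc k))" "CARD('d)" lam]) auto
  then have "\<exists>H. \<forall>k. small_rate CARD('d) lam (H k) \<and> H k \<le> 1 / (12 * real (Suc k))"
    by (intro choice) blast
  then obtain H where H: "\<And>k. small_rate CARD('d) lam (H k)" "\<And>k. H k \<le> 1 / (12 * real (Suc k))" by blast
  have Hpos: "H k > 0" for k using H(1)[of k] by (simp add: small_rate_def)
  \<comment> \<open>Summed over \<open>k\<close>, these bounds show that the complement of
    \<open>G r\<close> has measure at most \<open>2 / (r + 1)\<close>.\<close>
  have "\<exists>L. \<P>(x in \<mu>. \<not> regular M lam (H k) L x) < (1 / 2) ^ k / real (Suc r)" for k r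
    by (rule regular_large[OF cl \<mu> ld Hpos]) simp
  then have "\<exists>L. \<forall>kr. \<P>(x in \<mu>. \<not> regular M lam (H (fst kr)) (L kr) x) < (1 / 2) ^ fst kr / real (Suc (snd kr))"
    by (intro choice) blast
  then obtain L0 where L0: "\<And>kr. \<P>(x in \<mu>. \<not> regular M lam (H (fst kr)) (L0 kr) x) < (1 / 2) ^ fst kr / real (Suc (snd kr))"
    by blast
  define L where "L r k = L0 (k, r)" for r k
  have L: "\<P>(x in \<mu>. \<not> regular M lam (H k) (L r k) x) < (1 / 2) ^ k / real (Suc r)" for k r
    using L0[of "(k, r)"] by (simp add: L_def)
  define G where "G r = {x\<in>space \<mu>. \<forall>k. regular M lam (H k) (L r k) x}" for r
  have reg: "{x\<in>space \<mu>. regular M lam (H k) (L r k) x} \<in> sets \<mu>" for k r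
    by (rule regular_meas[OF cl \<mu> ld])
  have G: "G r \<in> sets \<mu>" for r unfolding G_def by (intro sets.sets_Collect_countable_All reg)
  define D where "D r k = pesin_const CARD('d) lam * exp (12 * H k * real (L r k))" for r k
  have Dpos: "D r k > 0" for r k using pesin_const_pos by (simp add: D_def)
  \<comment> \<open>Forwards this is \<open>regular_growth\<close> between the times 0 and
    \<open>n\<close>, in both orders, using \<open>norm v = 1\<close>; backwards it is
    \<open>oseledetsI\<close>.\<close>
  have char: "v \<in> oseledets_space M (lam i) x \<longleftrightarrow>
      (\<forall>k n. norm (cocycle M n x *v v) \<le> D r k * exp (real_of_int n * lam i + real_of_int \<bar>n\<bar> / real (Suc k)) \<and>
             exp (real_of_int n * lam i - real_of_int \<bar>n\<bar> / real (Suc k)) \<le> D r k * norm (cocycle M n x *v v))"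
    (is "_ \<longleftrightarrow> (\<forall>k n. ?up k n \<and> ?lo k n)") if x: "x \<in> G r" and v: "v \<in> sphere 0 1" and i: "i \<in> ?I" for x r v i
  proof
    have xs: "x \<in> sft Q" using x by (simp add: G_def sp)
    have v1: "norm v = 1" "v \<noteq> 0" using v by auto
    {
      assume vo: "v \<in> oseledets_space M (lam i) x"
      show "\<forall>k n. ?up k n \<and> ?lo k n"
      proof (intro allI)
        fix k and n :: int
        have rg: "regular M lam (H k) (L r k) x" using x by (simp add: G_def)
        note gr = regular_growth[OF cl xs rg H(1) dec i vo v1(2)]
        have "12 * H k * real_of_int \<bar>n\<bar> \<le> 12 * (1 / (12 * real (Suc k))) * real_of_int \<bar>n\<bar>"
          using H(2)[of k] by (intro mult_right_mono mult_left_mono) auto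
        also have "12 * (1 / (12 * real (Suc k))) * real_of_int \<bar>n\<bar> = real_of_int \<bar>n\<bar> / real (Suc k)"
          by (simp del: of_nat_Suc)
        finally have n: "12 * H k * real_of_int \<bar>n\<bar> \<le> real_of_int \<bar>n\<bar> / real (Suc k)" .
        have e: "pesin_const CARD('d) lam * exp (12 * H k * (real (L r k) + real_of_int \<bar>n\<bar>)) \<le> D r k * exp (real_of_int \<bar>n\<bar> / real (Suc k))"
          unfolding D_def mult.assoc mult_exp_exp using n pesin_const_pos[of "CARD('d)" lam]
          by (intro mult_left_mono) (simp_all add: algebra_simps)
        have "norm (cocycle M n x *v v) * exp (- (real_of_int n * lam i)) \<le> D r k * exp (real_of_int \<bar>n\<bar> / real (Suc k))"
          using gr[of n 0] e by (simp add: cocycle_0[OF cl] v1)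
        then have "norm (cocycle M n x *v v) * exp (- (real_of_int n * lam i)) * exp (real_of_int n * lam i)
            \<le> D r k * exp (real_of_int \<bar>n\<bar> / real (Suc k)) * exp (real_of_int n * lam i)"
          by (intro mult_right_mono) auto
        then have "?up k n" by (simp add: mult.assoc mult_exp_exp add.commute)
        have "exp (real_of_int n * lam i) \<le> D r k * exp (real_of_int \<bar>n\<bar> / real (Suc k)) * norm (cocycle M n x *v v)"
        proof -
          have "exp (real_of_int n * lam i) \<le> pesin_const CARD('d) lam * exp (12 * H k * (real (L r k) + real_of_int \<bar>n\<bar>)) * norm (cocycle M n x *v v)"
            using gr[of 0 n] by (simp add: cocycle_0[OF cl] v1)
          also have "\<dots> \<le> D r k * exp (real_of_int \<bar>n\<bar> / real (Suc k)) * norm (cocycle M n x *v v)"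
            by (intro mult_right_mono e) simp
          finally show ?thesis .
        qed
        then have "exp (- (real_of_int \<bar>n\<bar> / real (Suc k))) * exp (real_of_int n * lam i) \<le>
            exp (- (real_of_int \<bar>n\<bar> / real (Suc k))) * (D r k * exp (real_of_int \<bar>n\<bar> / real (Suc k)) * norm (cocycle M n x *v v))"
          by (intro mult_left_mono) auto
        moreover have "exp (- t) * (D r k * exp t * y) = D r k * y" for t y :: real
          by (simp add: exp_minus)
        moreover have "exp (- t) * exp s = exp (s - t)" for s t :: real
          by (simp add: mult_exp_exp)
        ultimately have "?lo k n" by metis
        with \<open>?up k n\<close> show "?up k n \<and> ?lo k n" by blast
      qed
    next
      assume *: "\<forall>k n. ?up k n \<and> ?lo k n"
      show "v \<in> oseledets_space M (lam i) x"
      proof (rule oseledetsI[of M x v "D r" "lam i"])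
        show "norm (cocycle M n x *v v) > 0" for n
          using invertible_mult_nonzero[OF invertible_cocycle[OF cl xs] v1(2)] by simp
      qed (use * Dpos v1 in auto)
    }
  qed
  define w where "w i m n = exp (- (of_int (n - m) * lam i)) * exp (- (of_int (\<bar>n\<bar> + \<bar>m\<bar>) * \<epsilon> / 2))" for i and m n :: int
  define S where "S r i m n q = {x\<in>sft Q. \<exists>v\<in>sphere 0 1.
      (\<forall>k n. norm (cocycle M n x *v v) \<le> D r k * exp (real_of_int n * lam i + real_of_int \<bar>n\<bar> / real (Suc k)) \<and>
             exp (real_of_int n * lam i - real_of_int \<bar>n\<bar> / real (Suc k)) \<le> D r k * norm (cocycle M n x *v v)) \<and>
      (C + 1 / real (Suc q)) * norm (cocycle M m x *v v) \<le> norm (cocycle M n x *v v) * w i m n}" for r i m n and q :: nat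
  have S: "S r i m n q \<in> sets \<mu>" for r i m n q
  proof -
    \<comment> \<open>All conditions as one family \<open>f j \<le> g j\<close>: \<open>None\<close>
      encodes the ratio condition, \<open>Some (k, n', b)\<close> the upper or lower growth bound
      according to \<open>b\<close>.\<close>
    define f where "f j x v = (case j of None \<Rightarrow> (C + 1 / real (Suc q)) * norm (cocycle M m x *v v)
       | Some (k, n', b) \<Rightarrow> if b then norm (cocycle M n' x *v v) else exp (real_of_int n' * lam i - real_of_int \<bar>n'\<bar> / real (Suc k)))"
      for j :: "(nat \<times> int \<times> bool) option" and x and v :: "real^'d"
    define g where "g j x v = (case j of None \<Rightarrow> norm (cocycle M n x *v v) * w i m n
       | Some (k, n', b) \<Rightarrow> if b then D r k * exp (real_of_int n' * lam i + real_of_int \<bar>n'\<bar> / real (Suc k)) else D r k * norm (cocycle M n' x *v v))"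
      for j :: "(nat \<times> int \<times> bool) option" and x and v :: "real^'d"
    have "closedin (sft_topology Q) {x\<in>sft Q. \<exists>v\<in>sphere 0 1. \<forall>j. f j x v \<le> g j x v}"
    proof (rule closedin_projection)
      fix j :: "(nat \<times> int \<times> bool) option"
      show "continuous_map (prod_topology (sft_topology Q) (top_of_set (sphere 0 1))) euclideanreal (\<lambda>p. f j (fst p) (snd p))"
      proof (cases j)
        case None
        then show ?thesis
          by (simp add: f_def) (intro continuous_map_real_mult continuous_cocycle_norm[OF cl] continuous_map_canonical_const)
      next
        case (Some a)
        then obtain k n' b where "j = Some (k, n', b)" by (cases a) auto
        then show ?thesis
          by (cases b) (simp_all add: f_def continuous_map_real_mult continuous_cocycle_norm[OF cl])
      qed
      show "continuous_map (prod_topology (sft_topology Q) (top_of_set (sphere 0 1))) euclideanreal (\<lambda>p. g j (fst p) (snd p))"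
      proof (cases j)
        case None
        then show ?thesis
          by (simp add: g_def) (intro continuous_map_real_mult continuous_cocycle_norm[OF cl] continuous_map_canonical_const)
      next
        case (Some a)
        then obtain k n' b where "j = Some (k, n', b)" by (cases a) auto
        then show ?thesis
          by (cases b) (simp_all add: g_def continuous_map_real_mult continuous_cocycle_norm[OF cl])
      qed
    qed
    moreover have "(\<forall>j. f j x v \<le> g j x v) \<longleftrightarrow>
        (\<forall>k n. norm (cocycle M n x *v v) \<le> D r k * exp (real_of_int n * lam i + real_of_int \<bar>n\<bar> / real (Suc k)) \<and>
             exp (real_of_int n * lam i - real_of_int \<bar>n\<bar> / real (Suc k)) \<le> D r k * norm (cocycle M n x *v v)) \<and>
        (C + 1 / real (Suc q)) * norm (cocycle M m x *v v) \<le> norm (cocycle M n x *v v) * w i m n" for x v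
      unfolding split_option_all split_paired_All by (simp add: f_def g_def all_bool_eq conj_commute)
    ultimately show ?thesis
      unfolding S_def by (simp add: gibbs_closed_sets[OF \<mu>])
  qed
  have eq: "{x\<in>sft Q. pesin_function M lam \<epsilon> x > ennreal C} \<inter> G r = G r \<inter> (\<Union>i\<in>?I. \<Union>m. \<Union>n. \<Union>q. S r i m n q)" for r
  proof (intro equalityI subsetI)
    fix x assume x: "x \<in> {x\<in>sft Q. pesin_function M lam \<epsilon> x > ennreal C} \<inter> G r"
    then obtain i v m n and q :: nat where i: "i \<in> ?I" and v: "v \<in> sphere 0 1" "v \<in> oseledets_space M (lam i) x"
      and ratio: "(C + 1 / real (Suc q)) * norm (cocycle M m x *v v) \<le> norm (cocycle M n x *v v) * w i m n"
      using pesin_function_gt_iff[OF cl _ C, of x lam \<epsilon>] unfolding w_def by blast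
    have "x \<in> S r i m n q"
      unfolding S_def using x v ratio char[OF _ v(1) i, of x r] by blast
    then show "x \<in> G r \<inter> (\<Union>i\<in>?I. \<Union>m. \<Union>n. \<Union>q. S r i m n q)" using x i by blast
  next
    fix x assume "x \<in> G r \<inter> (\<Union>i\<in>?I. \<Union>m. \<Union>n. \<Union>q. S r i m n q)"
    then obtain i m n q where x: "x \<in> G r" and i: "i \<in> ?I" and xS: "x \<in> S r i m n q" by blast
    then obtain v where v: "x \<in> sft Q" "v \<in> sphere 0 1"
      "\<forall>k n. norm (cocycle M n x *v v) \<le> D r k * exp (real_of_int n * lam i + real_of_int \<bar>n\<bar> / real (Suc k)) \<and>
             exp (real_of_int n * lam i - real_of_int \<bar>n\<bar> / real (Suc k)) \<le> D r k * norm (cocycle M n x *v v)"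
      "(C + 1 / real (Suc q)) * norm (cocycle M m x *v v) \<le> norm (cocycle M n x *v v) * w i m n"
      unfolding S_def by blast
    have "v \<in> oseledets_space M (lam i) x" using char[OF x v(2) i] v(3) by blast
    then have "pesin_function M lam \<epsilon> x > ennreal C"
      using pesin_function_gt_iff[OF cl v(1) C, of lam \<epsilon>] i v(2,4) unfolding w_def by blast
    then show "x \<in> {x\<in>sft Q. pesin_function M lam \<epsilon> x > ennreal C} \<inter> G r" using v(1) x by blast
  qed
  define V where "V = (\<Union>r. {x\<in>sft Q. pesin_function M lam \<epsilon> x > ennreal C} \<inter> G r)"
  have "finite ?I" by (simp add: distinct_exponent_indices_def)
  then have V: "V \<in> sets \<mu>"
    unfolding V_def eq by (intro sets.countable_UN sets.Int G sets.finite_UN image_subsetI S) auto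
  define N where "N = space \<mu> - (\<Union>r. G r)"
  have N: "N \<in> sets \<mu>" unfolding N_def using G by auto
  have "measure \<mu> N \<le> 2 / real (Suc r)" for r
  proof -
    have sums: "(\<lambda>k. (1 / 2) ^ k / real (Suc r)) sums (2 / real (Suc r))"
      using sums_divide[OF geometric_sums[of "1 / 2 :: real"]] by simp
    have neg: "{x\<in>space \<mu>. \<not> regular M lam (H k) (L r k) x} \<in> sets \<mu>" for k
      by (rule sets.sets_Collect_neg[OF reg])
    have le: "\<P>(x in \<mu>. \<not> regular M lam (H k) (L r k) x) \<le> (1 / 2) ^ k / real (Suc r)" for k
      using L[of k r] by simp
    have sm: "summable (\<lambda>k. \<P>(x in \<mu>. \<not> regular M lam (H k) (L r k) x))"
      by (rule summable_comparison_test'[OF sums_summable[OF sums], of 0]) (use le in simp)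
    have "measure \<mu> N \<le> measure \<mu> (\<Union>k. {x\<in>space \<mu>. \<not> regular M lam (H k) (L r k) x})"
      using neg by (intro finite_measure_mono sets.countable_UN) (auto simp: N_def G_def)
    also have "\<dots> \<le> (\<Sum>k. \<P>(x in \<mu>. \<not> regular M lam (H k) (L r k) x))"
      using neg by (intro finite_measure_subadditive_countably sm) auto
    also have "\<dots> \<le> (\<Sum>k. (1 / 2) ^ k / real (Suc r))"
      by (intro suminf_le le sm sums_summable[OF sums])
    also have "\<dots> = 2 / real (Suc r)" by (rule sums_unique[OF sums, symmetric])
    finally show ?thesis .
  qed
  note N_le = this
  have "measure \<mu> N < e" if "e > 0" for e
  proof -
    have "e / 2 > 0" using that by simp
    then obtain r where "1 / real (Suc r) < e / 2" by (rule nat_approx_posE)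
    then have "2 / real (Suc r) < e" by simp
    with N_le[of r] show ?thesis by linarith
  qed
  from this[of "measure \<mu> N"] have "measure \<mu> N = 0"
    using measure_nonneg[of \<mu> N] by linarith
  then have "N \<in> null_sets \<mu>" using N by (simp add: null_sets_def emeasure_eq_measure)
  \<comment> \<open>The points outside all \<open>G r\<close> form a null set; no control of the
    level set is available there, and the completion takes care of it.\<close>
  moreover have "{x\<in>sft Q. pesin_function M lam \<epsilon> x > ennreal C} =
      V \<union> ({x\<in>sft Q. pesin_function M lam \<epsilon> x > ennreal C} \<inter> N)"
    by (auto simp: V_def N_def sp)
  ultimately show ?thesis
    using V by (intro sets_completionI[of _ V "{x\<in>sft Q. pesin_function M lam \<epsilon> x > ennreal C} \<inter> N" N]) auto
qed

theorem theorem1p7: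
  fixes Q :: "'a::finite \<Rightarrow> 'a \<Rightarrow> bool"
    and \<phi> :: "(int \<Rightarrow> 'a) \<Rightarrow> real"
    and \<mu> :: "(int \<Rightarrow> 'a) measure"
    and M :: "(int \<Rightarrow> 'a) \<Rightarrow> real^'d^'d"
    and lam :: "nat \<Rightarrow> real"
    and \<epsilon> \<delta> :: real
  assumes "sft_transitive Q"
    and "hoelder_on_sft Q \<phi>"
    and "gibbs_measure Q \<phi> \<mu>"
    and "continuous_linear_cocycle Q M"
    and "lyapunov_exponents \<mu> M lam"
    and "exp_large_deviations_pos \<mu> M lam"
    and "exp_large_deviations_neg \<mu> M lam"
    and "\<epsilon> > 0" and "\<delta> > 0"
  shows "\<exists>C>0. \<forall>n::nat.
    {x \<in> space \<mu>. real (card {j \<in> {..<n}. pesin_function M lam \<epsilon> (shift_pow (int j) x) > ennreal C})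
                   \<ge> \<delta> * real n} \<in> sets (completion \<mu>) \<and>
    measure (completion \<mu>)
      {x \<in> space \<mu>. real (card {j \<in> {..<n}. pesin_function M lam \<epsilon> (shift_pow (int j) x) > ennreal C})
                     \<ge> \<delta> * real n}
      \<le> C * exp (- (1 / C) * real n)"
proof -
  note \<mu> = assms(3) and cl = assms(4) and ld = assms(6)
  interpret prob_space \<mu> by (rule gibbs_prob_space[OF \<mu>])
  note sp = gibbs_space[OF \<mu>]
  have dec: "\<And>k. k \<in> {1..<CARD('d)} \<Longrightarrow> lam (Suc k) \<le> lam k"
    using assms(5) by (simp add: lyapunov_exponents_def)
  have "\<epsilon> / 24 > 0" using assms(8) by simp
  then obtain \<eta> where \<eta>: "small_rate CARD('d) lam \<eta>" "\<eta> \<le> \<epsilon> / 24" by (rule small_rate_exists)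
  then have "\<eta> > 0" by (simp add: small_rate_def)
  from regular_count[OF cl \<mu> ld this assms(9)]
  obtain L Z where Z: "\<And>n. Z n \<in> sets \<mu>" "exp_small (\<lambda>n. measure \<mu> (Z n))"
    "\<And>x n. x \<in> space \<mu> \<Longrightarrow>
      real (card {j\<in>{..<n}. \<not> regular M lam \<eta> L (shift_pow (int j) x)}) \<ge> \<delta> * real n \<Longrightarrow> x \<in> Z n"
    by blast
  obtain C1 where C1: "C1 > 0" "\<And>n. measure \<mu> (Z n) \<le> C1 * exp (- (1 / C1) * real n)"
    using Z(2) by (auto simp: exp_small_def)
  \<comment> \<open>The same \<open>C\<close> is the level for the Pesin function and the constant
    of the estimate; enlarging it raises the level and weakens the estimate, so a maximum serves
    both.\<close>
  define C where "C = max C1 (pesin_const CARD('d) lam * exp (12 * \<eta> * real L))"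
  have C: "C > 0" using C1 by (simp add: C_def)
  have pesin: "pesin_function M lam \<epsilon> x \<le> ennreal C" if "x \<in> sft Q" "regular M lam \<eta> L x" for x
    using regular_pesin_bound[OF cl that \<eta> dec] by (rule order_trans) (auto simp: C_def intro!: ennreal_leI)
  define S where "S n = {x \<in> space \<mu>. real (card {j \<in> {..<n}. pesin_function M lam \<epsilon> (shift_pow (int j) x) > ennreal C}) \<ge> \<delta> * real n}" for n
  have meas: "S n \<in> sets (completion \<mu>)" for n
  proof -
    define B where "B j = {x \<in> space (completion \<mu>). pesin_function M lam \<epsilon> (shift_pow (int j) x) > ennreal C}" for j
    have B: "B j \<in> sets (completion \<mu>)" for j
    proof -
      have "B j = shift_pow (int j) -` {x\<in>sft Q. pesin_function M lam \<epsilon> x > ennreal C} \<inter> space \<mu>"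
        by (auto simp: B_def sp)
      then show ?thesis
        using gibbs_completion_shift[OF \<mu> pesin_level_sets[OF cl \<mu> ld _ dec]] C by simp
    qed
    \<comment> \<open>Splits according to the exact set \<open>R\<close> of times at which the level
      is exceeded. There are finitely many such \<open>R\<close>, and each piece is a Boolean
      combination of the sets \<open>B j\<close>.\<close>
    have "S n = (\<Union>R\<in>{R\<in>Pow {..<n}. real (card R) \<ge> \<delta> * real n}. {x\<in>space (completion \<mu>).
        \<forall>j\<in>{..<n}. (x \<in> B j) = (j \<in> R)})"
    proof (intro equalityI subsetI)
      fix x assume "x \<in> S n"
      then show "x \<in> (\<Union>R\<in>{R\<in>Pow {..<n}. real (card R) \<ge> \<delta> * real n}. {x\<in>space (completion \<mu>). \<forall>j\<in>{..<n}. (x \<in> B j) = (j \<in> R)})"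
        by (intro UN_I[of "{j \<in> {..<n}. pesin_function M lam \<epsilon> (shift_pow (int j) x) > ennreal C}"]) (auto simp: S_def B_def)
    next
      fix x assume "x \<in> (\<Union>R\<in>{R\<in>Pow {..<n}. real (card R) \<ge> \<delta> * real n}. {x\<in>space (completion \<mu>). \<forall>j\<in>{..<n}. (x \<in> B j) = (j \<in> R)})"
      then obtain R where R: "R \<subseteq> {..<n}" "real (card R) \<ge> \<delta> * real n" "x \<in> space \<mu>" "\<forall>j\<in>{..<n}. (x \<in> B j) = (j \<in> R)"
        by auto
      then have "R = {j \<in> {..<n}. pesin_function M lam \<epsilon> (shift_pow (int j) x) > ennreal C}"
        by (auto simp: B_def)
      then show "x \<in> S n" using R by (simp add: S_def)
    qed
    also have "\<dots> \<in> sets (completion \<mu>)"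
    proof (rule sets.finite_UN)
      show "{x\<in>space (completion \<mu>). \<forall>j\<in>{..<n}. (x \<in> B j) = (j \<in> R)} \<in> sets (completion \<mu>)" for R
      proof (rule sets.sets_Collect_finite_All)
        fix j
        have "{x\<in>space (completion \<mu>). (x \<in> B j) = (j \<in> R)} = (if j \<in> R then B j else space (completion \<mu>) - B j)"
          by (auto simp: B_def)
        then show "{x\<in>space (completion \<mu>). (x \<in> B j) = (j \<in> R)} \<in> sets (completion \<mu>)"
          using B[of j] by auto
      qed simp
    qed simp
    finally show ?thesis .
  qed
  have bound: "measure (completion \<mu>) (S n) \<le> C * exp (- (1 / C) * real n)" for n
  proof -
    interpret comp: finite_measure "completion \<mu>"
      by (rule finite_measureI) (simp add: emeasure_space_1)
    have "S n \<subseteq> Z n"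
    proof
      fix x assume x: "x \<in> S n"
      then have "x \<in> sft Q" by (simp add: S_def sp)
      have "card {j \<in> {..<n}. pesin_function M lam \<epsilon> (shift_pow (int j) x) > ennreal C} \<le>
          card {j\<in>{..<n}. \<not> regular M lam \<eta> L (shift_pow (int j) x)}"
      proof (rule card_mono)
        show "{j \<in> {..<n}. pesin_function M lam \<epsilon> (shift_pow (int j) x) > ennreal C} \<subseteq> {j\<in>{..<n}. \<not> regular M lam \<eta> L (shift_pow (int j) x)}"
        proof
          fix j assume "j \<in> {j \<in> {..<n}. pesin_function M lam \<epsilon> (shift_pow (int j) x) > ennreal C}"
          then show "j \<in> {j\<in>{..<n}. \<not> regular M lam \<eta> L (shift_pow (int j) x)}"
            using pesin[of "shift_pow (int j) x"] \<open>x \<in> sft Q\<close> by (auto simp: not_le[symmetric])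
        qed
      qed simp
      then show "x \<in> Z n" using x by (intro Z(3)) (auto simp: S_def)
    qed
    then have "measure (completion \<mu>) (S n) \<le> measure (completion \<mu>) (Z n)"
      using Z(1) by (intro comp.finite_measure_mono) auto
    also have "\<dots> = measure \<mu> (Z n)" by (rule measure_completion[OF Z(1)])
    also have "\<dots> \<le> C1 * exp (- (1 / C1) * real n)" by (rule C1)
    also have "\<dots> \<le> C * exp (- (1 / C) * real n)"
    proof (intro mult_mono)
      have "1 / C \<le> 1 / C1" using C1(1) by (intro divide_left_mono) (auto simp: C_def)
      then have "1 / C * real n \<le> 1 / C1 * real n" by (rule mult_right_mono) simp
      then show "exp (- (1 / C1) * real n) \<le> exp (- (1 / C) * real n)"
        unfolding exp_le_cancel_iff by linarith
    qed (use C in \<open>auto simp: C_def\<close>)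
    finally show ?thesis .
  qed
  show ?thesis using C meas bound unfolding S_def by blast
qed

end
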